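(* Let $X$ be a complete $RN$ module over $K$ with base $(\Omega,\mathcal F,P)$, let $C\in B(X)$ be injective, and let $\{V(s):s\ge0\}$ be a locally a.s. bounded $C$-semigroup on $X$ with generator $(A,D(A))$. Then: (1) $\lim_{s\downarrow0}\frac1s\int_0^sV(u)z\,du=Cz$ for any $z\in X$; (2) for any $z\in X$ and $s\ge0$, $\int_0^sV(u)z\,du\in D(A)$ and $A\int_0^sV(u)z\,du=V(s)z-Cz$; (3) $R(C)\subseteq\overline{D(A)}$; (4) for any $z\in D(A)$ and $s\ge0$, $V(s)z\in D(A)$ and $\frac{dV(s)z}{ds}=V(s)Az=AV(s)z$; (5) for any $z\in D(A)$ and $s\ge0$, $\int_0^sV(u)Az\,du=V(s)z-Cz$; (6) $A$ is a closed module homomorphism and satisfies $C^{-1}AC=A$.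
   Context: $(\Omega,\mathcal F,P)$ is a probability space, $K=\mathbb R$ or $\mathbb C$, $L^0(\mathcal F,K)$ is the algebra of equivalence classes (a.s. equality) of $K$-valued $\mathcal F$-measurable random variables, $\bar L^0(\mathcal F,R)$ the complete lattice of equivalence classes of extended real-valued random variables under a.s. order, and $L^0_+(\mathcal F)=\{\xi\in L^0(\mathcal F,R):\xi\ge 0\}$. $\bigvee$ and $\bigwedge$ denote supremum and infimum in $\bar L^0(\mathcal F,R)$. An $RN$ module over $K$ with base $(\Omega,\mathcal F,P)$ is an $L^0(\mathcal F,K)$-module $X$ with a map $\|\cdot\|:X\to L^0_+(\mathcal F)$ (the $L^0$-norm) such that $\|\xi x\|=|\xi|\|x\|$ for all $\xi\in L^0(\mathcal F,K)$, $x\in X$; $\|x+y\|\le\|x\|+\|y\|$; and $\|x\|=0$ implies $x=0$. It carries the $(\varepsilon,\lambda)$-topology, the metrizable linear topology with local base at $0$ given by $\{z: P(\|z\|<\varepsilon)>\lambda\}$, $\varepsilon>0$, $0<\lambda<1$; so $z_n\to z$ iff $\|z_n-z\|\to0$ in probability. Completeness, closures, limits, continuity, derivatives (one-sided at endpoints), Riemann integrals (limits of Riemann sums) and closedness of operators are in this topology. A linear operator $T:X\to X$ is a.s. bounded if there is $\eta\in L^0_+(\mathcal F)$ with $\|Tz\|\le\eta\|z\|$ for all $z\in X$; $B(X)$ is the set of these (equivalently, the continuous module homomorphisms on $X$), and $\|T\|=\bigwedge\{\eta\in L^0_+(\mathcal F):\|Tz\|\le\eta\|z\|\ \forall z\in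 X\}$. A module homomorphism is an $L^0(\mathcal F,K)$-linear map. $R(C)$ is the range of $C$. $C$-semigroup on $X$ ($C\in B(X)$ injective): a family $\{V(s):s\ge0\}\subset B(X)$ such that $s\mapsto V(s)z$ is continuous from $[0,\infty)$ to $X$ for every $z\in X$; $V(0)=C$; and $CV(s+t)=V(s)V(t)$ for all $s,t\ge0$. It is locally a.s. bounded if $\bigvee_{s\in[0,l]}\|V(s)\|\in L^0_+(\mathcal F)$ for every $l>0$. Its generator $(A,D(A))$ is given by $D(A)=\{z\in X:\lim_{s\downarrow0}\frac{V(s)z-Cz}{s}\text{ exists and belongs to }R(C)\}$ and $Az=C^{-1}\lim_{s\downarrow0}\frac{V(s)z-Cz}{s}$ for $z\in D(A)$. $C^{-1}AC$ has domain $\{x\in X:Cx\in D(A),\ ACx\in R(C)\}$; the equality $C^{-1}AC=A$ includes equality of domains. *)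

theory Defs
  imports
    "HOL-Probability.Probability"
    "HOL-Algebra.Module"
    "HOL-Algebra.Complete_Lattice"
begin

section \<open>Equivalence classes of random variables\<close>

definition ae_rel :: "'a measure \<Rightarrow> (('a \<Rightarrow> 'b::topological_space) \<times> ('a \<Rightarrow> 'b)) set" where
  "ae_rel M = {(f, g). f \<in> borel_measurable M \<and> g \<in> borel_measurable M \<and> (AE x in M. f x = g x)}"

text \<open>With values in the scalar field this is the set underlying $L^0(\mathcal F, K)$;
  with values in \<^typ>\<open>ereal\<close> it is $\bar L^0(\mathcal F, R)$.\<close>

definition L0 :: "'a measure \<Rightarrow> ('a \<Rightarrow> 'b::topological_space) set set" where
  "L0 M = borel_measurable M // ae_rel M"

definition L0_class :: "'a measure \<Rightarrow> ('a \<Rightarrow> 'b::topological_space) \<Rightarrow> ('a \<Rightarrow> 'b) set" where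
  "L0_class M f = ae_rel M `` {f}"

text \<open>An arbitrary representative; everything below depends on it only up to a.s. equality.\<close>

definition L0_rep :: "('a \<Rightarrow> 'b) set \<Rightarrow> 'a \<Rightarrow> 'b" where
  "L0_rep \<xi> = (SOME f. f \<in> \<xi>)"

definition L0_const :: "'a measure \<Rightarrow> 'b::topological_space \<Rightarrow> ('a \<Rightarrow> 'b) set" where
  "L0_const M c = L0_class M (\<lambda>_. c)"

definition L0_le :: "'a measure \<Rightarrow> ('a \<Rightarrow> 'b::{topological_space, ord}) set \<Rightarrow> ('a \<Rightarrow> 'b) set \<Rightarrow> bool" where
  "L0_le M \<xi> \<eta> \<longleftrightarrow> (AE x in M. L0_rep \<xi> x \<le> L0_rep \<eta> x)"

text \<open>The scalars range over a type of sort \<open>{real_normed_field, euclidean_space}\<close>. By the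
  Frobenius theorem (or Gelfand-Mazur) its instances are, up to isometric isomorphism,
  exactly \<^typ>\<open>real\<close> and \<^typ>\<open>complex\<close>, so this renders $K = R$ or $C$.\<close>

definition L0_ring :: "'a measure \<Rightarrow> ('a \<Rightarrow> 'k::{real_normed_field, euclidean_space}) set ring" where
  "L0_ring M =
    \<lparr>carrier = L0 M,
     mult = (\<lambda>\<xi> \<eta>. L0_class M (\<lambda>x. L0_rep \<xi> x * L0_rep \<eta> x)),
     one = L0_const M 1,
     zero = L0_const M 0,
     add = (\<lambda>\<xi> \<eta>. L0_class M (\<lambda>x. L0_rep \<xi> x + L0_rep \<eta> x))\<rparr>"

lemma L0_class_in_L0: "f \<in> borel_measurable M \<Longrightarrow> L0_class M f \<in> L0 M"
  by (auto simp: L0_def L0_class_def quotient_def)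

lemma L0_class_eqI:
  assumes "f \<in> borel_measurable M" "g \<in> borel_measurable M" "AE x in M. f x = g x"
  shows "L0_class M f = L0_class M g"
proof -
  have "(AE x in M. f x = h x) \<longleftrightarrow> (AE x in M. g x = h x)" for h
    by (rule eventually_cong[OF assms(3)]) simp
  then show ?thesis using assms(1,2) by (auto simp: L0_class_def ae_rel_def)
qed

lemma L0_rep:
  assumes "\<xi> \<in> L0 M"
  shows L0_rep_measurable: "L0_rep \<xi> \<in> borel_measurable M"
    and L0_class_rep: "L0_class M (L0_rep \<xi>) = \<xi>"
proof -
  obtain f where f: "f \<in> borel_measurable M" "\<xi> = ae_rel M `` {f}"
    using assms by (auto simp: L0_def quotient_def)
  then have "f \<in> \<xi>" by (auto simp: ae_rel_def)
  then have "L0_rep \<xi> \<in> \<xi>" unfolding L0_rep_def by (rule someI[of "\<lambda>h. h \<in> _"])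
  then have *: "L0_rep \<xi> \<in> borel_measurable M" "AE x in M. f x = L0_rep \<xi> x"
    using f by (auto simp: ae_rel_def)
  then show "L0_rep \<xi> \<in> borel_measurable M" by simp
  show "L0_class M (L0_rep \<xi>) = \<xi>"
    using L0_class_eqI[OF f(1) *] f by (simp add: L0_class_def)
qed

lemma L0_rep_class:
  assumes "f \<in> borel_measurable M"
  shows "AE x in M. L0_rep (L0_class M f) x = f x"
proof -
  have "f \<in> L0_class M f" using assms by (auto simp: L0_class_def ae_rel_def)
  then have "L0_rep (L0_class M f) \<in> L0_class M f" unfolding L0_rep_def by (rule someI[of "\<lambda>h. h \<in> _"])
  then have "AE x in M. f x = L0_rep (L0_class M f) x"
    unfolding L0_class_def ae_rel_def by blast
  then show ?thesis by eventually_elim simp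
qed

lemma cring_L0_ring: "cring (L0_ring M :: ('a \<Rightarrow> 'k::{real_normed_field, euclidean_space}) set ring)"
proof -
  let ?R = "L0_ring M :: ('a \<Rightarrow> 'k) set ring"
  have carr: "\<exists>f \<in> borel_measurable M. \<xi> = L0_class M f" if "\<xi> \<in> carrier ?R" for \<xi>
    using that L0_rep[of \<xi> M] by (auto simp: L0_ring_def)
  have cl: "L0_class M f \<in> carrier ?R" if "f \<in> borel_measurable M" for f
    using that by (simp add: L0_ring_def L0_class_in_L0)
  have add: "L0_class M f \<oplus>\<^bsub>?R\<^esub> L0_class M g = L0_class M (\<lambda>x. f x + g x)"
    and mult: "L0_class M f \<otimes>\<^bsub>?R\<^esub> L0_class M g = L0_class M (\<lambda>x. f x * g x)"
    if [measurable]: "f \<in> borel_measurable M" "g \<in> borel_measurable M" for f g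
  proof -
    have [measurable]: "L0_rep (L0_class M f) \<in> borel_measurable M"
      "L0_rep (L0_class M g) \<in> borel_measurable M"
      by (simp_all add: L0_rep_measurable L0_class_in_L0)
    show "L0_class M f \<oplus>\<^bsub>?R\<^esub> L0_class M g = L0_class M (\<lambda>x. f x + g x)"
      unfolding L0_ring_def monoid.simps ring.simps
    proof (rule L0_class_eqI)
      show "AE x in M. L0_rep (L0_class M f) x + L0_rep (L0_class M g) x = f x + g x"
        using L0_rep_class[OF that(1)] L0_rep_class[OF that(2)] by eventually_elim simp
    qed measurable
    show "L0_class M f \<otimes>\<^bsub>?R\<^esub> L0_class M g = L0_class M (\<lambda>x. f x * g x)"
      unfolding L0_ring_def monoid.simps ring.simps
    proof (rule L0_class_eqI)
      show "AE x in M. L0_rep (L0_class M f) x * L0_rep (L0_class M g) x = f x * g x"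
        using L0_rep_class[OF that(1)] L0_rep_class[OF that(2)] by eventually_elim simp
    qed measurable
  qed
  have zero: "\<zero>\<^bsub>?R\<^esub> = L0_class M (\<lambda>_. 0)"
    and one: "\<one>\<^bsub>?R\<^esub> = L0_class M (\<lambda>_. 1)"
    by (simp_all add: L0_ring_def L0_const_def)
  note R_simps = add mult zero one cl borel_measurable_add borel_measurable_times
    borel_measurable_uminus borel_measurable_const
  show ?thesis
  proof (intro cringI abelian_groupI comm_monoidI)
    fix \<xi> \<eta> \<zeta> assume "\<xi> \<in> carrier ?R" "\<eta> \<in> carrier ?R" "\<zeta> \<in> carrier ?R"
    then obtain f g h where m: "f \<in> borel_measurable M" "g \<in> borel_measurable M"
      "h \<in> borel_measurable M" and eq: "\<xi> = L0_class M f" "\<eta> = L0_class M g" "\<zeta> = L0_class M h"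
      using carr by metis
    show "\<xi> \<oplus>\<^bsub>?R\<^esub> \<eta> \<oplus>\<^bsub>?R\<^esub> \<zeta> = \<xi> \<oplus>\<^bsub>?R\<^esub> (\<eta> \<oplus>\<^bsub>?R\<^esub> \<zeta>)"
      "\<xi> \<otimes>\<^bsub>?R\<^esub> \<eta> \<otimes>\<^bsub>?R\<^esub> \<zeta> = \<xi> \<otimes>\<^bsub>?R\<^esub> (\<eta> \<otimes>\<^bsub>?R\<^esub> \<zeta>)"
      "(\<xi> \<oplus>\<^bsub>?R\<^esub> \<eta>) \<otimes>\<^bsub>?R\<^esub> \<zeta> = \<xi> \<otimes>\<^bsub>?R\<^esub> \<zeta> \<oplus>\<^bsub>?R\<^esub> \<eta> \<otimes>\<^bsub>?R\<^esub> \<zeta>"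
      using m by (simp_all add: eq R_simps algebra_simps)
  next
    fix \<xi> \<eta> assume "\<xi> \<in> carrier ?R" "\<eta> \<in> carrier ?R"
    then obtain f g where m: "f \<in> borel_measurable M" "g \<in> borel_measurable M"
      and eq: "\<xi> = L0_class M f" "\<eta> = L0_class M g"
      using carr by metis
    show "\<xi> \<oplus>\<^bsub>?R\<^esub> \<eta> \<in> carrier ?R" "\<xi> \<otimes>\<^bsub>?R\<^esub> \<eta> \<in> carrier ?R"
      "\<xi> \<oplus>\<^bsub>?R\<^esub> \<eta> = \<eta> \<oplus>\<^bsub>?R\<^esub> \<xi>" "\<xi> \<otimes>\<^bsub>?R\<^esub> \<eta> = \<eta> \<otimes>\<^bsub>?R\<^esub> \<xi>"
      using m by (simp_all add: eq R_simps ac_simps)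
  next
    fix \<xi> assume "\<xi> \<in> carrier ?R"
    then obtain f where m: "f \<in> borel_measurable M" and eq: "\<xi> = L0_class M f"
      using carr by metis
    show "\<zero>\<^bsub>?R\<^esub> \<oplus>\<^bsub>?R\<^esub> \<xi> = \<xi>" "\<one>\<^bsub>?R\<^esub> \<otimes>\<^bsub>?R\<^esub> \<xi> = \<xi>"
      using m by (simp_all add: eq R_simps)
    show "\<exists>\<eta>\<in>carrier ?R. \<eta> \<oplus>\<^bsub>?R\<^esub> \<xi> = \<zero>\<^bsub>?R\<^esub>"
      using m by (intro bexI[of _ "L0_class M (\<lambda>x. - f x)"]) (simp_all add: eq R_simps)
  qed (simp_all add: R_simps)
qed

definition L0_abs :: "'a measure \<Rightarrow> ('a \<Rightarrow> 'k::real_normed_vector) set \<Rightarrow> ('a \<Rightarrow> real) set" where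
  "L0_abs M \<xi> = L0_class M (\<lambda>x. norm (L0_rep \<xi> x))"

definition L0_plus :: "'a measure \<Rightarrow> ('a \<Rightarrow> real) set set" where
  "L0_plus M = {\<xi> \<in> L0 M. L0_le M (L0_const M 0) \<xi>}"

definition L0bar :: "'a measure \<Rightarrow> ('a \<Rightarrow> ereal) set gorder" where
  "L0bar M = \<lparr>carrier = L0 M, eq = (=), le = L0_le M\<rparr>"

text \<open>The inclusion of $L^0(\mathcal F, R)$ into $\bar L^0(\mathcal F, R)$.\<close>

definition L0_ext :: "'a measure \<Rightarrow> ('a \<Rightarrow> real) set \<Rightarrow> ('a \<Rightarrow> ereal) set" where
  "L0_ext M \<xi> = L0_class M (\<lambda>x. ereal (L0_rep \<xi> x))"


section \<open>Random normed modules\<close>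

locale RN_module = prob_space M + RN: Module.module "L0_ring M" X
  for M :: "'a measure"
    and X :: "(('a \<Rightarrow> 'k::{real_normed_field, euclidean_space}) set, 'x) Module.module" +
  fixes nrm :: "'x \<Rightarrow> ('a \<Rightarrow> real) set"
  assumes nrm_closed: "nrm \<in> carrier X \<rightarrow> L0_plus M"
    and nrm_smult: "\<lbrakk>\<xi> \<in> L0 M; x \<in> carrier X\<rbrakk> \<Longrightarrow>
          nrm (\<xi> \<odot>\<^bsub>X\<^esub> x) = L0_abs M \<xi> \<otimes>\<^bsub>L0_ring M\<^esub> nrm x"
    and nrm_triangle: "\<lbrakk>x \<in> carrier X; y \<in> carrier X\<rbrakk> \<Longrightarrow>
          L0_le M (nrm (x \<oplus>\<^bsub>X\<^esub> y)) (nrm x \<oplus>\<^bsub>L0_ring M\<^esub> nrm y)"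
    and nrm_zeroD: "\<lbrakk>x \<in> carrier X; nrm x = L0_const M 0\<rbrakk> \<Longrightarrow> x = \<zero>\<^bsub>X\<^esub>"

definition scaleK ::
    "'a measure \<Rightarrow> (('a \<Rightarrow> 'k::{real_normed_field, euclidean_space}) set, 'x) Module.module
      \<Rightarrow> 'k \<Rightarrow> 'x \<Rightarrow> 'x" where
  "scaleK M X c x = L0_const M c \<odot>\<^bsub>X\<^esub> x"

definition eps_lambda_nhd ::
    "'a measure \<Rightarrow> (('a \<Rightarrow> 'k::{real_normed_field, euclidean_space}) set, 'x) Module.module
      \<Rightarrow> ('x \<Rightarrow> ('a \<Rightarrow> real) set) \<Rightarrow> real \<Rightarrow> real \<Rightarrow> 'x set" where
  "eps_lambda_nhd M X nrm \<epsilon> \<kappa> =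
    {z \<in> carrier X. measure M {x \<in> space M. L0_rep (nrm z) x < \<epsilon>} > \<kappa>}"

definition eps_lambda_topology ::
    "'a measure \<Rightarrow> (('a \<Rightarrow> 'k::{real_normed_field, euclidean_space}) set, 'x) Module.module
      \<Rightarrow> ('x \<Rightarrow> ('a \<Rightarrow> real) set) \<Rightarrow> 'x topology" where
  "eps_lambda_topology M X nrm = topology (\<lambda>U. U \<subseteq> carrier X \<and>
    (\<forall>x\<in>U. \<exists>\<epsilon>>0. \<exists>\<kappa>. 0 < \<kappa> \<and> \<kappa> < 1 \<and>
      {y \<in> carrier X. y \<ominus>\<^bsub>X\<^esub> x \<in> eps_lambda_nhd M X nrm \<epsilon> \<kappa>} \<subseteq> U))"

lemma (in RN_module) openin_eps_lambda_topology:
  "openin (eps_lambda_topology M X nrm) U \<longleftrightarrow> U \<subseteq> carrier X \<and>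
    (\<forall>x\<in>U. \<exists>\<epsilon>>0. \<exists>\<kappa>. 0 < \<kappa> \<and> \<kappa> < 1 \<and>
      {y \<in> carrier X. y \<ominus>\<^bsub>X\<^esub> x \<in> eps_lambda_nhd M X nrm \<epsilon> \<kappa>} \<subseteq> U)"
proof -
  let ?N = "eps_lambda_nhd M X nrm"
  let ?B = "\<lambda>x \<epsilon> \<kappa>. {y \<in> carrier X. y \<ominus>\<^bsub>X\<^esub> x \<in> ?N \<epsilon> \<kappa>}"
  let ?P = "\<lambda>U. U \<subseteq> carrier X \<and> (\<forall>x\<in>U. \<exists>\<epsilon>>0. \<exists>\<kappa>. 0 < \<kappa> \<and> \<kappa> < 1 \<and> ?B x \<epsilon> \<kappa> \<subseteq> U)"
  have mono: "?N \<epsilon> \<kappa> \<subseteq> ?N \<epsilon>' \<kappa>'" if "\<epsilon> \<le> \<epsilon>'" "\<kappa>' \<le> \<kappa>" for \<epsilon> \<epsilon>' \<kappa> \<kappa>'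
  proof
    fix z assume z: "z \<in> ?N \<epsilon> \<kappa>"
    then have "nrm z \<in> L0 M"
      using nrm_closed by (auto simp: eps_lambda_nhd_def L0_plus_def)
    then have [measurable]: "L0_rep (nrm z) \<in> borel_measurable M" by (rule L0_rep_measurable)
    have "prob {x \<in> space M. L0_rep (nrm z) x < \<epsilon>} \<le> prob {x \<in> space M. L0_rep (nrm z) x < \<epsilon>'}"
      using that by (intro finite_measure_mono) auto
    then show "z \<in> ?N \<epsilon>' \<kappa>'" using z that by (auto simp: eps_lambda_nhd_def)
  qed
  have int: "?P (S \<inter> T)" if S: "?P S" and T: "?P T" for S T
  proof (intro conjI ballI)
    show "S \<inter> T \<subseteq> carrier X" using S by blast
    fix x assume x: "x \<in> S \<inter> T"
    obtain e k where 1: "e > 0" "0 < k" "k < 1" "?B x e k \<subseteq> S" using S x by blast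
    obtain e' k' where 2: "e' > 0" "0 < k'" "k' < 1" "?B x e' k' \<subseteq> T" using T x by blast
    have "?B x (min e e') (max k k') \<subseteq> S \<inter> T"
      using 1(4) 2(4) mono[of "min e e'" e k "max k k'"] mono[of "min e e'" e' k' "max k k'"]
      by auto
    then show "\<exists>\<epsilon>>0. \<exists>\<kappa>. 0 < \<kappa> \<and> \<kappa> < 1 \<and> ?B x \<epsilon> \<kappa> \<subseteq> S \<inter> T"
      using 1(1-3) 2(1-3) by (intro exI[of _ "min e e'"] conjI exI[of _ "max k k'"]) auto
  qed
  have "istopology ?P"
    unfolding istopology_def
  proof (rule conjI; intro allI impI)
    show "?P (S \<inter> T)" if "?P S" "?P T" for S T using that by (rule int)
    show "?P (\<Union>\<K>)" if "\<forall>K\<in>\<K>. ?P K" for \<K>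
    proof (intro conjI ballI)
      show "\<Union>\<K> \<subseteq> carrier X" using that by (intro Union_least) simp
      fix x assume "x \<in> \<Union>\<K>"
      then obtain K where K: "K \<in> \<K>" "x \<in> K" by blast
      have "?P K" using that K(1) by (rule bspec)
      then obtain e k where "e > 0" "0 < k" "k < 1" "?B x e k \<subseteq> K" using K(2) by blast
      then show "\<exists>\<epsilon>>0. \<exists>\<kappa>. 0 < \<kappa> \<and> \<kappa> < 1 \<and> ?B x \<epsilon> \<kappa> \<subseteq> \<Union>\<K>"
        using Union_upper[OF K(1)]
        by (intro exI[of _ e] conjI exI[of _ k]) (auto intro: order_trans)
    qed
  qed
  then show ?thesis unfolding eps_lambda_topology_def by (rule topology_inverse'[THEN fun_cong])
qed

text \<open>The topology is metrizable and translation invariant, so completeness is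
  convergence of Cauchy sequences.\<close>

definition RN_complete ::
    "'a measure \<Rightarrow> (('a \<Rightarrow> 'k::{real_normed_field, euclidean_space}) set, 'x) Module.module
      \<Rightarrow> ('x \<Rightarrow> ('a \<Rightarrow> real) set) \<Rightarrow> bool" where
  "RN_complete M X nrm \<longleftrightarrow>
    (\<forall>f :: nat \<Rightarrow> 'x. range f \<subseteq> carrier X \<longrightarrow>
      (\<forall>\<epsilon>>0. \<forall>\<kappa>. 0 < \<kappa> \<and> \<kappa> < 1 \<longrightarrow>
        (\<exists>N. \<forall>m\<ge>N. \<forall>n\<ge>N. f m \<ominus>\<^bsub>X\<^esub> f n \<in> eps_lambda_nhd M X nrm \<epsilon> \<kappa>)) \<longrightarrow>
      (\<exists>l. limitin (eps_lambda_topology M X nrm) f l sequentially))"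


section \<open>Derivative and Riemann integral\<close>

text \<open>Derivative at \<open>s\<close> relative to \<open>S\<close>; one-sided if \<open>s\<close> is an endpoint of the interval \<open>S\<close>.\<close>

definition RN_has_derivative ::
    "'a measure \<Rightarrow> (('a \<Rightarrow> 'k::{real_normed_field, euclidean_space}) set, 'x) Module.module
      \<Rightarrow> ('x \<Rightarrow> ('a \<Rightarrow> real) set) \<Rightarrow> (real \<Rightarrow> 'x) \<Rightarrow> 'x \<Rightarrow> real \<Rightarrow> real set \<Rightarrow> bool" where
  "RN_has_derivative M X nrm f y s S \<longleftrightarrow>
    limitin (eps_lambda_topology M X nrm)
      (\<lambda>t. scaleK M X (of_real (1 / (t - s))) (f t \<ominus>\<^bsub>X\<^esub> f s)) y (at s within S)"

definition RN_riemann_sum ::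
    "'a measure \<Rightarrow> (('a \<Rightarrow> 'k::{real_normed_field, euclidean_space}) set, 'x) Module.module
      \<Rightarrow> (real \<Rightarrow> 'x) \<Rightarrow> (real \<times> real set) set \<Rightarrow> 'x" where
  "RN_riemann_sum M X f p =
    (\<Oplus>\<^bsub>X\<^esub>q\<in>p. scaleK M X (of_real (measure lborel (snd q))) (f (fst q)))"

text \<open>The gauge is a ball of constant radius, so this is the Riemann (not the
  Henstock-Kurzweil) integral.\<close>

definition RN_has_integral ::
    "'a measure \<Rightarrow> (('a \<Rightarrow> 'k::{real_normed_field, euclidean_space}) set, 'x) Module.module
      \<Rightarrow> ('x \<Rightarrow> ('a \<Rightarrow> real) set) \<Rightarrow> real \<Rightarrow> real \<Rightarrow> (real \<Rightarrow> 'x) \<Rightarrow> 'x \<Rightarrow> bool" where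
  "RN_has_integral M X nrm a b f I \<longleftrightarrow> I \<in> carrier X \<and>
    (\<forall>\<epsilon>>0. \<forall>\<kappa>. 0 < \<kappa> \<and> \<kappa> < 1 \<longrightarrow>
      (\<exists>\<delta>>0. \<forall>p. p tagged_division_of {a..b} \<and> (\<lambda>t. ball t \<delta>) fine p \<longrightarrow>
        RN_riemann_sum M X f p \<ominus>\<^bsub>X\<^esub> I \<in> eps_lambda_nhd M X nrm \<epsilon> \<kappa>))"

definition RN_integrable ::
    "'a measure \<Rightarrow> (('a \<Rightarrow> 'k::{real_normed_field, euclidean_space}) set, 'x) Module.module
      \<Rightarrow> ('x \<Rightarrow> ('a \<Rightarrow> real) set) \<Rightarrow> real \<Rightarrow> real \<Rightarrow> (real \<Rightarrow> 'x) \<Rightarrow> bool" where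
  "RN_integrable M X nrm a b f \<longleftrightarrow> (\<exists>I. RN_has_integral M X nrm a b f I)"

definition RN_integral ::
    "'a measure \<Rightarrow> (('a \<Rightarrow> 'k::{real_normed_field, euclidean_space}) set, 'x) Module.module
      \<Rightarrow> ('x \<Rightarrow> ('a \<Rightarrow> real) set) \<Rightarrow> real \<Rightarrow> real \<Rightarrow> (real \<Rightarrow> 'x) \<Rightarrow> 'x" where
  "RN_integral M X nrm a b f = (THE I. RN_has_integral M X nrm a b f I)"


section \<open>Almost surely bounded operators\<close>

text \<open>Operators are HOL functions of which only the values on the carrier matter.\<close>

definition as_bounds ::
    "'a measure \<Rightarrow> (('a \<Rightarrow> 'k::{real_normed_field, euclidean_space}) set, 'x) Module.module
      \<Rightarrow> ('x \<Rightarrow> ('a \<Rightarrow> real) set) \<Rightarrow> ('x \<Rightarrow> 'x) \<Rightarrow> ('a \<Rightarrow> real) set set" where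
  "as_bounds M X nrm T =
    {\<eta> \<in> L0_plus M. \<forall>z\<in>carrier X. L0_le M (nrm (T z)) (\<eta> \<otimes>\<^bsub>L0_ring M\<^esub> nrm z)}"

definition as_bounded_ops ::
    "'a measure \<Rightarrow> (('a \<Rightarrow> 'k::{real_normed_field, euclidean_space}) set, 'x) Module.module
      \<Rightarrow> ('x \<Rightarrow> ('a \<Rightarrow> real) set) \<Rightarrow> ('x \<Rightarrow> 'x) set" where
  "as_bounded_ops M X nrm = {T \<in> carrier X \<rightarrow> carrier X.
    (\<forall>x\<in>carrier X. \<forall>y\<in>carrier X. T (x \<oplus>\<^bsub>X\<^esub> y) = T x \<oplus>\<^bsub>X\<^esub> T y) \<and>
    (\<forall>c. \<forall>x\<in>carrier X. T (scaleK M X c x) = scaleK M X c (T x)) \<and>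
    as_bounds M X nrm T \<noteq> {}}"

definition op_norm ::
    "'a measure \<Rightarrow> (('a \<Rightarrow> 'k::{real_normed_field, euclidean_space}) set, 'x) Module.module
      \<Rightarrow> ('x \<Rightarrow> ('a \<Rightarrow> real) set) \<Rightarrow> ('x \<Rightarrow> 'x) \<Rightarrow> ('a \<Rightarrow> ereal) set" where
  "op_norm M X nrm T = \<Sqinter>\<^bsub>L0bar M\<^esub> (L0_ext M ` as_bounds M X nrm T)"

text \<open>A module homomorphism defined on a submodule \<open>D\<close> of \<open>X\<close>.\<close>

definition module_hom_on ::
    "'a measure \<Rightarrow> (('a \<Rightarrow> 'k::{real_normed_field, euclidean_space}) set, 'x) Module.module
      \<Rightarrow> 'x set \<Rightarrow> ('x \<Rightarrow> 'x) \<Rightarrow> bool" where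
  "module_hom_on M X D A \<longleftrightarrow> submodule D (L0_ring M) X \<and> A \<in> D \<rightarrow> carrier X \<and>
    (\<forall>x\<in>D. \<forall>y\<in>D. A (x \<oplus>\<^bsub>X\<^esub> y) = A x \<oplus>\<^bsub>X\<^esub> A y) \<and>
    (\<forall>\<xi>\<in>L0 M. \<forall>x\<in>D. A (\<xi> \<odot>\<^bsub>X\<^esub> x) = \<xi> \<odot>\<^bsub>X\<^esub> A x)"

definition closed_op_on ::
    "'a measure \<Rightarrow> (('a \<Rightarrow> 'k::{real_normed_field, euclidean_space}) set, 'x) Module.module
      \<Rightarrow> ('x \<Rightarrow> ('a \<Rightarrow> real) set) \<Rightarrow> 'x set \<Rightarrow> ('x \<Rightarrow> 'x) \<Rightarrow> bool" where
  "closed_op_on M X nrm D A \<longleftrightarrow>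
    closedin (prod_topology (eps_lambda_topology M X nrm) (eps_lambda_topology M X nrm))
      {(x, A x) | x. x \<in> D}"


section \<open>C-semigroups\<close>

definition C_semigroup ::
    "'a measure \<Rightarrow> (('a \<Rightarrow> 'k::{real_normed_field, euclidean_space}) set, 'x) Module.module
      \<Rightarrow> ('x \<Rightarrow> ('a \<Rightarrow> real) set) \<Rightarrow> ('x \<Rightarrow> 'x) \<Rightarrow> (real \<Rightarrow> 'x \<Rightarrow> 'x) \<Rightarrow> bool" where
  "C_semigroup M X nrm C V \<longleftrightarrow>
    C \<in> as_bounded_ops M X nrm \<and> inj_on C (carrier X) \<and>
    (\<forall>s\<ge>0. V s \<in> as_bounded_ops M X nrm) \<and>
    (\<forall>z\<in>carrier X. continuous_map (top_of_set {0..}) (eps_lambda_topology M X nrm) (\<lambda>s. V s z)) \<and>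
    (\<forall>z\<in>carrier X. V 0 z = C z) \<and>
    (\<forall>s\<ge>0. \<forall>t\<ge>0. \<forall>z\<in>carrier X. C (V (s + t) z) = V s (V t z))"

definition locally_as_bounded ::
    "'a measure \<Rightarrow> (('a \<Rightarrow> 'k::{real_normed_field, euclidean_space}) set, 'x) Module.module
      \<Rightarrow> ('x \<Rightarrow> ('a \<Rightarrow> real) set) \<Rightarrow> (real \<Rightarrow> 'x \<Rightarrow> 'x) \<Rightarrow> bool" where
  "locally_as_bounded M X nrm V \<longleftrightarrow>
    (\<forall>l>0. \<Squnion>\<^bsub>L0bar M\<^esub> ((\<lambda>s. op_norm M X nrm (V s)) ` {0..l}) \<in> L0_ext M ` L0_plus M)"

definition gen_limit ::
    "'a measure \<Rightarrow> (('a \<Rightarrow> 'k::{real_normed_field, euclidean_space}) set, 'x) Module.module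
      \<Rightarrow> ('x \<Rightarrow> ('a \<Rightarrow> real) set) \<Rightarrow> ('x \<Rightarrow> 'x) \<Rightarrow> (real \<Rightarrow> 'x \<Rightarrow> 'x) \<Rightarrow> 'x \<Rightarrow> 'x \<Rightarrow> bool" where
  "gen_limit M X nrm C V z l \<longleftrightarrow>
    limitin (eps_lambda_topology M X nrm)
      (\<lambda>s. scaleK M X (of_real (1 / s)) (V s z \<ominus>\<^bsub>X\<^esub> C z)) l (at_right 0)"

definition gen_dom ::
    "'a measure \<Rightarrow> (('a \<Rightarrow> 'k::{real_normed_field, euclidean_space}) set, 'x) Module.module
      \<Rightarrow> ('x \<Rightarrow> ('a \<Rightarrow> real) set) \<Rightarrow> ('x \<Rightarrow> 'x) \<Rightarrow> (real \<Rightarrow> 'x \<Rightarrow> 'x) \<Rightarrow> 'x set" where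
  "gen_dom M X nrm C V = {z \<in> carrier X. \<exists>l \<in> C ` carrier X. gen_limit M X nrm C V z l}"

definition gen_op ::
    "'a measure \<Rightarrow> (('a \<Rightarrow> 'k::{real_normed_field, euclidean_space}) set, 'x) Module.module
      \<Rightarrow> ('x \<Rightarrow> ('a \<Rightarrow> real) set) \<Rightarrow> ('x \<Rightarrow> 'x) \<Rightarrow> (real \<Rightarrow> 'x \<Rightarrow> 'x) \<Rightarrow> 'x \<Rightarrow> 'x" where
  "gen_op M X nrm C V z = the_inv_into (carrier X) C (THE l. gen_limit M X nrm C V z l)"

end

theory Submission
  imports Defs
begin

text \<open>The \<open>(\<epsilon>, \<lambda>)\<close>-topology is given by the metric \<open>E (min 1 \<parallel>x - y\<parallel>)\<close>, whose balls are not convex,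
  so that Riemann sums of continuous functions need not converge. They do if
  \<open>\<parallel>f t\<parallel> \<le> \<eta>\<close> for all \<open>t\<close>: after multiplication by the weight \<open>1 / (1 + \<eta>)\<close> the increments of
  \<open>f\<close> are bounded by constants, the metric may be replaced by the seminorm
  \<open>E (\<parallel>x\<parallel> / (1 + \<eta>))\<close>, and the usual argument by uniform continuity applies. Local a.s.
  boundedness provides such an \<open>\<eta>\<close> for the orbits \<open>V s z\<close>, since essential suprema and infima are
  attained along countable subfamilies.

  Put \<open>J s z = \<integral>\<^sub>0\<^sup>s V u z du\<close>. Then \<open>V h (J s z) - C (J s z) = C (\<integral>\<^sub>s\<^sup>s\<^sup>+\<^sup>h V u z du - J h z)\<close> gives
  \<open>A (J s z) = V s z - C z\<close>. The operator \<open>J s\<close> is a.s. bounded and commutes with \<open>V h\<close>, so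
  applying it to the difference quotients of \<open>z \<in> D(A)\<close> gives \<open>C (V s z - C z) = C (J s (A z))\<close>, and
  \<open>C\<close> cancels. Conversely \<open>V s x - C x = J s y\<close> for all \<open>s > 0\<close> implies \<open>A x = y\<close>, and this
  description of the graph yields closedness and \<open>C\<^sup>-\<^sup>1 A C = A\<close>.\<close>

section \<open>Random norms\<close>

text \<open>Injectivity of \<open>C\<close> permits cancelling \<open>C\<close> in an equation,
  never in a limit, since its inverse on the range need not be continuous. This decides the route.
  The law \<open>C (V (s + h) z) = V s (V h z)\<close> controls only \<open>C\<close> applied to a
  difference quotient of an orbit, so the derivative of an orbit is not read off from it: the
  integrated equation \<open>int_V 0 s (A z) = V s z - C z\<close> comes first, and it makes the
  difference quotients averages of \<open>V u (A z)\<close>, which converge from both sides.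

  Two features of convergence in probability shape the estimates. A random factor
  \<open>\<eta>\<close> without constant bound admits in general no inequality
  \<open>fnorm y \<le> c * fnorm x\<close>, only \<open>fnorm y \<le> e + c * fnorm x\<close> with
  \<open>c\<close> depending on \<open>e\<close>; this still suffices for limits. And inequalities
  hold off a null set that depends on the time and the vector, so only countably many of them can be
  used at once. Riemann sums are finite, which is why one \<open>\<eta>\<close> for a whole time
  interval is enough.\<close>

context RN_module
begin

text \<open>A chosen representative turns the axioms, which concern classes, into a.s. inequalities
  between real functions.\<close>

definition rnorm :: "'x \<Rightarrow> 'a \<Rightarrow> real" where
  "rnorm x = L0_rep (nrm x)"

abbreviation rscale :: "real \<Rightarrow> 'x \<Rightarrow> 'x" where
  "rscale r x \<equiv> scaleK M X (of_real r) x"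

lemma L0_carrier: "carrier (L0_ring M :: ('a \<Rightarrow> 'c::{real_normed_field, euclidean_space}) set ring) = L0 M"
  by (simp add: L0_ring_def)

lemma nrm_L0: "x \<in> carrier X \<Longrightarrow> nrm x \<in> L0 M"
  using nrm_closed by (auto simp: L0_plus_def)

lemma rnorm_measurable [measurable]: "x \<in> carrier X \<Longrightarrow> rnorm x \<in> borel_measurable M"
  by (simp add: rnorm_def nrm_L0 L0_rep_measurable)

lemma rnorm_nonneg: "x \<in> carrier X \<Longrightarrow> AE \<omega> in M. 0 \<le> rnorm x \<omega>"
proof -
  assume x: "x \<in> carrier X"
  have "AE \<omega> in M. L0_rep (L0_const M (0::real)) \<omega> = 0"
    unfolding L0_const_def by (rule L0_rep_class) simp
  moreover have "AE \<omega> in M. L0_rep (L0_const M (0::real)) \<omega> \<le> L0_rep (nrm x) \<omega>"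
    using nrm_closed x by (auto simp: L0_plus_def L0_le_def)
  ultimately show ?thesis by eventually_elim (simp add: rnorm_def)
qed

lemma L0_const_in: "L0_const M c \<in> L0 M"
  unfolding L0_const_def by (rule L0_class_in_L0) simp

lemma L0_rep_const: "AE \<omega> in M. L0_rep (L0_const M c) \<omega> = c"
  unfolding L0_const_def by (rule L0_rep_class) simp

lemma L0_rep_mult:
  fixes \<xi> \<eta> :: "('a \<Rightarrow> 'c::{real_normed_field, euclidean_space}) set"
  assumes "\<xi> \<in> L0 M" "\<eta> \<in> L0 M"
  shows "AE \<omega> in M. L0_rep (\<xi> \<otimes>\<^bsub>L0_ring M\<^esub> \<eta>) \<omega> = L0_rep \<xi> \<omega> * L0_rep \<eta> \<omega>"
  unfolding L0_ring_def monoid.simps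
  using assms[THEN L0_rep_measurable] by (intro L0_rep_class) simp

lemma L0_rep_add:
  fixes \<xi> \<eta> :: "('a \<Rightarrow> 'c::{real_normed_field, euclidean_space}) set"
  assumes "\<xi> \<in> L0 M" "\<eta> \<in> L0 M"
  shows "AE \<omega> in M. L0_rep (\<xi> \<oplus>\<^bsub>L0_ring M\<^esub> \<eta>) \<omega> = L0_rep \<xi> \<omega> + L0_rep \<eta> \<omega>"
  unfolding L0_ring_def ring.simps
  using assms[THEN L0_rep_measurable] by (intro L0_rep_class) simp

lemma L0_abs_in:
  fixes \<xi> :: "('a \<Rightarrow> 'c::{real_normed_field, euclidean_space}) set"
  shows "\<xi> \<in> L0 M \<Longrightarrow> L0_abs M \<xi> \<in> L0 M"
  unfolding L0_abs_def by (intro L0_class_in_L0 measurable_compose[OF L0_rep_measurable borel_measurable_norm])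

lemma L0_rep_abs:
  fixes \<xi> :: "('a \<Rightarrow> 'c::{real_normed_field, euclidean_space}) set"
  shows "\<xi> \<in> L0 M \<Longrightarrow> AE \<omega> in M. L0_rep (L0_abs M \<xi>) \<omega> = norm (L0_rep \<xi> \<omega>)"
  unfolding L0_abs_def by (intro L0_rep_class measurable_compose[OF L0_rep_measurable borel_measurable_norm])

lemma smult_in [simp]: "\<xi> \<in> L0 M \<Longrightarrow> x \<in> carrier X \<Longrightarrow> \<xi> \<odot>\<^bsub>X\<^esub> x \<in> carrier X"
  using RN.smult_closed[of \<xi> x] by (simp add: L0_carrier)

lemma rnorm_smult:
  assumes "\<xi> \<in> L0 M" "x \<in> carrier X"
  shows "AE \<omega> in M. rnorm (\<xi> \<odot>\<^bsub>X\<^esub> x) \<omega> = norm (L0_rep \<xi> \<omega>) * rnorm x \<omega>"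
  using L0_rep_mult[OF L0_abs_in[OF assms(1)] nrm_L0[OF assms(2)]] L0_rep_abs[OF assms(1)]
  by eventually_elim (simp add: rnorm_def nrm_smult[OF assms])

lemma rnorm_add:
  assumes "x \<in> carrier X" "y \<in> carrier X"
  shows "AE \<omega> in M. rnorm (x \<oplus>\<^bsub>X\<^esub> y) \<omega> \<le> rnorm x \<omega> + rnorm y \<omega>"
  using nrm_triangle[OF assms] L0_rep_add[OF nrm_L0[OF assms(1)] nrm_L0[OF assms(2)]]
  unfolding L0_le_def by eventually_elim (simp add: rnorm_def)

lemma rnorm_eq_0D:
  assumes "x \<in> carrier X" "AE \<omega> in M. rnorm x \<omega> = 0"
  shows "x = \<zero>\<^bsub>X\<^esub>"
proof (rule nrm_zeroD[OF assms(1)])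
  have "nrm x = L0_class M (rnorm x)"
    by (simp add: rnorm_def L0_class_rep nrm_L0 assms)
  also have "\<dots> = L0_const M 0"
    unfolding L0_const_def using assms by (intro L0_class_eqI) auto
  finally show "nrm x = L0_const M 0" .
qed

section \<open>Constant scalars: \<open>X\<close> as a vector space over \<open>K\<close>\<close>

lemma scaleK_closed [simp]: "x \<in> carrier X \<Longrightarrow> scaleK M X c x \<in> carrier X"
  by (simp add: scaleK_def L0_const_in)

lemma rnorm_scaleK:
  assumes "x \<in> carrier X"
  shows "AE \<omega> in M. rnorm (scaleK M X c x) \<omega> = norm c * rnorm x \<omega>"
  unfolding scaleK_def using rnorm_smult[OF L0_const_in assms, of c] L0_rep_const[of c]
  by eventually_elim simp

lemma L0_const_add:
  fixes c d :: "'c::{real_normed_field, euclidean_space}"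
  shows "L0_const M (c + d) = L0_const M c \<oplus>\<^bsub>L0_ring M\<^esub> L0_const M d"
  unfolding L0_ring_def ring.simps L0_const_def[of _ "c + d"]
proof (rule L0_class_eqI)
  show "AE \<omega> in M. c + d = L0_rep (L0_const M c) \<omega> + L0_rep (L0_const M d) \<omega>"
    using L0_rep_const[of c] L0_rep_const[of d] by eventually_elim simp
qed (intro borel_measurable_add borel_measurable_const L0_rep_measurable L0_const_in)+

lemma L0_const_mult:
  fixes c d :: "'c::{real_normed_field, euclidean_space}"
  shows "L0_const M (c * d) = L0_const M c \<otimes>\<^bsub>L0_ring M\<^esub> L0_const M d"
  unfolding L0_ring_def monoid.simps L0_const_def[of _ "c * d"]
proof (rule L0_class_eqI)
  show "AE \<omega> in M. c * d = L0_rep (L0_const M c) \<omega> * L0_rep (L0_const M d) \<omega>"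
    using L0_rep_const[of c] L0_rep_const[of d] by eventually_elim simp
qed (intro borel_measurable_times borel_measurable_const L0_rep_measurable L0_const_in)+

lemma scaleK_add_left: "x \<in> carrier X \<Longrightarrow> scaleK M X (c + d) x = scaleK M X c x \<oplus>\<^bsub>X\<^esub> scaleK M X d x"
  unfolding scaleK_def L0_const_add by (rule RN.smult_l_distr) (simp_all add: L0_carrier L0_const_in)

lemma scaleK_add_right:
  "x \<in> carrier X \<Longrightarrow> y \<in> carrier X \<Longrightarrow>
    scaleK M X c (x \<oplus>\<^bsub>X\<^esub> y) = scaleK M X c x \<oplus>\<^bsub>X\<^esub> scaleK M X c y"
  unfolding scaleK_def by (rule RN.smult_r_distr) (simp_all add: L0_carrier L0_const_in)

lemma scaleK_scaleK: "x \<in> carrier X \<Longrightarrow> scaleK M X c (scaleK M X d x) = scaleK M X (c * d) x"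
  unfolding scaleK_def L0_const_mult
  by (rule RN.smult_assoc1[symmetric]) (simp_all add: L0_carrier L0_const_in)

lemma scaleK_one [simp]: "x \<in> carrier X \<Longrightarrow> scaleK M X 1 x = x"
  using RN.smult_one[of x] by (simp add: scaleK_def L0_ring_def)

lemma scaleK_zero_left [simp]: "x \<in> carrier X \<Longrightarrow> scaleK M X 0 x = \<zero>\<^bsub>X\<^esub>"
  using RN.smult_l_null[of x] by (simp add: scaleK_def L0_ring_def)

lemma scaleK_zero_right [simp]: "scaleK M X c \<zero>\<^bsub>X\<^esub> = \<zero>\<^bsub>X\<^esub>"
  using RN.smult_r_null[of "L0_const M c"] by (simp add: scaleK_def L0_carrier L0_const_in)

lemma scaleK_uminus: "x \<in> carrier X \<Longrightarrow> scaleK M X (- 1) x = \<ominus>\<^bsub>X\<^esub> x"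
  using scaleK_add_left[of x "- 1" 1]
  by (intro RN.M.minus_equality[symmetric]) simp_all

lemma smult_minus_right:
  assumes "\<xi> \<in> L0 M" "x \<in> carrier X" "y \<in> carrier X"
  shows "\<xi> \<odot>\<^bsub>X\<^esub> (x \<ominus>\<^bsub>X\<^esub> y) = (\<xi> \<odot>\<^bsub>X\<^esub> x) \<ominus>\<^bsub>X\<^esub> (\<xi> \<odot>\<^bsub>X\<^esub> y)"
  using assms by (simp add: RN.M.minus_eq RN.smult_r_distr RN.smult_r_minus L0_carrier)

lemma scaleK_minus_right:
  "x \<in> carrier X \<Longrightarrow> y \<in> carrier X \<Longrightarrow>
    scaleK M X c (x \<ominus>\<^bsub>X\<^esub> y) = scaleK M X c x \<ominus>\<^bsub>X\<^esub> scaleK M X c y"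
  unfolding scaleK_def by (simp add: smult_minus_right L0_const_in)

lemma scaleK_smult_commute:
  assumes "\<xi> \<in> L0 M" "x \<in> carrier X"
  shows "scaleK M X c (\<xi> \<odot>\<^bsub>X\<^esub> x) = \<xi> \<odot>\<^bsub>X\<^esub> scaleK M X c x"
  using assms RN.smult_assoc1[of "L0_const M c" \<xi> x] RN.smult_assoc1[of \<xi> "L0_const M c" x]
    RN.R.m_comm[of \<xi> "L0_const M c"]
  by (simp add: scaleK_def L0_carrier L0_const_in)

lemma rnorm_zero: "AE \<omega> in M. rnorm \<zero>\<^bsub>X\<^esub> \<omega> = 0"
  using rnorm_scaleK[of "\<zero>\<^bsub>X\<^esub>" 0] by simp

lemma rnorm_uminus:
  assumes "x \<in> carrier X"
  shows "AE \<omega> in M. rnorm (\<ominus>\<^bsub>X\<^esub> x) \<omega> = rnorm x \<omega>"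
  using rnorm_scaleK[OF assms, of "- 1"] assms by (simp add: scaleK_uminus)

lemma rnorm_minus_le:
  assumes "x \<in> carrier X" "y \<in> carrier X"
  shows "AE \<omega> in M. rnorm (x \<ominus>\<^bsub>X\<^esub> y) \<omega> \<le> rnorm x \<omega> + rnorm y \<omega>"
  using rnorm_add[OF assms(1), of "\<ominus>\<^bsub>X\<^esub> y"] rnorm_uminus[OF assms(2)] assms
  by (auto simp: RN.M.minus_eq elim: eventually_elim2)

section \<open>Rearrangements in the additive group\<close>

lemma minus_add_swap:
  assumes "a \<in> carrier X" "b \<in> carrier X" "c \<in> carrier X" "d \<in> carrier X"
  shows "(a \<oplus>\<^bsub>X\<^esub> b) \<ominus>\<^bsub>X\<^esub> (c \<oplus>\<^bsub>X\<^esub> d) = (a \<ominus>\<^bsub>X\<^esub> c) \<oplus>\<^bsub>X\<^esub> (b \<ominus>\<^bsub>X\<^esub> d)"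
  using assms by (simp add: RN.M.minus_eq RN.M.minus_add RN.M.a_ac)

lemma minus_minus_swap:
  assumes "a \<in> carrier X" "b \<in> carrier X" "c \<in> carrier X" "d \<in> carrier X"
  shows "(a \<ominus>\<^bsub>X\<^esub> b) \<ominus>\<^bsub>X\<^esub> (c \<ominus>\<^bsub>X\<^esub> d) = (a \<ominus>\<^bsub>X\<^esub> c) \<ominus>\<^bsub>X\<^esub> (b \<ominus>\<^bsub>X\<^esub> d)"
  using assms by (simp add: RN.M.minus_eq RN.M.minus_add RN.M.a_ac)

lemma minus_self [simp]: "x \<in> carrier X \<Longrightarrow> x \<ominus>\<^bsub>X\<^esub> x = \<zero>\<^bsub>X\<^esub>"
  by (simp add: RN.M.minus_eq RN.M.r_neg)

lemma neg_add_cancel: "x \<in> carrier X \<Longrightarrow> y \<in> carrier X \<Longrightarrow> \<ominus>\<^bsub>X\<^esub> x \<oplus>\<^bsub>X\<^esub> (x \<oplus>\<^bsub>X\<^esub> y) = y"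
  by (simp add: RN.M.a_assoc[symmetric] RN.M.l_neg)

lemma minus_add_cancel:
  "x \<in> carrier X \<Longrightarrow> y \<in> carrier X \<Longrightarrow> z \<in> carrier X \<Longrightarrow>
    (x \<ominus>\<^bsub>X\<^esub> y) \<oplus>\<^bsub>X\<^esub> (y \<ominus>\<^bsub>X\<^esub> z) = x \<ominus>\<^bsub>X\<^esub> z"
  by (simp add: RN.M.minus_eq RN.M.a_assoc neg_add_cancel)

lemma minus_add_id:
  "x \<in> carrier X \<Longrightarrow> y \<in> carrier X \<Longrightarrow> (x \<ominus>\<^bsub>X\<^esub> y) \<oplus>\<^bsub>X\<^esub> y = x"
  by (simp add: RN.M.minus_eq RN.M.a_assoc RN.M.l_neg)

lemma add_minus_cancel:
  assumes "x \<in> carrier X" "y \<in> carrier X"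
  shows "(x \<oplus>\<^bsub>X\<^esub> y) \<ominus>\<^bsub>X\<^esub> x = y"
  using assms neg_add_cancel[of x y] by (simp add: RN.M.minus_eq RN.M.a_comm)

lemma minus_eq_0D:
  assumes "x \<in> carrier X" "y \<in> carrier X" "x \<ominus>\<^bsub>X\<^esub> y = \<zero>\<^bsub>X\<^esub>"
  shows "x = y"
  using assms minus_add_id[of x y] by simp

lemma uminus_minus: "x \<in> carrier X \<Longrightarrow> y \<in> carrier X \<Longrightarrow> \<ominus>\<^bsub>X\<^esub> (x \<ominus>\<^bsub>X\<^esub> y) = y \<ominus>\<^bsub>X\<^esub> x"
  by (simp add: RN.M.minus_eq RN.M.minus_add RN.M.a_comm)

subsection \<open>A metric for the topology\<close>

text \<open>The usual F-norm of convergence in probability: subadditive and monotone in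
  \<open>rnorm\<close>, but not homogeneous, so scalars cannot be pulled out of it.\<close>

definition fnorm :: "'x \<Rightarrow> real" where
  "fnorm x = expectation (\<lambda>\<omega>. min 1 (rnorm x \<omega>))"

lemma integrable_min_1:
  assumes [measurable]: "f \<in> borel_measurable M" and "AE \<omega> in M. 0 \<le> f \<omega>"
  shows "integrable M (\<lambda>\<omega>. min 1 (f \<omega>) :: real)"
  using assms(2) by (intro integrable_const_bound[of _ 1]) auto

lemma integrable_min_1_rnorm: "x \<in> carrier X \<Longrightarrow> integrable M (\<lambda>\<omega>. min 1 (rnorm x \<omega>))"
  by (simp add: integrable_min_1 rnorm_nonneg)

lemma fnorm_nonneg [simp]: "x \<in> carrier X \<Longrightarrow> 0 \<le> fnorm x"
  unfolding fnorm_def using rnorm_nonneg[of x] by (intro integral_nonneg_AE) auto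

lemma fnorm_mono:
  assumes "x \<in> carrier X" "y \<in> carrier X" "AE \<omega> in M. rnorm x \<omega> \<le> rnorm y \<omega>"
  shows "fnorm x \<le> fnorm y"
  unfolding fnorm_def using assms(3)
  by (intro integral_mono_AE integrable_min_1_rnorm assms) auto

lemma fnorm_uminus: "x \<in> carrier X \<Longrightarrow> fnorm (\<ominus>\<^bsub>X\<^esub> x) = fnorm x"
  using rnorm_uminus[of x] by (intro antisym fnorm_mono) auto

lemma fnorm_add:
  assumes "x \<in> carrier X" "y \<in> carrier X"
  shows "fnorm (x \<oplus>\<^bsub>X\<^esub> y) \<le> fnorm x + fnorm y"
proof -
  have "fnorm (x \<oplus>\<^bsub>X\<^esub> y) \<le> expectation (\<lambda>\<omega>. min 1 (rnorm x \<omega>) + min 1 (rnorm y \<omega>))"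
    unfolding fnorm_def
    using rnorm_add[OF assms] rnorm_nonneg[OF assms(1)] rnorm_nonneg[OF assms(2)]
    by (intro integral_mono_AE integrable_min_1_rnorm Bochner_Integration.integrable_add)
      (use assms in auto)
  also have "\<dots> = fnorm x + fnorm y"
    unfolding fnorm_def
    by (intro Bochner_Integration.integral_add integrable_min_1_rnorm assms)
  finally show ?thesis .
qed

lemma fnorm_zero [simp]: "fnorm \<zero>\<^bsub>X\<^esub> = 0"
proof -
  have "fnorm \<zero>\<^bsub>X\<^esub> = expectation (\<lambda>_. 0)"
    unfolding fnorm_def using rnorm_zero by (intro integral_cong_AE) auto
  then show ?thesis by simp
qed

lemma fnorm_eq_0D:
  assumes "x \<in> carrier X" "fnorm x = 0"
  shows "x = \<zero>\<^bsub>X\<^esub>"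
proof (rule rnorm_eq_0D[OF assms(1)])
  have "AE \<omega> in M. min 1 (rnorm x \<omega>) = 0"
    using assms(2) rnorm_nonneg[OF assms(1)] integrable_min_1_rnorm[OF assms(1)]
    unfolding fnorm_def by (subst (asm) integral_nonneg_eq_0_iff_AE) auto
  then show "AE \<omega> in M. rnorm x \<omega> = 0"
    by eventually_elim (auto simp: min_def split: if_splits)
qed

lemma nhd_iff:
  "z \<in> eps_lambda_nhd M X nrm \<epsilon> \<kappa> \<longleftrightarrow> z \<in> carrier X \<and> prob {\<omega> \<in> space M. rnorm z \<omega> < \<epsilon>} > \<kappa>"
  by (simp add: eps_lambda_nhd_def rnorm_def)

lemma prob_rnorm_ge: "x \<in> carrier X \<Longrightarrow>
    prob {\<omega> \<in> space M. rnorm x \<omega> \<ge> \<epsilon>} = 1 - prob {\<omega> \<in> space M. rnorm x \<omega> < \<epsilon>}"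
proof -
  assume [measurable]: "x \<in> carrier X"
  have "{\<omega> \<in> space M. rnorm x \<omega> \<ge> \<epsilon>} = space M - {\<omega> \<in> space M. rnorm x \<omega> < \<epsilon>}"
    by auto
  then show ?thesis by (simp add: prob_compl)
qed

text \<open>Markov's inequality for \<open>min 1 (rnorm x)\<close> at the level
  \<open>min 1 \<epsilon>\<close>; the level is truncated as well because the variable never exceeds
  1.\<close>

lemma nhdI_fnorm:
  assumes x: "x \<in> carrier X" and "0 < \<epsilon>" "\<kappa> < 1" and small: "fnorm x < min 1 \<epsilon> * (1 - \<kappa>)"
  shows "x \<in> eps_lambda_nhd M X nrm \<epsilon> \<kappa>"
proof -
  note [measurable] = rnorm_measurable[OF x]
  have "prob {\<omega> \<in> space M. min 1 (rnorm x \<omega>) \<ge> min 1 \<epsilon>} \<le> fnorm x / min 1 \<epsilon>"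
    unfolding fnorm_def using rnorm_nonneg[OF x] assms(2)
    by (intro integral_Markov_inequality_measure[where A="space M - {}"] integrable_min_1_rnorm x) auto
  moreover have "prob {\<omega> \<in> space M. rnorm x \<omega> \<ge> \<epsilon>} \<le> prob {\<omega> \<in> space M. min 1 (rnorm x \<omega>) \<ge> min 1 \<epsilon>}"
    by (intro finite_measure_mono) auto
  moreover have "fnorm x / min 1 \<epsilon> < 1 - \<kappa>"
    using small assms(2) by (subst pos_divide_less_eq) (auto simp: mult.commute)
  ultimately show ?thesis using x by (simp add: nhd_iff prob_rnorm_ge)
qed

text \<open>Split the expectation at \<open>\<epsilon>\<close>: below it the norm itself is small,
  and the event \<open>?B\<close> where it is not has probability less than
  \<open>1 - \<kappa>\<close>.\<close>

lemma fnorm_le_nhd: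
  assumes "x \<in> eps_lambda_nhd M X nrm \<epsilon> \<kappa>" "0 < \<epsilon>"
  shows "fnorm x < \<epsilon> + (1 - \<kappa>)"
proof -
  have x: "x \<in> carrier X" using assms by (simp add: nhd_iff)
  note [measurable] = rnorm_measurable[OF x]
  let ?B = "{\<omega> \<in> space M. rnorm x \<omega> \<ge> \<epsilon>}"
  have int: "integrable M (indicator ?B :: _ \<Rightarrow> real)"
    by (intro integrable_real_indicator) (auto simp: emeasure_eq_measure)
  have "fnorm x \<le> expectation (\<lambda>\<omega>. \<epsilon> + indicator ?B \<omega>)"
    unfolding fnorm_def
  proof (rule integral_mono_AE[OF integrable_min_1_rnorm[OF x]])
    show "integrable M (\<lambda>\<omega>. \<epsilon> + indicator ?B \<omega>)" using int by simp
    show "AE \<omega> in M. min 1 (rnorm x \<omega>) \<le> \<epsilon> + indicator ?B \<omega>"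
      using assms(2) by (auto simp: indicator_def)
  qed
  also have "\<dots> = \<epsilon> + prob ?B"
    by (subst Bochner_Integration.integral_add) (use int in \<open>simp_all add: prob_space\<close>)
  finally show ?thesis using assms x by (simp add: prob_rnorm_ge nhd_iff)
qed

text \<open>The value 0 off the carrier is a default: the locale \<open>Metric_space\<close> demands
  nonnegativity and symmetry for all arguments, not only for points of the space.\<close>

definition rdist :: "'x \<Rightarrow> 'x \<Rightarrow> real" where
  "rdist x y = (if x \<in> carrier X \<and> y \<in> carrier X then fnorm (x \<ominus>\<^bsub>X\<^esub> y) else 0)"

lemma rdist_eq: "x \<in> carrier X \<Longrightarrow> y \<in> carrier X \<Longrightarrow> rdist x y = fnorm (x \<ominus>\<^bsub>X\<^esub> y)"
  by (simp add: rdist_def)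

sublocale RD: Metric_space "carrier X" rdist
proof
  show "0 \<le> rdist x y" for x y by (simp add: rdist_def)
  show "rdist x y = rdist y x" for x y
    using fnorm_uminus[of "x \<ominus>\<^bsub>X\<^esub> y"] by (auto simp: rdist_def uminus_minus)
  show "rdist x y = 0 \<longleftrightarrow> x = y" if "x \<in> carrier X" "y \<in> carrier X" for x y
    using that fnorm_eq_0D[of "x \<ominus>\<^bsub>X\<^esub> y"] minus_eq_0D[of x y] by (auto simp: rdist_def)
  show "rdist x z \<le> rdist x y + rdist y z"
    if "x \<in> carrier X" "y \<in> carrier X" "z \<in> carrier X" for x y z
    using that fnorm_add[of "x \<ominus>\<^bsub>X\<^esub> y" "y \<ominus>\<^bsub>X\<^esub> z"]
    by (simp add: rdist_def minus_add_cancel)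
qed

text \<open>\<open>nhdI_fnorm\<close> puts a ball inside each basic neighbourhood,
  \<open>fnorm_le_nhd\<close> a neighbourhood inside each ball. Limits, closures and products are
  then taken in a metric space.\<close>

lemma topology_eq: "eps_lambda_topology M X nrm = RD.mtopology"
proof (rule topology_eq[THEN iffD2], rule allI)
  fix U
  show "openin (eps_lambda_topology M X nrm) U \<longleftrightarrow> openin RD.mtopology U"
  proof (cases "U \<subseteq> carrier X")
    case U: True
    have "(\<exists>\<epsilon>>0. \<exists>\<kappa>. 0 < \<kappa> \<and> \<kappa> < 1 \<and> {y \<in> carrier X. y \<ominus>\<^bsub>X\<^esub> x \<in> eps_lambda_nhd M X nrm \<epsilon> \<kappa>} \<subseteq> U)
        \<longleftrightarrow> (\<exists>r>0. RD.mball x r \<subseteq> U)" (is "?L \<longleftrightarrow> ?R") if "x \<in> U" for x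
    proof
      have x: "x \<in> carrier X" using that U by auto
      assume ?L
      then obtain \<epsilon> \<kappa> where *: "\<epsilon> > 0" "0 < \<kappa>" "\<kappa> < 1"
        "{y \<in> carrier X. y \<ominus>\<^bsub>X\<^esub> x \<in> eps_lambda_nhd M X nrm \<epsilon> \<kappa>} \<subseteq> U" by auto
      have "RD.mball x (min 1 \<epsilon> * (1 - \<kappa>)) \<subseteq> U"
        using * x by (auto simp: RD.in_mball RD.commute[of x] rdist_eq intro!: subsetD[OF *(4)] nhdI_fnorm)
      then show ?R using * by (intro exI[of _ "min 1 \<epsilon> * (1 - \<kappa>)"]) auto
    next
      have x: "x \<in> carrier X" using that U by auto
      assume ?R
      then obtain r where r: "r > 0" "RD.mball x r \<subseteq> U" by auto
      \<comment> \<open>With \<open>\<kappa> = 1 - \<epsilon>\<close> the bound of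
        \<open>fnorm_le_nhd\<close> is \<open>2 * \<epsilon>\<close>, hence \<open>r / 2\<close>;
        the cap \<open>1 / 2\<close> keeps \<open>\<kappa>\<close> strictly between 0 and 1.\<close>
      define \<epsilon> where "\<epsilon> = min (r / 2) (1 / 2)"
      have e: "\<epsilon> > 0" "\<epsilon> < 1" "\<epsilon> + (1 - (1 - \<epsilon>)) \<le> r" using r by (auto simp: \<epsilon>_def)
      have "{y \<in> carrier X. y \<ominus>\<^bsub>X\<^esub> x \<in> eps_lambda_nhd M X nrm \<epsilon> (1 - \<epsilon>)} \<subseteq> U"
      proof safe
        fix y assume y: "y \<in> carrier X" "y \<ominus>\<^bsub>X\<^esub> x \<in> eps_lambda_nhd M X nrm \<epsilon> (1 - \<epsilon>)"
        have "rdist x y < r"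
          using fnorm_le_nhd[OF y(2) e(1)] e x y by (simp add: RD.commute[of x] rdist_eq)
        then show "y \<in> U" using x y r by auto
      qed
      then show ?L using e by (intro exI[of _ \<epsilon>] conjI exI[of _ "1 - \<epsilon>"]) auto
    qed
    then show ?thesis using U
      unfolding openin_eps_lambda_topology RD.openin_mtopology by blast
  qed (auto simp: openin_eps_lambda_topology RD.openin_mtopology)
qed

lemma integrable_const_plus_indicator [simp]:
  assumes [measurable]: "A \<in> sets M"
  shows "integrable M (\<lambda>\<omega>. c + indicator A \<omega> :: real)"
proof -
  have "integrable M (indicator A :: _ \<Rightarrow> real)"
    by (intro integrable_real_indicator) (auto simp: emeasure_eq_measure)
  then show ?thesis by simp
qed

text \<open>Since \<open>\<eta>\<close> is finite, the events \<open>\<eta> > n\<close> have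
  probability tending to 0 and one of them is absorbed by \<open>e\<close>. Where
  \<open>\<eta> \<le> n\<close>, the integrand is at most \<open>n * min 1 (g \<omega>)\<close>,
  because \<open>n \<ge> 1\<close>. The point is that \<open>c = n\<close> is chosen before
  \<open>g\<close>.\<close>

lemma expectation_min_times_le:
  fixes \<eta> :: "'a \<Rightarrow> real"
  assumes [measurable]: "\<eta> \<in> borel_measurable M" and "e > 0"
  shows "\<exists>c\<ge>1. \<forall>g \<in> borel_measurable M. (AE \<omega> in M. 0 \<le> g \<omega>) \<longrightarrow> (AE \<omega> in M. 0 \<le> \<eta> \<omega>) \<longrightarrow>
    expectation (\<lambda>\<omega>. min 1 (\<eta> \<omega> * g \<omega>)) \<le> e + c * expectation (\<lambda>\<omega>. min 1 (g \<omega>))"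
proof -
  define A where "A n = {\<omega> \<in> space M. \<eta> \<omega> > real n}" for n
  have A [measurable]: "A n \<in> sets M" for n unfolding A_def by measurable
  have "(\<lambda>n. prob (A n)) \<longlonglongrightarrow> prob (\<Inter>n. A n)"
    by (rule finite_Lim_measure_decseq) (auto simp: decseq_def A_def)
  also have "(\<Inter>n. A n) = {}"
  proof -
    have "\<exists>n. \<not> \<eta> \<omega> > real n" for \<omega>
      using reals_Archimedean2[of "\<eta> \<omega>"] by (auto intro: less_imp_le simp: not_less)
    then show ?thesis by (auto simp: A_def)
  qed
  finally have "(\<lambda>n. prob (A n)) \<longlonglongrightarrow> 0" by simp
  then have "\<forall>\<^sub>F n in sequentially. prob (A n) < e"
    using assms(2) by (rule order_tendstoD)
  then have "\<exists>n\<ge>1. prob (A n) < e"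
    by (auto simp: eventually_sequentially) (meson nat_le_linear order_trans)
  then obtain n where n: "n \<ge> 1" "prob (A n) < e" by blast
  show ?thesis
  proof (intro exI[of _ "real n"] conjI ballI impI)
    show "1 \<le> real n" using n by simp
    fix g :: "'a \<Rightarrow> real" assume [measurable]: "g \<in> borel_measurable M"
      and g: "AE \<omega> in M. 0 \<le> g \<omega>" and \<eta>: "AE \<omega> in M. 0 \<le> \<eta> \<omega>"
    have int: "integrable M (\<lambda>\<omega>. min 1 (g \<omega>))"
      by (rule integrable_min_1) (simp_all add: g)
    have int2: "integrable M (\<lambda>\<omega>. 0 + indicator (A n) \<omega> :: real)" by (rule integrable_const_plus_indicator) simp
    have "expectation (\<lambda>\<omega>. min 1 (\<eta> \<omega> * g \<omega>)) \<le>
        expectation (\<lambda>\<omega>. (0 + indicator (A n) \<omega>) + real n * min 1 (g \<omega>))"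
    proof (rule integral_mono_AE)
      have "AE \<omega> in M. 0 \<le> \<eta> \<omega> * g \<omega>" using g \<eta> by eventually_elim simp
      then show "integrable M (\<lambda>\<omega>. min 1 (\<eta> \<omega> * g \<omega>))" by (intro integrable_min_1) simp_all
      show "integrable M (\<lambda>\<omega>. (0 + indicator (A n) \<omega>) + real n * min 1 (g \<omega>))"
        using int int2 by (intro Bochner_Integration.integrable_add integrable_mult_right) auto
      show "AE \<omega> in M. min 1 (\<eta> \<omega> * g \<omega>) \<le> (0 + indicator (A n) \<omega>) + real n * min 1 (g \<omega>)"
        using g \<eta> AE_space
      proof eventually_elim
        fix \<omega> assume *: "0 \<le> g \<omega>" "0 \<le> \<eta> \<omega>" "\<omega> \<in> space M"
        show "min 1 (\<eta> \<omega> * g \<omega>) \<le> (0 + indicator (A n) \<omega>) + real n * min 1 (g \<omega>)"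
        proof (cases "\<omega> \<in> A n")
          case True
          have "min 1 (\<eta> \<omega> * g \<omega>) \<le> 1 + 0" by simp
          also have "\<dots> \<le> 1 + real n * min 1 (g \<omega>)" using * by (intro add_left_mono) simp
          finally show ?thesis using True by simp
        next
          case False
          then have "\<eta> \<omega> \<le> real n" using * by (simp add: A_def)
          then have "\<eta> \<omega> * g \<omega> \<le> real n * g \<omega>" using * by (intro mult_right_mono)
          then show ?thesis using False n by (auto simp: min_def)
        qed
      qed
    qed
    also have "\<dots> = prob (A n) + real n * expectation (\<lambda>\<omega>. min 1 (g \<omega>))"
      using int int2 by (subst Bochner_Integration.integral_add) auto
    finally show "expectation (\<lambda>\<omega>. min 1 (\<eta> \<omega> * g \<omega>)) \<le> e + real n * expectation (\<lambda>\<omega>. min 1 (g \<omega>))"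
      using n by simp
  qed
qed

lemma rnorm_finsum:
  assumes "finite S" "x \<in> S \<rightarrow> carrier X"
  shows "AE \<omega> in M. rnorm (\<Oplus>\<^bsub>X\<^esub>i\<in>S. x i) \<omega> \<le> (\<Sum>i\<in>S. rnorm (x i) \<omega>)"
  using assms
proof (induction S rule: finite_induct)
  case empty
  then show ?case using rnorm_zero by auto
next
  case (insert i S)
  then have c: "x i \<in> carrier X" "x \<in> S \<rightarrow> carrier X" by auto
  then have s: "(\<Oplus>\<^bsub>X\<^esub>i\<in>S. x i) \<in> carrier X" by simp
  from insert.IH[OF c(2)] rnorm_add[OF c(1) s] show ?case
    by eventually_elim (use insert.hyps c in simp)
qed

lemma finsum_additive:
  assumes "finite S" "x \<in> S \<rightarrow> carrier X" "T \<in> carrier X \<rightarrow> carrier X" "T \<zero>\<^bsub>X\<^esub> = \<zero>\<^bsub>X\<^esub>"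
    and "\<And>x y. x \<in> carrier X \<Longrightarrow> y \<in> carrier X \<Longrightarrow> T (x \<oplus>\<^bsub>X\<^esub> y) = T x \<oplus>\<^bsub>X\<^esub> T y"
  shows "T (\<Oplus>\<^bsub>X\<^esub>i\<in>S. x i) = (\<Oplus>\<^bsub>X\<^esub>i\<in>S. T (x i))"
  using assms
proof (induction S rule: finite_induct)
  case (insert i S)
  then have "x i \<in> carrier X" "x \<in> S \<rightarrow> carrier X" "T (x i) \<in> carrier X" "(\<lambda>i. T (x i)) \<in> S \<rightarrow> carrier X"
    by auto
  then show ?case using insert by simp
qed simp

text \<open>The convexity that the metric lacks: the proof estimates \<open>x i\<close> by \<open>\<parallel>x i\<parallel> / (1 + \<bar>\<eta>\<bar>)\<close>, which
  is at most \<open>min 1 \<parallel>x i\<parallel>\<close>.\<close>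

lemma fnorm_combination_le:
  fixes \<eta> :: "'a \<Rightarrow> real"
  assumes [measurable]: "\<eta> \<in> borel_measurable M" and "e > 0"
  shows "\<exists>c\<ge>1. \<forall>(S :: 'i set) (w :: 'i \<Rightarrow> real) x. finite S \<longrightarrow>
    (\<forall>i\<in>S. 0 \<le> w i \<and> x i \<in> carrier X \<and> (AE \<omega> in M. rnorm (x i) \<omega> \<le> \<eta> \<omega>)) \<longrightarrow>
    fnorm (\<Oplus>\<^bsub>X\<^esub>i\<in>S. rscale (w i) (x i)) \<le> e + c * (\<Sum>i\<in>S. w i * fnorm (x i))"
proof -
  \<comment> \<open>Being at least 1, the weight makes the quotient \<open>h i\<close> at most
    \<open>rnorm (x i)\<close>; dominating \<open>\<eta>\<close>, it makes it at most 1.\<close>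
  define \<eta>' where "\<eta>' \<omega> = 1 + \<bar>\<eta> \<omega>\<bar>" for \<omega>
  have [measurable]: "\<eta>' \<in> borel_measurable M" unfolding \<eta>'_def by measurable
  have \<eta>': "\<eta>' \<omega> \<ge> 1" "\<eta>' \<omega> \<ge> \<eta> \<omega>" and \<eta>'_nn: "0 \<le> \<eta>' \<omega>" for \<omega> by (auto simp: \<eta>'_def)
  obtain c where c: "c \<ge> 1" and *: "\<And>g. g \<in> borel_measurable M \<Longrightarrow> (AE \<omega> in M. 0 \<le> g \<omega>) \<Longrightarrow>
    (AE \<omega> in M. 0 \<le> \<eta>' \<omega>) \<Longrightarrow>
    expectation (\<lambda>\<omega>. min 1 (\<eta>' \<omega> * g \<omega>)) \<le> e + c * expectation (\<lambda>\<omega>. min 1 (g \<omega>))"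
    using expectation_min_times_le[of \<eta>' e] assms(2) by auto
  show ?thesis
  proof (intro exI[of _ c] conjI allI impI c)
    fix S :: "'i set" and w :: "'i \<Rightarrow> real" and x
    assume S: "finite S" and "\<forall>i\<in>S. 0 \<le> w i \<and> x i \<in> carrier X \<and> (AE \<omega> in M. rnorm (x i) \<omega> \<le> \<eta> \<omega>)"
    then have w: "\<And>i. i \<in> S \<Longrightarrow> 0 \<le> w i" and x: "\<And>i. i \<in> S \<Longrightarrow> x i \<in> carrier X"
      and bd: "AE \<omega> in M. \<forall>i\<in>S. rnorm (x i) \<omega> \<le> \<eta> \<omega>"
      by (auto simp: AE_finite_all)
    have x' [measurable]: "\<And>i. i \<in> S \<Longrightarrow> rnorm (x i) \<in> borel_measurable M" using x by simp
    have nn: "AE \<omega> in M. \<forall>i\<in>S. 0 \<le> rnorm (x i) \<omega>"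
      using S x by (auto simp: AE_finite_all rnorm_nonneg)
    have sc: "AE \<omega> in M. \<forall>i\<in>S. rnorm (rscale (w i) (x i)) \<omega> = w i * rnorm (x i) \<omega>"
      using S
    proof (rule AE_finite_allI)
      show "AE \<omega> in M. rnorm (rscale (w i) (x i)) \<omega> = w i * rnorm (x i) \<omega>" if "i \<in> S" for i
        using rnorm_scaleK[OF x[OF that], of "of_real (w i)"] w[OF that] by simp
    qed
    define h where "h i \<omega> = rnorm (x i) \<omega> / \<eta>' \<omega>" for i \<omega>
    have h_meas [measurable]: "h i \<in> borel_measurable M" if "i \<in> S" for i
      unfolding h_def using x'[OF that] by measurable
    have h: "AE \<omega> in M. \<forall>i\<in>S. 0 \<le> h i \<omega> \<and> h i \<omega> \<le> min 1 (rnorm (x i) \<omega>)"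
      using bd nn
    proof eventually_elim
      fix \<omega> assume 1: "\<forall>i\<in>S. rnorm (x i) \<omega> \<le> \<eta> \<omega>" and 2: "\<forall>i\<in>S. 0 \<le> rnorm (x i) \<omega>"
      show "\<forall>i\<in>S. 0 \<le> h i \<omega> \<and> h i \<omega> \<le> min 1 (rnorm (x i) \<omega>)"
      proof
        fix i assume i: "i \<in> S"
        have "rnorm (x i) \<omega> \<le> \<eta>' \<omega>" using 1 i \<eta>'(2)[of \<omega>] by force
        moreover have "rnorm (x i) \<omega> * 1 \<le> rnorm (x i) \<omega> * \<eta>' \<omega>"
          using 2 i \<eta>'(1)[of \<omega>] by (intro mult_left_mono) auto
        ultimately show "0 \<le> h i \<omega> \<and> h i \<omega> \<le> min 1 (rnorm (x i) \<omega>)"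
          using 2 i \<eta>'(1)[of \<omega>] by (auto simp: h_def pos_divide_le_eq)
      qed
    qed
    have h_int: "integrable M (h i)" if "i \<in> S" for i
      using h that by (intro integrable_const_bound[of _ 1]) auto
    define g where "g \<omega> = (\<Sum>i\<in>S. w i * h i \<omega>)" for \<omega>
    have g_int: "integrable M g"
      unfolding g_def by (intro Bochner_Integration.integrable_sum integrable_mult_right h_int)
    then have [measurable]: "g \<in> borel_measurable M" by simp
    have g_nn: "AE \<omega> in M. 0 \<le> g \<omega>"
      using h by eventually_elim (auto simp: g_def intro!: sum_nonneg mult_nonneg_nonneg w)
    have g_eq: "\<eta>' \<omega> * g \<omega> = (\<Sum>i\<in>S. w i * rnorm (x i) \<omega>)" for \<omega>
      using \<eta>'(1)[of \<omega>] by (auto simp: g_def h_def sum_distrib_left intro!: sum.cong)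
    have sx: "(\<lambda>i. rscale (w i) (x i)) \<in> S \<rightarrow> carrier X" using x by auto
    have "fnorm (\<Oplus>\<^bsub>X\<^esub>i\<in>S. rscale (w i) (x i)) \<le> expectation (\<lambda>\<omega>. min 1 (\<eta>' \<omega> * g \<omega>))"
      unfolding fnorm_def
    proof (rule integral_mono_AE)
      show "integrable M (\<lambda>\<omega>. min 1 (rnorm (\<Oplus>\<^bsub>X\<^esub>i\<in>S. rscale (w i) (x i)) \<omega>))"
        using sx by (intro integrable_min_1_rnorm) simp
      have "AE \<omega> in M. 0 \<le> \<eta>' \<omega> * g \<omega>"
        using g_nn by eventually_elim (simp add: \<eta>'_nn)
      then show "integrable M (\<lambda>\<omega>. min 1 (\<eta>' \<omega> * g \<omega>))" by (intro integrable_min_1) simp_all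
      show "AE \<omega> in M. min 1 (rnorm (\<Oplus>\<^bsub>X\<^esub>i\<in>S. rscale (w i) (x i)) \<omega>) \<le> min 1 (\<eta>' \<omega> * g \<omega>)"
        using rnorm_finsum[OF S sx] sc
        by eventually_elim (auto simp: g_eq intro: min.mono)
    qed
    also have "\<dots> \<le> e + c * expectation (\<lambda>\<omega>. min 1 (g \<omega>))"
      by (intro *) (simp_all add: g_nn \<eta>'_nn)
    \<comment> \<open>Dropping the truncation of \<open>g\<close> leaves a plain expectation. Its
      linearity in the weights \<open>w i\<close> supplies the convexity.\<close>
    also have "expectation (\<lambda>\<omega>. min 1 (g \<omega>)) \<le> expectation g"
      using g_int g_nn by (intro integral_mono integrable_min_1) auto
    also have "expectation g = (\<Sum>i\<in>S. w i * expectation (h i))"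
      unfolding g_def using h_int by (subst Bochner_Integration.integral_sum) auto
    also have "\<dots> \<le> (\<Sum>i\<in>S. w i * fnorm (x i))"
    proof (intro sum_mono mult_left_mono w)
      fix i assume i: "i \<in> S"
      show "expectation (h i) \<le> fnorm (x i)"
        unfolding fnorm_def using h i
        by (intro integral_mono_AE h_int integrable_min_1_rnorm x) auto
    qed
    finally show "fnorm (\<Oplus>\<^bsub>X\<^esub>i\<in>S. rscale (w i) (x i)) \<le> e + c * (\<Sum>i\<in>S. w i * fnorm (x i))"
      using c by (simp add: mult_left_mono)
  qed
qed

text \<open>The quantitative continuity of an operator bounded by \<open>\<eta>\<close>;
  \<open>c\<close> serves all pairs \<open>x\<close>, \<open>y\<close> at once.\<close>

lemma fnorm_times_le:
  fixes \<eta> :: "'a \<Rightarrow> real"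
  assumes [measurable]: "\<eta> \<in> borel_measurable M" and \<eta>: "AE \<omega> in M. 0 \<le> \<eta> \<omega>" and "e > 0"
  shows "\<exists>c\<ge>1. \<forall>x\<in>carrier X. \<forall>y\<in>carrier X. (AE \<omega> in M. rnorm y \<omega> \<le> \<eta> \<omega> * rnorm x \<omega>) \<longrightarrow>
    fnorm y \<le> e + c * fnorm x"
proof -
  obtain c where c: "c \<ge> 1" and *: "\<And>g. g \<in> borel_measurable M \<Longrightarrow> (AE \<omega> in M. 0 \<le> g \<omega>) \<Longrightarrow>
    expectation (\<lambda>\<omega>. min 1 (\<eta> \<omega> * g \<omega>)) \<le> e + c * expectation (\<lambda>\<omega>. min 1 (g \<omega>))"
    using expectation_min_times_le[of \<eta> e] assms by auto
  show ?thesis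
  proof (intro exI[of _ c] conjI ballI impI c)
    fix x y assume x: "x \<in> carrier X" and y: "y \<in> carrier X"
      and le: "AE \<omega> in M. rnorm y \<omega> \<le> \<eta> \<omega> * rnorm x \<omega>"
    note [measurable] = rnorm_measurable[OF x]
    have "fnorm y \<le> expectation (\<lambda>\<omega>. min 1 (\<eta> \<omega> * rnorm x \<omega>))"
      unfolding fnorm_def
    proof (rule integral_mono_AE[OF integrable_min_1_rnorm[OF y]])
      have "AE \<omega> in M. 0 \<le> \<eta> \<omega> * rnorm x \<omega>"
        using rnorm_nonneg[OF x] \<eta> by eventually_elim simp
      then show "integrable M (\<lambda>\<omega>. min 1 (\<eta> \<omega> * rnorm x \<omega>))" by (intro integrable_min_1) simp_all
      show "AE \<omega> in M. min 1 (rnorm y \<omega>) \<le> min 1 (\<eta> \<omega> * rnorm x \<omega>)"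
        using le by eventually_elim (auto intro: min.mono)
    qed
    also have "\<dots> \<le> e + c * fnorm x"
      unfolding fnorm_def by (intro * rnorm_nonneg x) simp
    finally show "fnorm y \<le> e + c * fnorm x" .
  qed
qed

subsection \<open>Limits\<close>

abbreviation rlim :: "('i \<Rightarrow> 'x) \<Rightarrow> 'x \<Rightarrow> 'i filter \<Rightarrow> bool" where
  "rlim \<equiv> limitin RD.mtopology"

lemma rlim_iff:
  "rlim f l F \<longleftrightarrow> l \<in> carrier X \<and> (\<forall>\<^sub>F i in F. f i \<in> carrier X) \<and>
    ((\<lambda>i. fnorm (f i \<ominus>\<^bsub>X\<^esub> l)) \<longlongrightarrow> 0) F"
proof -
  have "((\<lambda>i. rdist (f i) l) \<longlongrightarrow> 0) F \<longleftrightarrow> ((\<lambda>i. fnorm (f i \<ominus>\<^bsub>X\<^esub> l)) \<longlongrightarrow> 0) F"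
    if "l \<in> carrier X" "\<forall>\<^sub>F i in F. f i \<in> carrier X"
    using that(2) by (intro tendsto_cong, eventually_elim) (simp add: rdist_eq that)
  then show ?thesis by (auto simp: RD.limitin_metric_dist_null)
qed

lemma rlim_closed: "rlim f l F \<Longrightarrow> l \<in> carrier X"
  by (simp add: rlim_iff)

lemma rlim_const: "x \<in> carrier X \<Longrightarrow> rlim (\<lambda>_. x) x F"
  by (simp add: rlim_iff)

lemma rlim_cong:
  assumes "\<forall>\<^sub>F i in F. f i = g i" "rlim f l F"
  shows "rlim g l F"
  using limitin_transform_eventually[OF assms] .

lemma rlim_squeeze:
  assumes "\<forall>\<^sub>F i in F. f i \<in> carrier X" "l \<in> carrier X"
    and "\<forall>\<^sub>F i in F. fnorm (f i \<ominus>\<^bsub>X\<^esub> l) \<le> b i" "(b \<longlongrightarrow> 0) F"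
  shows "rlim f l F"
  unfolding rlim_iff
proof (intro conjI assms)
  show "((\<lambda>i. fnorm (f i \<ominus>\<^bsub>X\<^esub> l)) \<longlongrightarrow> 0) F"
  proof (rule tendsto_sandwich[OF _ assms(3) tendsto_const assms(4)])
    show "\<forall>\<^sub>F i in F. 0 \<le> fnorm (f i \<ominus>\<^bsub>X\<^esub> l)"
      using assms(1) by eventually_elim (simp add: assms(2))
  qed
qed

lemma rlim_add:
  assumes "rlim f a F" "rlim g b F"
  shows "rlim (\<lambda>i. f i \<oplus>\<^bsub>X\<^esub> g i) (a \<oplus>\<^bsub>X\<^esub> b) F"
proof (rule rlim_squeeze)
  have ev: "\<forall>\<^sub>F i in F. f i \<in> carrier X \<and> g i \<in> carrier X" and c: "a \<in> carrier X" "b \<in> carrier X"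
    using assms by (auto simp: rlim_iff eventually_conj_iff)
  show "\<forall>\<^sub>F i in F. f i \<oplus>\<^bsub>X\<^esub> g i \<in> carrier X" using ev by eventually_elim simp
  show "a \<oplus>\<^bsub>X\<^esub> b \<in> carrier X" using c by simp
  show "\<forall>\<^sub>F i in F. fnorm ((f i \<oplus>\<^bsub>X\<^esub> g i) \<ominus>\<^bsub>X\<^esub> (a \<oplus>\<^bsub>X\<^esub> b)) \<le> fnorm (f i \<ominus>\<^bsub>X\<^esub> a) + fnorm (g i \<ominus>\<^bsub>X\<^esub> b)"
    using ev by eventually_elim (use c in \<open>auto simp: minus_add_swap intro: fnorm_add\<close>)
  show "((\<lambda>i. fnorm (f i \<ominus>\<^bsub>X\<^esub> a) + fnorm (g i \<ominus>\<^bsub>X\<^esub> b)) \<longlongrightarrow> 0) F"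
    using assms by (intro tendsto_add_zero) (auto simp: rlim_iff)
qed

text \<open>A random factor that does not depend on the index preserves limits: by
  \<open>fnorm_times_le\<close> half of the error is fixed first, at the price of a constant
  \<open>c\<close>, and then \<open>f\<close> is taken within \<open>e / (2 * c)\<close> of its
  limit.\<close>

lemma rlim_le:
  fixes \<eta> :: "'a \<Rightarrow> real"
  assumes [measurable]: "\<eta> \<in> borel_measurable M" and \<eta>: "AE \<omega> in M. 0 \<le> \<eta> \<omega>"
    and f: "rlim f a F" and b: "b \<in> carrier X" and g: "\<forall>\<^sub>F i in F. g i \<in> carrier X"
    and le: "\<forall>\<^sub>F i in F. AE \<omega> in M. rnorm (g i \<ominus>\<^bsub>X\<^esub> b) \<omega> \<le> \<eta> \<omega> * rnorm (f i \<ominus>\<^bsub>X\<^esub> a) \<omega>"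
  shows "rlim g b F"
  unfolding rlim_iff
proof (intro conjI b g)
  have a: "a \<in> carrier X" using f by (rule rlim_closed)
  have f0: "((\<lambda>i. fnorm (f i \<ominus>\<^bsub>X\<^esub> a)) \<longlongrightarrow> 0) F" and fc: "\<forall>\<^sub>F i in F. f i \<in> carrier X"
    using f by (auto simp: rlim_iff)
  show "((\<lambda>i. fnorm (g i \<ominus>\<^bsub>X\<^esub> b)) \<longlongrightarrow> 0) F"
  proof (rule tendstoI)
    fix e :: real assume "e > 0"
    then obtain c where c: "c \<ge> 1" and *: "\<And>x y. x \<in> carrier X \<Longrightarrow> y \<in> carrier X \<Longrightarrow>
      (AE \<omega> in M. rnorm y \<omega> \<le> \<eta> \<omega> * rnorm x \<omega>) \<Longrightarrow> fnorm y \<le> e / 2 + c * fnorm x"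
      using fnorm_times_le[of \<eta> "e / 2"] \<eta> by auto
    have "\<forall>\<^sub>F i in F. fnorm (f i \<ominus>\<^bsub>X\<^esub> a) < e / (2 * c)"
      using f0 c \<open>e > 0\<close> by (intro order_tendstoD) auto
    then show "\<forall>\<^sub>F i in F. dist (fnorm (g i \<ominus>\<^bsub>X\<^esub> b)) 0 < e"
      using fc g le
    proof eventually_elim
      fix i assume i: "fnorm (f i \<ominus>\<^bsub>X\<^esub> a) < e / (2 * c)" "f i \<in> carrier X" "g i \<in> carrier X"
        "AE \<omega> in M. rnorm (g i \<ominus>\<^bsub>X\<^esub> b) \<omega> \<le> \<eta> \<omega> * rnorm (f i \<ominus>\<^bsub>X\<^esub> a) \<omega>"
      have "fnorm (g i \<ominus>\<^bsub>X\<^esub> b) \<le> e / 2 + c * fnorm (f i \<ominus>\<^bsub>X\<^esub> a)"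
        using i a b by (intro *) auto
      also have "c * fnorm (f i \<ominus>\<^bsub>X\<^esub> a) < c * (e / (2 * c))"
        using i c by (intro mult_strict_left_mono) auto
      also have "\<dots> = e / 2" using c by simp
      finally show "dist (fnorm (g i \<ominus>\<^bsub>X\<^esub> b)) 0 < e"
        using i b by simp
    qed
  qed
qed

subsection \<open>Almost surely bounded operators\<close>

abbreviation BX :: "('x \<Rightarrow> 'x) set" where
  "BX \<equiv> as_bounded_ops M X nrm"

lemma op_closed [simp]: "T \<in> BX \<Longrightarrow> x \<in> carrier X \<Longrightarrow> T x \<in> carrier X"
  by (auto simp: as_bounded_ops_def)

lemma op_add: "T \<in> BX \<Longrightarrow> x \<in> carrier X \<Longrightarrow> y \<in> carrier X \<Longrightarrow> T (x \<oplus>\<^bsub>X\<^esub> y) = T x \<oplus>\<^bsub>X\<^esub> T y"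
  unfolding as_bounded_ops_def by blast

lemma op_scaleK: "T \<in> BX \<Longrightarrow> x \<in> carrier X \<Longrightarrow> T (scaleK M X c x) = scaleK M X c (T x)"
  unfolding as_bounded_ops_def by blast

lemma op_zero [simp]: "T \<in> BX \<Longrightarrow> T \<zero>\<^bsub>X\<^esub> = \<zero>\<^bsub>X\<^esub>"
  using op_scaleK[of T "\<zero>\<^bsub>X\<^esub>" 0] by simp

lemma op_uminus: "T \<in> BX \<Longrightarrow> x \<in> carrier X \<Longrightarrow> T (\<ominus>\<^bsub>X\<^esub> x) = \<ominus>\<^bsub>X\<^esub> T x"
  using op_scaleK[of T x "- 1"] by (simp add: scaleK_uminus)

lemma op_minus: "T \<in> BX \<Longrightarrow> x \<in> carrier X \<Longrightarrow> y \<in> carrier X \<Longrightarrow> T (x \<ominus>\<^bsub>X\<^esub> y) = T x \<ominus>\<^bsub>X\<^esub> T y"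
  by (simp add: RN.M.minus_eq op_add op_uminus)

lemma as_bounds_iff:
  "\<eta> \<in> as_bounds M X nrm T \<longleftrightarrow> \<eta> \<in> L0_plus M \<and>
    (\<forall>z\<in>carrier X. AE \<omega> in M. rnorm (T z) \<omega> \<le> L0_rep \<eta> \<omega> * rnorm z \<omega>)"
proof -
  have "L0_le M (nrm (T z)) (\<eta> \<otimes>\<^bsub>L0_ring M\<^esub> nrm z) \<longleftrightarrow>
      (AE \<omega> in M. rnorm (T z) \<omega> \<le> L0_rep \<eta> \<omega> * rnorm z \<omega>)"
    if "\<eta> \<in> L0_plus M" "z \<in> carrier X" for z
  proof -
    have "\<eta> \<in> L0 M" using that by (simp add: L0_plus_def)
    from L0_rep_mult[OF this nrm_L0[OF that(2)]] show ?thesis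
      unfolding L0_le_def rnorm_def by (rule eventually_cong) simp
  qed
  then show ?thesis by (auto simp: as_bounds_def)
qed

lemma L0_plus_iff: "\<eta> \<in> L0_plus M \<longleftrightarrow> \<eta> \<in> L0 M \<and> (AE \<omega> in M. 0 \<le> L0_rep \<eta> \<omega>)"
proof -
  have "L0_le M (L0_const M 0) \<eta> \<longleftrightarrow> (AE \<omega> in M. 0 \<le> L0_rep \<eta> \<omega>)"
    unfolding L0_le_def by (rule eventually_cong[OF L0_rep_const[of "0::real"]]) simp
  then show ?thesis by (simp add: L0_plus_def)
qed

lemma op_boundE:
  assumes "T \<in> BX"
  obtains \<eta> where "\<eta> \<in> borel_measurable M" "AE \<omega> in M. 0 \<le> \<eta> \<omega>"
    "\<And>z. z \<in> carrier X \<Longrightarrow> AE \<omega> in M. rnorm (T z) \<omega> \<le> \<eta> \<omega> * rnorm z \<omega>"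
proof -
  obtain \<eta> where "\<eta> \<in> as_bounds M X nrm T" using assms unfolding as_bounded_ops_def by blast
  then show ?thesis
    by (intro that[of "L0_rep \<eta>"]) (auto simp: as_bounds_iff L0_plus_iff L0_rep_measurable)
qed

lemma L0_class_plus: 
  fixes \<eta> :: "'a \<Rightarrow> real"
  assumes "\<eta> \<in> borel_measurable M" "AE \<omega> in M. 0 \<le> \<eta> \<omega>"
  shows "L0_class M \<eta> \<in> L0_plus M"
  unfolding L0_plus_iff
proof
  show "L0_class M \<eta> \<in> L0 M" by (rule L0_class_in_L0[OF assms(1)])
  show "AE \<omega> in M. 0 \<le> L0_rep (L0_class M \<eta>) \<omega>"
    using L0_rep_class[OF assms(1)] assms(2) by eventually_elim simp
qed

lemma opI:
  assumes T: "\<And>x. x \<in> carrier X \<Longrightarrow> T x \<in> carrier X"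
    and add: "\<And>x y. x \<in> carrier X \<Longrightarrow> y \<in> carrier X \<Longrightarrow> T (x \<oplus>\<^bsub>X\<^esub> y) = T x \<oplus>\<^bsub>X\<^esub> T y"
    and sc: "\<And>c x. x \<in> carrier X \<Longrightarrow> T (scaleK M X c x) = scaleK M X c (T x)"
    and \<eta>: "\<eta> \<in> borel_measurable M" "AE \<omega> in M. 0 \<le> \<eta> \<omega>"
    and bd: "\<And>z. z \<in> carrier X \<Longrightarrow> AE \<omega> in M. rnorm (T z) \<omega> \<le> \<eta> \<omega> * rnorm z \<omega>"
  shows "T \<in> BX"
proof -
  have "L0_class M \<eta> \<in> as_bounds M X nrm T"
    unfolding as_bounds_iff
  proof (intro conjI ballI L0_class_plus \<eta>)
    show "AE \<omega> in M. rnorm (T z) \<omega> \<le> L0_rep (L0_class M \<eta>) \<omega> * rnorm z \<omega>" if "z \<in> carrier X" for z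
      using L0_rep_class[OF \<eta>(1)] bd[OF that] by eventually_elim simp
  qed
  then show ?thesis using T add sc unfolding as_bounded_ops_def by blast
qed

lemma op_rlim:
  assumes T: "T \<in> BX" and f: "rlim f l F"
  shows "rlim (\<lambda>i. T (f i)) (T l) F"
proof -
  obtain \<eta> where \<eta>: "\<eta> \<in> borel_measurable M" "AE \<omega> in M. 0 \<le> \<eta> \<omega>"
    "\<And>z. z \<in> carrier X \<Longrightarrow> AE \<omega> in M. rnorm (T z) \<omega> \<le> \<eta> \<omega> * rnorm z \<omega>"
    using op_boundE[OF T] by blast
  have l: "l \<in> carrier X" and ev: "\<forall>\<^sub>F i in F. f i \<in> carrier X" using f by (auto simp: rlim_iff)
  show ?thesis
  proof (rule rlim_le[OF \<eta>(1,2) f])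
    show "\<forall>\<^sub>F i in F. AE \<omega> in M. rnorm (T (f i) \<ominus>\<^bsub>X\<^esub> T l) \<omega> \<le> \<eta> \<omega> * rnorm (f i \<ominus>\<^bsub>X\<^esub> l) \<omega>"
      using ev
    proof eventually_elim
      fix i assume "f i \<in> carrier X"
      then show "AE \<omega> in M. rnorm (T (f i) \<ominus>\<^bsub>X\<^esub> T l) \<omega> \<le> \<eta> \<omega> * rnorm (f i \<ominus>\<^bsub>X\<^esub> l) \<omega>"
        using \<eta>(3)[of "f i \<ominus>\<^bsub>X\<^esub> l"] l by (simp add: op_minus[OF T])
    qed
    show "\<forall>\<^sub>F i in F. T (f i) \<in> carrier X" using ev by eventually_elim (simp add: T)
  qed (simp add: l T)
qed

lemma op_continuous: "T \<in> BX \<Longrightarrow> continuous_map RD.mtopology RD.mtopology T"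
  using continuous_map_id[of RD.mtopology] op_rlim[of T "\<lambda>x. x"]
  unfolding continuous_map_atin id_def by blast

text \<open>Multiplication by a random scalar becomes one more bounded operator, so that general
  facts about operators cover it.\<close>

lemma smult_op: "\<xi> \<in> L0 M \<Longrightarrow> (\<lambda>x. \<xi> \<odot>\<^bsub>X\<^esub> x) \<in> BX"
proof (rule opI[where \<eta> = "\<lambda>\<omega>. norm (L0_rep \<xi> \<omega>)"])
  assume \<xi>: "\<xi> \<in> L0 M"
  show "\<xi> \<odot>\<^bsub>X\<^esub> x \<in> carrier X" if "x \<in> carrier X" for x using \<xi> that by simp
  show "\<xi> \<odot>\<^bsub>X\<^esub> (x \<oplus>\<^bsub>X\<^esub> y) = \<xi> \<odot>\<^bsub>X\<^esub> x \<oplus>\<^bsub>X\<^esub> \<xi> \<odot>\<^bsub>X\<^esub> y" if "x \<in> carrier X" "y \<in> carrier X" for x y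
    using \<xi> that by (simp add: RN.smult_r_distr L0_carrier)
  show "\<xi> \<odot>\<^bsub>X\<^esub> scaleK M X c x = scaleK M X c (\<xi> \<odot>\<^bsub>X\<^esub> x)" if "x \<in> carrier X" for c x
    using \<xi> that by (simp add: scaleK_smult_commute)
  show "(\<lambda>\<omega>. norm (L0_rep \<xi> \<omega>)) \<in> borel_measurable M"
    by (rule measurable_compose[OF L0_rep_measurable[OF \<xi>] borel_measurable_norm])
  show "AE \<omega> in M. rnorm (\<xi> \<odot>\<^bsub>X\<^esub> z) \<omega> \<le> norm (L0_rep \<xi> \<omega>) * rnorm z \<omega>" if "z \<in> carrier X" for z
    using rnorm_smult[OF \<xi> that] by eventually_elim simp
qed simp

lemma scaleK_op: "scaleK M X c \<in> BX"
  using smult_op[OF L0_const_in, of c] by (simp add: scaleK_def[abs_def])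

lemmas rlim_scaleK = op_rlim[OF scaleK_op]

lemma rlim_minus:
  assumes "rlim f a F" "rlim g b F"
  shows "rlim (\<lambda>i. f i \<ominus>\<^bsub>X\<^esub> g i) (a \<ominus>\<^bsub>X\<^esub> b) F"
proof (rule rlim_cong)
  have ev: "\<forall>\<^sub>F i in F. g i \<in> carrier X" and b: "b \<in> carrier X"
    using assms by (auto simp: rlim_iff)
  show "rlim (\<lambda>i. f i \<oplus>\<^bsub>X\<^esub> scaleK M X (- 1) (g i)) (a \<ominus>\<^bsub>X\<^esub> b) F"
    using rlim_add[OF assms(1) rlim_scaleK[OF assms(2), of "- 1"]] b
    by (simp add: scaleK_uminus RN.M.minus_eq)
  show "\<forall>\<^sub>F i in F. f i \<oplus>\<^bsub>X\<^esub> scaleK M X (- 1) (g i) = f i \<ominus>\<^bsub>X\<^esub> g i"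
    using ev by eventually_elim (simp add: scaleK_uminus RN.M.minus_eq)
qed

lemma op_finsum:
  assumes "T \<in> BX" "finite S" "x \<in> S \<rightarrow> carrier X"
  shows "T (\<Oplus>\<^bsub>X\<^esub>i\<in>S. x i) = (\<Oplus>\<^bsub>X\<^esub>i\<in>S. T (x i))"
  using assms by (intro finsum_additive) (auto simp: op_add)

text \<open>For every scalar \<open>c\<close>, the norm of \<open>T (\<xi> x) - \<xi> T x = T ((\<xi> - c) x) - (\<xi> - c) T x\<close> is at most
  \<open>2 \<eta> \<bar>\<xi> - c\<bar> \<parallel>x\<parallel>\<close>; letting \<open>c\<close> run through a countable dense set shows that it vanishes.\<close>

lemma op_smult:
  assumes T: "T \<in> BX" and \<xi>: "\<xi> \<in> L0 M" and x: "x \<in> carrier X"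
  shows "T (\<xi> \<odot>\<^bsub>X\<^esub> x) = \<xi> \<odot>\<^bsub>X\<^esub> T x"
proof (rule minus_eq_0D)
  let ?d = "T (\<xi> \<odot>\<^bsub>X\<^esub> x) \<ominus>\<^bsub>X\<^esub> \<xi> \<odot>\<^bsub>X\<^esub> T x"
  obtain \<eta> where \<eta>: "\<eta> \<in> borel_measurable M" "AE \<omega> in M. 0 \<le> \<eta> \<omega>"
    "\<And>z. z \<in> carrier X \<Longrightarrow> AE \<omega> in M. rnorm (T z) \<omega> \<le> \<eta> \<omega> * rnorm z \<omega>"
    using op_boundE[OF T] by blast
  obtain D :: "'k set" where D: "countable D" "\<And>U. open U \<Longrightarrow> U \<noteq> {} \<Longrightarrow> \<exists>d\<in>D. d \<in> U"
    using countable_dense_exists by metis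
  have "AE \<omega> in M. rnorm ?d \<omega> \<le> 2 * \<eta> \<omega> * rnorm x \<omega> * norm (L0_rep \<xi> \<omega> - c)" for c
  proof -
    define \<zeta> where "\<zeta> = \<xi> \<oplus>\<^bsub>L0_ring M\<^esub> L0_const M (- c)"
    have \<zeta>: "\<zeta> \<in> L0 M"
      using RN.R.a_closed[of \<xi> "L0_const M (- c)"] \<xi> by (simp add: \<zeta>_def L0_carrier L0_const_in)
    have rep: "AE \<omega> in M. L0_rep \<zeta> \<omega> = L0_rep \<xi> \<omega> - c"
      unfolding \<zeta>_def using L0_rep_add[OF \<xi> L0_const_in[of "- c"]] L0_rep_const[of "- c"]
      by eventually_elim simp
    have spl: "\<zeta> \<odot>\<^bsub>X\<^esub> y = \<xi> \<odot>\<^bsub>X\<^esub> y \<oplus>\<^bsub>X\<^esub> scaleK M X (- c) y" if "y \<in> carrier X" for y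
      unfolding \<zeta>_def scaleK_def
      using that \<xi> by (intro RN.smult_l_distr) (simp_all add: L0_carrier L0_const_in)
    have "T (\<zeta> \<odot>\<^bsub>X\<^esub> x) \<ominus>\<^bsub>X\<^esub> \<zeta> \<odot>\<^bsub>X\<^esub> T x = ?d"
      using T \<xi> x by (simp add: spl op_add op_scaleK minus_add_swap)
    moreover have "AE \<omega> in M. rnorm (T (\<zeta> \<odot>\<^bsub>X\<^esub> x) \<ominus>\<^bsub>X\<^esub> \<zeta> \<odot>\<^bsub>X\<^esub> T x) \<omega>
        \<le> rnorm (T (\<zeta> \<odot>\<^bsub>X\<^esub> x)) \<omega> + rnorm (\<zeta> \<odot>\<^bsub>X\<^esub> T x) \<omega>"
      using T \<zeta> x by (intro rnorm_minus_le) auto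
    ultimately have "AE \<omega> in M. rnorm ?d \<omega> \<le> rnorm (T (\<zeta> \<odot>\<^bsub>X\<^esub> x)) \<omega> + rnorm (\<zeta> \<odot>\<^bsub>X\<^esub> T x) \<omega>"
      by simp
    with \<eta>(3)[OF smult_in[OF \<zeta> x]] \<eta>(3)[OF x] rnorm_smult[OF \<zeta> x]
      rnorm_smult[OF \<zeta> op_closed[OF T x]] rep show ?thesis
    proof eventually_elim
      case (elim \<omega>)
      have "norm (L0_rep \<xi> \<omega> - c) * rnorm (T x) \<omega> \<le> norm (L0_rep \<xi> \<omega> - c) * (\<eta> \<omega> * rnorm x \<omega>)"
        using elim by (intro mult_left_mono) auto
      then show ?case using elim by (simp add: algebra_simps)
    qed
  qed
  \<comment> \<open>Countability of \<open>D\<close> yields one null set for all \<open>c\<close>,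
    after which \<open>c\<close> may be chosen depending on the point
    \<open>\<omega>\<close>.\<close>
  then have ae: "AE \<omega> in M. \<forall>c\<in>D. rnorm ?d \<omega> \<le> 2 * \<eta> \<omega> * rnorm x \<omega> * norm (L0_rep \<xi> \<omega> - c)"
    using D(1) by (subst AE_ball_countable) auto
  have d: "?d \<in> carrier X" using T \<xi> x by simp
  from ae have "AE \<omega> in M. rnorm ?d \<omega> = 0"
    using rnorm_nonneg[OF d] rnorm_nonneg[OF x] \<eta>(2)
  proof eventually_elim
    case (elim \<omega>)
    have "0 \<le> rnorm ?d \<omega>" using elim by simp
    moreover have "rnorm ?d \<omega> \<le> 0"
    proof (rule field_le_epsilon)
      fix e :: real assume e: "e > 0"
      let ?K = "2 * \<eta> \<omega> * rnorm x \<omega>"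
      have K: "0 \<le> ?K" using elim by simp
      \<comment> \<open>The summand 1 covers \<open>?K = 0\<close> and keeps
        \<open>?K * (e / (?K + 1)) \<le> e\<close>.\<close>
      then have "0 < e / (?K + 1)" using e by (intro divide_pos_pos) auto
      then obtain c where c: "c \<in> D" "c \<in> ball (L0_rep \<xi> \<omega>) (e / (?K + 1))"
        using D(2)[of "ball (L0_rep \<xi> \<omega>) (e / (?K + 1))"] by auto
      have "rnorm ?d \<omega> \<le> ?K * norm (L0_rep \<xi> \<omega> - c)" using elim c by simp
      also have "\<dots> \<le> ?K * (e / (?K + 1))"
        using c(2) K by (intro mult_left_mono) (auto simp: dist_norm)
      also have "\<dots> \<le> e" using K e by (simp add: field_simps)
      finally show "rnorm ?d \<omega> \<le> 0 + e" by simp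
    qed
    ultimately show ?case by simp
  qed
  then show "?d = \<zero>\<^bsub>X\<^esub>" by (rule rnorm_eq_0D[OF d])
qed (use T \<xi> x in auto)

end

subsection \<open>Essential suprema of families\<close>

context prob_space
begin

text \<open>Exhaustion: the supremum of the probabilities of countable unions from the family is
  attained by such a union, and joining one more member to it cannot raise the probability.\<close>

lemma essential_union:
  assumes "\<A> \<noteq> {}" "\<A> \<subseteq> events"
  obtains F :: "nat \<Rightarrow> 'a set" where "range F \<subseteq> \<A>"
    "\<And>A. A \<in> \<A> \<Longrightarrow> AE \<omega> in M. \<omega> \<in> A \<longrightarrow> (\<exists>n. \<omega> \<in> F n)"
proof -
  define P where "P = {prob (\<Union>n. F n) |F :: nat \<Rightarrow> 'a set. range F \<subseteq> \<A>}"
  have bdd: "bdd_above P" by (rule bdd_aboveI[of _ 1]) (auto simp: P_def)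
  have ne: "P \<noteq> {}"
    using assms(1) by (auto simp: P_def image_subset_iff)
  have "\<exists>F :: nat \<Rightarrow> 'a set. range F \<subseteq> \<A> \<and> prob (\<Union>n. F n) > Sup P - 1 / real (Suc k)" for k
  proof -
    have "Sup P - 1 / real (Suc k) < Sup P" by simp
    then obtain p where "p \<in> P" "p > Sup P - 1 / real (Suc k)"
      using less_cSupD[OF ne] by blast
    moreover from \<open>p \<in> P\<close> obtain F :: "nat \<Rightarrow> 'a set" where "range F \<subseteq> \<A>" "p = prob (\<Union>n. F n)"
      unfolding P_def by blast
    ultimately show ?thesis by blast
  qed
  then obtain F :: "nat \<Rightarrow> nat \<Rightarrow> 'a set" where F: "\<And>k. range (F k) \<subseteq> \<A>" "\<And>k. prob (\<Union>n. F k n) > Sup P - 1 / real (Suc k)"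
    by metis
  \<comment> \<open>Countably many sequences that come within \<open>1 / (k + 1)\<close> of the
    supremum are merged into one, whose union attains it.\<close>
  define G where "G m = F (fst (prod_decode m)) (snd (prod_decode m))" for m
  have G: "range G \<subseteq> \<A>" using F(1) by (auto simp: G_def)
  then have G_ev [measurable]: "G m \<in> events" for m using assms(2) by auto
  have "Sup P \<le> prob (\<Union>m. G m)"
  proof (rule field_le_epsilon)
    fix e :: real assume "e > 0"
    then obtain k where k: "1 / real (Suc k) < e" by (meson nat_approx_posE)
    have "F k n = G (prod_encode (k, n))" for n by (simp add: G_def)
    then have "(\<Union>n. F k n) \<subseteq> (\<Union>m. G m)" by auto
    then have "prob (\<Union>n. F k n) \<le> prob (\<Union>m. G m)"
      by (intro finite_measure_mono) auto
    then show "Sup P \<le> prob (\<Union>m. G m) + e" using F(2)[of k] k by simp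
  qed
  show ?thesis
  proof (rule that[OF G])
    fix A assume A: "A \<in> \<A>"
    then have [measurable]: "A \<in> events" using assms(2) by auto
    let ?G = "\<Union>m. G m"
    \<comment> \<open>Prepending \<open>A\<close> gives another competitor in \<open>P\<close>, so
      its union has probability at most \<open>Sup P\<close>; hence \<open>A\<close> adds only a
      null set.\<close>
    define G' where "G' m = (case m of 0 \<Rightarrow> A | Suc m \<Rightarrow> G m)" for m
    have "range G' \<subseteq> \<A>" using A G by (auto simp: G'_def image_subset_iff split: nat.splits)
    then have le: "prob (\<Union>m. G' m) \<le> Sup P"
      unfolding P_def by (intro cSup_upper bdd[unfolded P_def]) blast
    have "(\<Union>m. G' m) = G' 0 \<union> (\<Union>m. G' (Suc m))"
      by (subst UNIV_nat_eq) (simp add: image_image)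
    then have G'_eq: "(\<Union>m. G' m) = ?G \<union> (A - ?G)"
      by (simp add: G'_def Un_commute)
    have "prob (?G \<union> (A - ?G)) = prob ?G + prob (A - ?G)"
      by (rule finite_measure_Union) auto
    with G'_eq have "prob (\<Union>m. G' m) = prob ?G + prob (A - ?G)" by simp
    then have "prob (A - ?G) = 0"
      using le \<open>Sup P \<le> prob (\<Union>m. G m)\<close> measure_nonneg[of M "A - ?G"] by linarith
    then have "AE \<omega> in M. \<omega> \<notin> A - ?G"
      by (intro AE_I[of _ _ "A - ?G"]) (auto simp: emeasure_eq_measure)
    then show "AE \<omega> in M. \<omega> \<in> A \<longrightarrow> (\<exists>n. \<omega> \<in> G n)" by eventually_elim auto
  qed
qed

text \<open>Reduces to sets: apply \<open>essential_union\<close> to the superlevel sets at each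
  rational \<open>q\<close> and collect the countably many functions so obtained. A point with
  \<open>f\<close> above their supremum would have a rational strictly in between.\<close>

lemma essential_Sup:
  fixes S :: "('a \<Rightarrow> ereal) set"
  assumes "S \<noteq> {}" "S \<subseteq> borel_measurable M"
  obtains g :: "nat \<Rightarrow> 'a \<Rightarrow> ereal" where "range g \<subseteq> S"
    "\<And>f. f \<in> S \<Longrightarrow> AE \<omega> in M. f \<omega> \<le> (SUP n. g n \<omega>)"
proof -
  define B where "B q f = {\<omega> \<in> space M. f \<omega> > ereal (real_of_rat q)}" for q and f :: "'a \<Rightarrow> ereal"
  have B_ev: "B q f \<in> events" if "f \<in> S" for q f
  proof -
    have [measurable]: "f \<in> borel_measurable M" using that assms(2) by auto
    show ?thesis unfolding B_def by measurable
  qed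
  have "\<exists>h :: nat \<Rightarrow> 'a \<Rightarrow> ereal. range h \<subseteq> S \<and>
      (\<forall>f\<in>S. AE \<omega> in M. \<omega> \<in> B q f \<longrightarrow> (\<exists>n. \<omega> \<in> B q (h n)))" for q
  proof -
    have "B q ` S \<noteq> {}" "B q ` S \<subseteq> events"
      using assms(1) B_ev by auto
    then obtain F :: "nat \<Rightarrow> 'a set" where F: "range F \<subseteq> B q ` S"
      "\<And>A. A \<in> B q ` S \<Longrightarrow> AE \<omega> in M. \<omega> \<in> A \<longrightarrow> (\<exists>n. \<omega> \<in> F n)"
      by (rule essential_union) blast
    from F(1) have "\<forall>n. \<exists>f. f \<in> S \<and> F n = B q f" by (auto simp: image_subset_iff)
    then obtain h where h: "\<And>n. h n \<in> S" "\<And>n. F n = B q (h n)" by metis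
    then show ?thesis using F(2) by (intro exI[of _ h]) auto
  qed
  then have "\<forall>q. \<exists>h :: nat \<Rightarrow> 'a \<Rightarrow> ereal. range h \<subseteq> S \<and>
      (\<forall>f\<in>S. AE \<omega> in M. \<omega> \<in> B q f \<longrightarrow> (\<exists>n. \<omega> \<in> B q (h n)))" by (rule allI)
  from choice[OF this] obtain h :: "rat \<Rightarrow> nat \<Rightarrow> 'a \<Rightarrow> ereal"
    where h': "\<forall>q. range (h q) \<subseteq> S \<and>
      (\<forall>f\<in>S. AE \<omega> in M. \<omega> \<in> B q f \<longrightarrow> (\<exists>n. \<omega> \<in> B q (h q n)))" by (rule exE)
  have h1: "range (h q) \<subseteq> S" for q
    using h'[rule_format, of q] by (rule conjunct1)
  have h2: "AE \<omega> in M. \<omega> \<in> B q f \<longrightarrow> (\<exists>n. \<omega> \<in> B q (h q n))" if "f \<in> S" for q f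
    by (rule bspec[OF conjunct2[OF h'[rule_format, of q]] that])
  define g where "g m = (case from_nat m :: rat \<times> nat of (q, n) \<Rightarrow> h q n)" for m
  show ?thesis
  proof (rule that[of g])
    show "range g \<subseteq> S" using h1 by (auto simp: g_def image_subset_iff split: prod.split)
    fix f assume "f \<in> S"
    then have "AE \<omega> in M. \<forall>q. \<omega> \<in> B q f \<longrightarrow> (\<exists>n. \<omega> \<in> B q (h q n))"
      using h2 by (subst AE_all_countable) blast
    then show "AE \<omega> in M. f \<omega> \<le> (SUP n. g n \<omega>)"
      using AE_space
    proof eventually_elim
      case (elim \<omega>)
      show ?case
      proof (rule ccontr)
        assume "\<not> f \<omega> \<le> (SUP n. g n \<omega>)"
        then obtain q where q: "(SUP n. g n \<omega>) < ereal (real_of_rat q)" "ereal (real_of_rat q) < f \<omega>"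
          using ereal_dense3 by (metis not_le)
        then obtain n where "ereal (real_of_rat q) < h q n \<omega>"
          using elim by (auto simp: B_def)
        moreover have "h q n = g (to_nat (q, n))" by (simp add: g_def)
        then have "h q n \<omega> \<le> (SUP n. g n \<omega>)" by (auto intro: SUP_upper)
        ultimately show False using q by (simp add: less_le_not_le order_trans)
      qed
    qed
  qed
qed

lemma essential_Inf:
  fixes S :: "('a \<Rightarrow> ereal) set"
  assumes "S \<noteq> {}" "S \<subseteq> borel_measurable M"
  obtains g :: "nat \<Rightarrow> 'a \<Rightarrow> ereal" where "range g \<subseteq> S"
    "\<And>f. f \<in> S \<Longrightarrow> AE \<omega> in M. (INF n. g n \<omega>) \<le> f \<omega>"
proof -
  define m where "m f = (\<lambda>\<omega>. - f \<omega>)" for f :: "'a \<Rightarrow> ereal"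
  have "m ` S \<noteq> {}" "m ` S \<subseteq> borel_measurable M" using assms by (auto simp: m_def)
  then obtain g :: "nat \<Rightarrow> 'a \<Rightarrow> ereal" where g: "range g \<subseteq> m ` S" "\<And>f. f \<in> m ` S \<Longrightarrow> AE \<omega> in M. f \<omega> \<le> (SUP n. g n \<omega>)"
    by (rule essential_Sup) blast
  have mm: "m (m f) = f" for f by (simp add: m_def)
  show ?thesis
  proof (rule that[of "\<lambda>n. m (g n)"])
    show "range (\<lambda>n. m (g n)) \<subseteq> S"
    proof safe
      fix n
      obtain f where "f \<in> S" "g n = m f" using g(1) by blast
      then show "m (g n) \<in> S" by (simp add: mm)
    qed
    fix f assume "f \<in> S"
    then have "AE \<omega> in M. m f \<omega> \<le> (SUP n. g n \<omega>)" by (intro g(2)) auto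
    then show "AE \<omega> in M. (INF n. m (g n) \<omega>) \<le> f \<omega>"
      by eventually_elim (simp add: m_def ereal_INF_uminus_eq ereal_uminus_le_reorder)
  qed
qed

text \<open>The lattice operation is a choice among least upper bounds, so one has to exist before
  anything can be said about the chosen one.\<close>

lemma least_L0bar:
  fixes A :: "('a \<Rightarrow> ereal) set set"
  assumes A: "A \<noteq> {}" "A \<subseteq> L0 M"
  obtains s where "least (L0bar M) s (Upper (L0bar M) A)"
proof -
  have le: "le (L0bar M) = L0_le M" "carrier (L0bar M) = L0 M" by (simp_all add: L0bar_def)
  have ne: "L0_rep ` A \<noteq> {}" and sub: "L0_rep ` A \<subseteq> borel_measurable M"
    using A by (auto simp: L0_rep_measurable)
  then obtain g :: "nat \<Rightarrow> 'a \<Rightarrow> ereal" where g: "range g \<subseteq> L0_rep ` A"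
    "\<And>f. f \<in> L0_rep ` A \<Longrightarrow> AE \<omega> in M. f \<omega> \<le> (SUP n. g n \<omega>)"
    by (rule essential_Sup) blast
  have [measurable]: "g n \<in> borel_measurable M" for n
    using g(1) sub by blast
  define s where "s = L0_class M (\<lambda>\<omega>. SUP n. g n \<omega>)"
  have sm: "(\<lambda>\<omega>. SUP n. g n \<omega>) \<in> borel_measurable M" by measurable
  have s: "s \<in> L0 M" unfolding s_def by (rule L0_class_in_L0[OF sm])
  have rep: "AE \<omega> in M. L0_rep s \<omega> = (SUP n. g n \<omega>)" unfolding s_def by (rule L0_rep_class[OF sm])
  have "least (L0bar M) s (Upper (L0bar M) A)"
    unfolding least_def Upper_def le
  proof (intro conjI ballI)
    have "L0_le M x s" if "x \<in> A" for x
      unfolding L0_le_def using g(2)[OF imageI[OF that]] rep by eventually_elim simp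
    then show "s \<in> {u. \<forall>x. x \<in> A \<inter> L0 M \<longrightarrow> L0_le M x u} \<inter> L0 M" using s by auto
    fix u assume u: "u \<in> {u. \<forall>x. x \<in> A \<inter> L0 M \<longrightarrow> L0_le M x u} \<inter> L0 M"
    have "AE \<omega> in M. g n \<omega> \<le> L0_rep u \<omega>" for n
    proof -
      obtain x where "x \<in> A" "g n = L0_rep x" using g(1) by blast
      then show ?thesis using u A(2) by (auto simp: L0_le_def)
    qed
    then have "AE \<omega> in M. \<forall>n. g n \<omega> \<le> L0_rep u \<omega>" by (simp add: AE_all_countable)
    then show "L0_le M s u"
      unfolding L0_le_def using rep by eventually_elim (auto intro: SUP_least)
  qed (simp_all add: s)
  then show ?thesis by (rule that)
qed

lemma sup_L0bar_upper:
  fixes A :: "('a \<Rightarrow> ereal) set set"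
  assumes "A \<subseteq> L0 M" "x \<in> A"
  shows "L0_le M x (\<Squnion>\<^bsub>L0bar M\<^esub> A)"
proof -
  have "A \<noteq> {}" using assms by blast
  then have "\<exists>s. least (L0bar M) s (Upper (L0bar M) A)" using least_L0bar assms by metis
  then have "least (L0bar M) (\<Squnion>\<^bsub>L0bar M\<^esub> A) (Upper (L0bar M) A)"
    unfolding sup_def by (rule someI_ex)
  then show ?thesis using assms by (auto simp: least_def Upper_def L0bar_def)
qed

text \<open>The countable subfamily is what makes the infimum usable: an inequality known a.s. for
  each member passes to the infimum only if the exceptional null sets can be united.\<close>

lemma inf_L0bar:
  fixes A :: "('a \<Rightarrow> ereal) set set"
  assumes A: "A \<noteq> {}" "A \<subseteq> L0 M"
  obtains \<xi> :: "nat \<Rightarrow> ('a \<Rightarrow> ereal) set" where "range \<xi> \<subseteq> A"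
    "AE \<omega> in M. L0_rep (\<Sqinter>\<^bsub>L0bar M\<^esub> A) \<omega> = (INF n. L0_rep (\<xi> n) \<omega>)"
    "\<Sqinter>\<^bsub>L0bar M\<^esub> A \<in> L0 M"
proof -
  have le: "le (L0bar M) = L0_le M" "carrier (L0bar M) = L0 M" by (simp_all add: L0bar_def)
  have "L0_rep ` A \<noteq> {}" "L0_rep ` A \<subseteq> borel_measurable M"
    using A by (auto simp: L0_rep_measurable)
  then obtain g :: "nat \<Rightarrow> 'a \<Rightarrow> ereal" where g: "range g \<subseteq> L0_rep ` A"
    "\<And>f. f \<in> L0_rep ` A \<Longrightarrow> AE \<omega> in M. (INF n. g n \<omega>) \<le> f \<omega>"
    by (rule essential_Inf) blast
  from g(1) have "\<forall>n. \<exists>x. x \<in> A \<and> g n = L0_rep x" by blast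
  then obtain \<xi> where \<xi>: "\<And>n. \<xi> n \<in> A" "\<And>n. g n = L0_rep (\<xi> n)" by metis
  have [measurable]: "g n \<in> borel_measurable M" for n
    unfolding \<xi>(2) using \<xi>(1)[of n] A(2) by (intro L0_rep_measurable) blast
  define i where "i = L0_class M (\<lambda>\<omega>. INF n. g n \<omega>)"
  have im: "(\<lambda>\<omega>. INF n. g n \<omega>) \<in> borel_measurable M" by measurable
  have i: "i \<in> L0 M" unfolding i_def by (rule L0_class_in_L0[OF im])
  have rep: "AE \<omega> in M. L0_rep i \<omega> = (INF n. g n \<omega>)" unfolding i_def by (rule L0_rep_class[OF im])
  have i_lower: "L0_le M i x" if "x \<in> A" for x
    unfolding L0_le_def using g(2)[OF imageI[OF that]] rep by eventually_elim simp
  have i_greatest: "L0_le M u i" if u: "\<And>x. x \<in> A \<Longrightarrow> L0_le M u x" for u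
  proof -
    have "AE \<omega> in M. L0_rep u \<omega> \<le> g n \<omega>" for n
      using u[OF \<xi>(1)[of n]] by (simp add: L0_le_def \<xi>(2))
    then have "AE \<omega> in M. \<forall>n. L0_rep u \<omega> \<le> g n \<omega>" by (simp add: AE_all_countable)
    then show "L0_le M u i"
      unfolding L0_le_def using rep by eventually_elim (auto intro: INF_greatest)
  qed
  have "greatest (L0bar M) i (Lower (L0bar M) A)"
    unfolding greatest_def Lower_def le using i_lower i_greatest i A(2) by auto
  \<comment> \<open>The chosen infimum is compared with the constructed \<open>i\<close> in both
    directions, which fixes its representative up to a null set.\<close>
  then have "greatest (L0bar M) (\<Sqinter>\<^bsub>L0bar M\<^esub> A) (Lower (L0bar M) A)"
    unfolding inf_def by (rule someI)
  then have g': "\<Sqinter>\<^bsub>L0bar M\<^esub> A \<in> L0 M" "L0_le M i (\<Sqinter>\<^bsub>L0bar M\<^esub> A)" "L0_le M (\<Sqinter>\<^bsub>L0bar M\<^esub> A) i"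
    using i_lower i_greatest i A(2) unfolding greatest_def Lower_def le by auto
  show ?thesis
  proof (rule that[of \<xi>])
    show "range \<xi> \<subseteq> A" using \<xi> by auto
    show "AE \<omega> in M. L0_rep (\<Sqinter>\<^bsub>L0bar M\<^esub> A) \<omega> = (INF n. L0_rep (\<xi> n) \<omega>)"
      using g'(2,3) rep unfolding L0_le_def by eventually_elim (simp add: \<xi>(2))
  qed (rule g'(1))
qed

lemma L0_ext_in: "\<eta> \<in> L0 M \<Longrightarrow> L0_ext M \<eta> \<in> L0 M"
  unfolding L0_ext_def using L0_rep_measurable[of \<eta> M] by (intro L0_class_in_L0) simp

lemma L0_rep_ext: "\<eta> \<in> L0 M \<Longrightarrow> AE \<omega> in M. L0_rep (L0_ext M \<eta>) \<omega> = ereal (L0_rep \<eta> \<omega>)"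
  unfolding L0_ext_def using L0_rep_measurable[of \<eta> M] by (intro L0_rep_class) simp

end

section \<open>Bounds obtained from operator norms\<close>

context RN_module
begin

lemma as_bounds_nonempty: "T \<in> BX \<Longrightarrow> as_bounds M X nrm T \<noteq> {}"
  unfolding as_bounded_ops_def by blast

lemma ext_as_bounds_L0: "L0_ext M ` as_bounds M X nrm T \<subseteq> L0 M"
proof (rule image_subsetI)
  fix \<eta> assume "\<eta> \<in> as_bounds M X nrm T"
  then have "\<eta> \<in> L0 M" by (simp only: as_bounds_iff L0_plus_iff)
  then show "L0_ext M \<eta> \<in> L0 M" by (rule L0_ext_in)
qed

lemma op_norm_in:
  assumes "T \<in> BX"
  shows "op_norm M X nrm T \<in> L0 M"
proof -
  have "L0_ext M ` as_bounds M X nrm T \<noteq> {}" using as_bounds_nonempty[OF assms] by simp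
  then show ?thesis unfolding op_norm_def by (rule inf_L0bar[OF _ ext_as_bounds_L0])
qed

text \<open>The norm is a.s. an infimum of countably many bounds \<open>b n\<close>. Where
  \<open>rnorm z\<close> is positive one divides by it before taking the infimum; where it vanishes,
  any single \<open>b n\<close> forces \<open>rnorm (T z)\<close> to be at most 0.\<close>

lemma op_norm_bound:
  assumes T: "T \<in> BX" and z: "z \<in> carrier X"
    and le: "AE \<omega> in M. L0_rep (op_norm M X nrm T) \<omega> \<le> ereal (\<eta> \<omega>)"
  shows "AE \<omega> in M. rnorm (T z) \<omega> \<le> \<eta> \<omega> * rnorm z \<omega>"
proof -
  let ?A = "L0_ext M ` as_bounds M X nrm T"
  have "?A \<noteq> {}" using as_bounds_nonempty[OF T] by simp
  then obtain \<xi> :: "nat \<Rightarrow> ('a \<Rightarrow> ereal) set" where \<xi>: "range \<xi> \<subseteq> ?A"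
    "AE \<omega> in M. L0_rep (op_norm M X nrm T) \<omega> = (INF n. L0_rep (\<xi> n) \<omega>)"
    unfolding op_norm_def by (rule inf_L0bar[OF _ ext_as_bounds_L0])
  from \<xi>(1) have "\<forall>n. \<exists>b. b \<in> as_bounds M X nrm T \<and> \<xi> n = L0_ext M b" by blast
  then obtain b where b: "\<And>n. b n \<in> as_bounds M X nrm T" "\<And>n. \<xi> n = L0_ext M (b n)" by metis
  have "AE \<omega> in M. L0_rep (\<xi> n) \<omega> = ereal (L0_rep (b n) \<omega>) \<and>
      rnorm (T z) \<omega> \<le> L0_rep (b n) \<omega> * rnorm z \<omega>" for n
    using b[of n] z by (auto simp: as_bounds_iff L0_plus_iff L0_rep_ext)
  then have "AE \<omega> in M. \<forall>n. L0_rep (\<xi> n) \<omega> = ereal (L0_rep (b n) \<omega>) \<and>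
      rnorm (T z) \<omega> \<le> L0_rep (b n) \<omega> * rnorm z \<omega>"
    by (intro AE_all_countable[THEN iffD2] allI)
  with \<xi>(2) le rnorm_nonneg[OF z] show ?thesis
  proof eventually_elim
    case (elim \<omega>)
    show ?case
    proof (cases "rnorm z \<omega> = 0")
      case False
      then have pos: "rnorm z \<omega> > 0" using elim by simp
      have "ereal (rnorm (T z) \<omega> / rnorm z \<omega>) \<le> (INF n. L0_rep (\<xi> n) \<omega>)"
        using elim pos by (intro INF_greatest) (simp add: pos_divide_le_eq)
      also have "\<dots> \<le> ereal (\<eta> \<omega>)" using elim by simp
      finally show ?thesis using pos by (simp add: pos_divide_le_eq)
    qed (use elim in simp)
  qed
qed

text \<open>The bound \<open>\<eta>\<close> is common to all times up to \<open>l\<close>, while the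
  exceptional null set may vary with \<open>s\<close> and \<open>z\<close>.\<close>

lemma locally_boundedE:
  assumes V: "\<And>s. 0 \<le> s \<Longrightarrow> V s \<in> BX" and "locally_as_bounded M X nrm V" "0 < l"
  obtains \<eta> :: "'a \<Rightarrow> real" where "\<eta> \<in> borel_measurable M" "AE \<omega> in M. 0 \<le> \<eta> \<omega>"
    "\<And>s z. 0 \<le> s \<Longrightarrow> s \<le> l \<Longrightarrow> z \<in> carrier X \<Longrightarrow> AE \<omega> in M. rnorm (V s z) \<omega> \<le> \<eta> \<omega> * rnorm z \<omega>"
proof -
  let ?A = "(\<lambda>s. op_norm M X nrm (V s)) ` {0..l}"
  obtain \<eta> where \<eta>: "\<eta> \<in> L0_plus M" "\<Squnion>\<^bsub>L0bar M\<^esub> ?A = L0_ext M \<eta>"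
    using assms(2,3) by (auto simp: locally_as_bounded_def)
  have A: "?A \<subseteq> L0 M" using V by (auto intro: op_norm_in)
  show ?thesis
  proof (rule that[of "L0_rep \<eta>"])
    show "L0_rep \<eta> \<in> borel_measurable M" "AE \<omega> in M. 0 \<le> L0_rep \<eta> \<omega>"
      using \<eta>(1) by (auto simp: L0_plus_iff L0_rep_measurable)
    fix s z assume s: "0 \<le> s" "s \<le> l" and z: "z \<in> carrier X"
    have "L0_le M (op_norm M X nrm (V s)) (\<Squnion>\<^bsub>L0bar M\<^esub> ?A)"
      using s by (intro sup_L0bar_upper A) auto
    then have "AE \<omega> in M. L0_rep (op_norm M X nrm (V s)) \<omega> \<le> L0_rep (L0_ext M \<eta>) \<omega>"
      by (simp add: L0_le_def \<eta>(2))
    moreover have "AE \<omega> in M. L0_rep (L0_ext M \<eta>) \<omega> = ereal (L0_rep \<eta> \<omega>)"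
      using \<eta>(1) by (intro L0_rep_ext) (simp add: L0_plus_iff)
    ultimately have "AE \<omega> in M. L0_rep (op_norm M X nrm (V s)) \<omega> \<le> ereal (L0_rep \<eta> \<omega>)"
      by eventually_elim simp
    then show "AE \<omega> in M. rnorm (V s z) \<omega> \<le> L0_rep \<eta> \<omega> * rnorm z \<omega>"
      by (rule op_norm_bound[OF V[OF s(1)] z])
  qed
qed

end

section \<open>The Riemann integral\<close>

text \<open>Refinement of the mesh as a filter on tagged divisions. The integral becomes a limit
  along it, and limit laws, composition and uniqueness of limits replace arguments with explicit
  meshes.\<close>

definition riemann_filter :: "real \<Rightarrow> real \<Rightarrow> (real \<times> real set) set filter" where
  "riemann_filter a b =
    (INF \<delta>\<in>{0<..}. principal {p. p tagged_division_of {a..b} \<and> (\<lambda>t. ball t \<delta>) fine p})"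

lemma fine_ball_mono:
  fixes p :: "(real \<times> real set) set"
  assumes "d \<le> e" "(\<lambda>t. ball t d) fine p"
  shows "(\<lambda>t. ball t e) fine p"
proof (rule fineI)
  fix x k assume "(x, k) \<in> p"
  then have "k \<subseteq> ball x d" by (rule fineD[OF assms(2)])
  also have "\<dots> \<subseteq> ball x e" using assms(1) by (rule subset_ball)
  finally show "k \<subseteq> ball x e" .
qed

lemma eventually_riemann_filter:
  "eventually P (riemann_filter a b) \<longleftrightarrow>
    (\<exists>\<delta>>0. \<forall>p. p tagged_division_of {a..b} \<and> (\<lambda>t. ball t \<delta>) fine p \<longrightarrow> P p)"
  unfolding riemann_filter_def
proof (subst eventually_INF_base)
  fix d e :: real assume de: "d \<in> {0<..}" "e \<in> {0<..}"
  show "\<exists>x\<in>{0<..}. principal {p. p tagged_division_of {a..b} \<and> (\<lambda>t. ball t x) fine p}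
      \<le> inf (principal {p. p tagged_division_of {a..b} \<and> (\<lambda>t. ball t d) fine p})
          (principal {p. p tagged_division_of {a..b} \<and> (\<lambda>t. ball t e) fine p})"
    using de by (intro bexI[of _ "min d e"])
      (auto simp: le_inf_iff intro: fine_ball_mono[of "min d e"])
qed (auto simp: eventually_principal)

text \<open>Existence of fine tagged divisions (Cousin's lemma); uniqueness of the integral rests on
  it.\<close>

lemma riemann_filter_neq_bot: "riemann_filter a b \<noteq> bot"
proof -
  have "\<not> eventually (\<lambda>_. False) (riemann_filter a b)"
    unfolding eventually_riemann_filter
    using fine_division_exists_real[OF gauge_ball, of _ a b] by metis
  then show ?thesis by auto
qed

lemma eventually_riemann_filter_tagged:
  "eventually (\<lambda>p. p tagged_division_of {a..b}) (riemann_filter a b)"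
  unfolding eventually_riemann_filter by (intro exI[of _ 1]) auto

text \<open>Both sides are the integral of the indicator of \<open>{c..d}\<close> over
  \<open>{a..b}\<close>, on the left split along \<open>q\<close>. Common boundary points of the
  cells are taken care of by the integral.\<close>

lemma sum_measure_Int_tagged_division:
  fixes a b c d :: real
  assumes q: "q tagged_division_of {a..b}" and K: "{c..d} \<subseteq> {a..b}"
  shows "(\<Sum>j\<in>q. measure lborel ({c..d} \<inter> snd j)) = measure lborel {c..d}"
proof -
  have lm: "{c..d} \<inter> cbox u v \<in> lmeasurable" for u v
  proof -
    have "{c..d} \<inter> cbox u v = cbox (max c u) (min d v)" by auto
    then show ?thesis by (simp only: lmeasurable_cbox)
  qed
  have m: "measure lebesgue ({c..d} \<inter> cbox u v) = measure lborel ({c..d} \<inter> cbox u v)" for u v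
    by (simp add: measure_completion)
  have int: "integral (cbox u v) (indicator {c..d}) = measure lborel ({c..d} \<inter> cbox u v)" for u v
    using integral_indicator[OF lm[of u v]] m[of u v] by simp
  have "(indicator {c..d} :: real \<Rightarrow> real) integrable_on cbox a b"
    using lm[of a b] integrable_on_indicator[of "{c..d}" "cbox a b"] by simp
  then have "integral (cbox a b) (indicator {c..d}) = (\<Sum>(x, k)\<in>q. integral k (indicator {c..d} :: real \<Rightarrow> real))"
    using q by (intro integral_combine_tagged_division_topdown) auto
  also have "\<dots> = (\<Sum>j\<in>q. measure lborel ({c..d} \<inter> snd j))"
  proof (intro sum.cong refl)
    fix j assume "j \<in> q"
    then obtain u v where "snd j = cbox u v"
      using tagged_division_ofD(4)[OF q, of "fst j" "snd j"] by auto
    then show "(case j of (x, k) \<Rightarrow> integral k (indicator {c..d} :: real \<Rightarrow> real)) = measure lborel ({c..d} \<inter> snd j)"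
      using int[of u v] by (simp add: case_prod_beta)
  qed
  finally have "(\<Sum>j\<in>q. measure lborel ({c..d} \<inter> snd j)) = measure lborel ({c..d} \<inter> cbox a b)"
    using int[of a b] by (simp only:)
  also have "{c..d} \<inter> cbox a b = {c..d}" using K by auto
  finally show ?thesis .
qed

section \<open>Finite sums and Riemann sums in the module\<close>

context RN_module
begin

abbreviation rsum :: "(real \<Rightarrow> 'x) \<Rightarrow> (real \<times> real set) set \<Rightarrow> 'x" where
  "rsum \<equiv> RN_riemann_sum M X"

lemma finsum_finsum:
  assumes "finite A" "finite B" "\<And>i j. i \<in> A \<Longrightarrow> j \<in> B \<Longrightarrow> g i j \<in> carrier X"
  shows "(\<Oplus>\<^bsub>X\<^esub>i\<in>A. \<Oplus>\<^bsub>X\<^esub>j\<in>B. g i j) = (\<Oplus>\<^bsub>X\<^esub>k\<in>A \<times> B. g (fst k) (snd k))"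
  using assms(1,3)
proof (induction A rule: finite_induct)
  case (insert a A)
  have ga: "(\<lambda>j. g a j) \<in> B \<rightarrow> carrier X" using insert.prems by auto
  have eq: "insert a A \<times> B = Pair a ` B \<union> A \<times> B" by auto
  have "(\<Oplus>\<^bsub>X\<^esub>k\<in>Pair a ` B. g (fst k) (snd k)) = (\<Oplus>\<^bsub>X\<^esub>j\<in>B. g a j)"
    using ga by (subst RN.M.finsum_reindex) (auto simp: inj_on_def)
  moreover have "(\<Oplus>\<^bsub>X\<^esub>k\<in>insert a A \<times> B. g (fst k) (snd k)) =
      (\<Oplus>\<^bsub>X\<^esub>k\<in>Pair a ` B. g (fst k) (snd k)) \<oplus>\<^bsub>X\<^esub> (\<Oplus>\<^bsub>X\<^esub>k\<in>A \<times> B. g (fst k) (snd k))"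
    unfolding eq using insert assms(2) by (intro RN.M.finsum_Un_disjoint) auto
  moreover have "(\<Oplus>\<^bsub>X\<^esub>i\<in>insert a A. \<Oplus>\<^bsub>X\<^esub>j\<in>B. g i j) =
      (\<Oplus>\<^bsub>X\<^esub>j\<in>B. g a j) \<oplus>\<^bsub>X\<^esub> (\<Oplus>\<^bsub>X\<^esub>i\<in>A. \<Oplus>\<^bsub>X\<^esub>j\<in>B. g i j)"
    using insert by (intro RN.M.finsum_insert) (auto intro!: RN.M.finsum_closed)
  ultimately show ?case using insert by simp
qed simp

lemma finsum_swap_prod:
  assumes "\<And>i j. i \<in> A \<Longrightarrow> j \<in> B \<Longrightarrow> g i j \<in> carrier X"
  shows "(\<Oplus>\<^bsub>X\<^esub>k\<in>B \<times> A. g (snd k) (fst k)) = (\<Oplus>\<^bsub>X\<^esub>k\<in>A \<times> B. g (fst k) (snd k))"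
proof -
  have "(\<Oplus>\<^bsub>X\<^esub>k\<in>prod.swap ` (A \<times> B). g (snd k) (fst k)) =
      (\<Oplus>\<^bsub>X\<^esub>k\<in>A \<times> B. g (snd (prod.swap k)) (fst (prod.swap k)))"
    using assms by (intro RN.M.finsum_reindex) auto
  then show ?thesis by (simp add: product_swap)
qed

lemma finsum_minus:
  assumes "finite A" "f \<in> A \<rightarrow> carrier X" "g \<in> A \<rightarrow> carrier X"
  shows "(\<Oplus>\<^bsub>X\<^esub>i\<in>A. f i) \<ominus>\<^bsub>X\<^esub> (\<Oplus>\<^bsub>X\<^esub>i\<in>A. g i) = (\<Oplus>\<^bsub>X\<^esub>i\<in>A. f i \<ominus>\<^bsub>X\<^esub> g i)"
  using assms
proof (induction A rule: finite_induct)
  case (insert a A)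
  then have c: "f a \<in> carrier X" "g a \<in> carrier X" "f \<in> A \<rightarrow> carrier X" "g \<in> A \<rightarrow> carrier X"
    "(\<lambda>i. f i \<ominus>\<^bsub>X\<^esub> g i) \<in> A \<rightarrow> carrier X" by auto
  then show ?case using insert by (simp add: minus_add_swap)
qed simp

lemma rscale_sum:
  assumes "finite A" "x \<in> carrier X"
  shows "rscale (\<Sum>i\<in>A. w i) x = (\<Oplus>\<^bsub>X\<^esub>i\<in>A. rscale (w i) x)"
  using assms
proof (induction A rule: finite_induct)
  case (insert a A)
  then have "(\<lambda>i. rscale (w i) x) \<in> A \<rightarrow> carrier X" by auto
  then show ?case using insert by (simp add: scaleK_add_left)
qed simp

lemma tagged_division_tag:
  "p tagged_division_of {a..b::real} \<Longrightarrow> i \<in> p \<Longrightarrow> fst i \<in> {a..b}"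
  using tag_in_interval[of p "{a..b}" "fst i" "snd i"] by simp

lemma tagged_division_interval:
  assumes "p tagged_division_of {a..b::real}" "i \<in> p"
  obtains c d where "snd i = {c..d}" "{c..d} \<subseteq> {a..b}"
proof -
  have i: "(fst i, snd i) \<in> p" using assms(2) by simp
  obtain c d where "snd i = cbox c d" using tagged_division_ofD(4)[OF assms(1) i] by blast
  then show ?thesis using tagged_division_ofD(3)[OF assms(1) i] by (intro that[of c d]) simp_all
qed

lemma rsum_closed:
  assumes "p tagged_division_of {a..b}" "f \<in> {a..b} \<rightarrow> carrier X"
  shows "rsum f p \<in> carrier X"
  unfolding RN_riemann_sum_def
proof (intro RN.M.finsum_closed Pi_I scaleK_closed)
  fix i assume "i \<in> p"
  then show "f (fst i) \<in> carrier X" using tagged_division_tag[OF assms(1)] assms(2) by blast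
qed

text \<open>The difference of two Riemann sums is taken over the common refinement.\<close>

lemma rsum_diff:
  assumes p: "p tagged_division_of {a..b}" and q: "q tagged_division_of {a..b}"
    and f: "f \<in> {a..b} \<rightarrow> carrier X"
  shows "rsum f p \<ominus>\<^bsub>X\<^esub> rsum f q =
    (\<Oplus>\<^bsub>X\<^esub>k\<in>p \<times> q. rscale (measure lborel (snd (fst k) \<inter> snd (snd k)))
       (f (fst (fst k)) \<ominus>\<^bsub>X\<^esub> f (fst (snd k))))"
proof -
  have fin: "finite p" "finite q" using p q by auto
  have f': "f (fst i) \<in> carrier X" if "i \<in> p \<or> i \<in> q" for i
    using that f tagged_division_tag[OF p] tagged_division_tag[OF q] by blast
  \<comment> \<open>The refinement is never built as a division: all pairs of cells are kept, and
    pairs without overlap carry weight 0.\<close>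
  define w where "w i j = measure lborel (snd i \<inter> snd j)" for i j :: "real \<times> real set"
  have wp: "measure lborel (snd i) = (\<Sum>j\<in>q. w i j)" if i: "i \<in> p" for i
  proof -
    obtain c d where "snd i = {c..d}" "{c..d} \<subseteq> {a..b}" by (rule tagged_division_interval[OF p i])
    then show ?thesis using sum_measure_Int_tagged_division[OF q, of c d] by (simp only: w_def)
  qed
  have wq: "measure lborel (snd j) = (\<Sum>i\<in>p. w i j)" if j: "j \<in> q" for j
  proof -
    obtain c d where "snd j = {c..d}" "{c..d} \<subseteq> {a..b}" by (rule tagged_division_interval[OF q j])
    then show ?thesis using sum_measure_Int_tagged_division[OF p, of c d]
      by (simp only: w_def Int_commute)
  qed
  have "rsum f p = (\<Oplus>\<^bsub>X\<^esub>i\<in>p. \<Oplus>\<^bsub>X\<^esub>j\<in>q. rscale (w i j) (f (fst i)))"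
    unfolding RN_riemann_sum_def
    by (intro RN.M.finsum_cong') (use fin f' in \<open>auto simp: wp rscale_sum simp del: of_real_sum intro!: RN.M.finsum_closed\<close>)
  also have "\<dots> = (\<Oplus>\<^bsub>X\<^esub>k\<in>p \<times> q. rscale (w (fst k) (snd k)) (f (fst (fst k))))"
    using fin f' by (intro finsum_finsum) auto
  finally have 1: "rsum f p = (\<Oplus>\<^bsub>X\<^esub>k\<in>p \<times> q. rscale (w (fst k) (snd k)) (f (fst (fst k))))" .
  have "rsum f q = (\<Oplus>\<^bsub>X\<^esub>j\<in>q. \<Oplus>\<^bsub>X\<^esub>i\<in>p. rscale (w i j) (f (fst j)))"
    unfolding RN_riemann_sum_def
    by (intro RN.M.finsum_cong') (use fin f' in \<open>auto simp: wq rscale_sum simp del: of_real_sum intro!: RN.M.finsum_closed\<close>)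
  also have "\<dots> = (\<Oplus>\<^bsub>X\<^esub>k\<in>q \<times> p. rscale (w (snd k) (fst k)) (f (fst (fst k))))"
    using fin f' by (intro finsum_finsum) auto
  also have "\<dots> = (\<Oplus>\<^bsub>X\<^esub>k\<in>p \<times> q. rscale (w (fst k) (snd k)) (f (fst (snd k))))"
    using f' by (intro finsum_swap_prod) auto
  finally have 2: "rsum f q = (\<Oplus>\<^bsub>X\<^esub>k\<in>p \<times> q. rscale (w (fst k) (snd k)) (f (fst (snd k))))" .
  have "rsum f p \<ominus>\<^bsub>X\<^esub> rsum f q = (\<Oplus>\<^bsub>X\<^esub>k\<in>p \<times> q. rscale (w (fst k) (snd k)) (f (fst (fst k)))
      \<ominus>\<^bsub>X\<^esub> rscale (w (fst k) (snd k)) (f (fst (snd k))))"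
    unfolding 1 2 using fin by (intro finsum_minus Pi_I scaleK_closed f') auto
  also have "\<dots> = (\<Oplus>\<^bsub>X\<^esub>k\<in>p \<times> q. rscale (w (fst k) (snd k)) (f (fst (fst k)) \<ominus>\<^bsub>X\<^esub> f (fst (snd k))))"
  proof (intro RN.M.finsum_cong' refl Pi_I scaleK_closed RN.M.minus_closed f')
    fix k assume "k \<in> p \<times> q"
    then have "f (fst (fst k)) \<in> carrier X" "f (fst (snd k)) \<in> carrier X" by (auto intro!: f')
    then show "rscale (w (fst k) (snd k)) (f (fst (fst k))) \<ominus>\<^bsub>X\<^esub> rscale (w (fst k) (snd k)) (f (fst (snd k)))
      = rscale (w (fst k) (snd k)) (f (fst (fst k)) \<ominus>\<^bsub>X\<^esub> f (fst (snd k)))"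
      by (simp add: scaleK_minus_right)
  qed auto
  finally show ?thesis by (simp add: w_def)
qed

text \<open>The form of \<open>fnorm_combination_le\<close> that is applied, with
  \<open>W = b - a\<close> for differences of Riemann sums and \<open>W = 1\<close> for averages.
  Smallness is asked only at positive weights, since nothing relates the tags of two disjoint
  cells.\<close>

lemma fnorm_finsum_weights_le:
  fixes \<eta> :: "'a \<Rightarrow> real"
  assumes \<eta>: "\<eta> \<in> borel_measurable M" and "e > 0" "W \<ge> 0"
  shows "\<exists>d>0. \<forall>(S :: 'i set) (w :: 'i \<Rightarrow> real) x. finite S \<longrightarrow> sum w S = W \<longrightarrow>
    (\<forall>i\<in>S. 0 \<le> w i \<and> x i \<in> carrier X \<and> (AE \<omega> in M. rnorm (x i) \<omega> \<le> \<eta> \<omega>)) \<longrightarrow>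
    (\<forall>i\<in>S. 0 < w i \<longrightarrow> fnorm (x i) \<le> d) \<longrightarrow>
    fnorm (\<Oplus>\<^bsub>X\<^esub>i\<in>S. rscale (w i) (x i)) \<le> e"
proof -
  obtain c where c: "c \<ge> 1" and le: "\<forall>(S :: 'i set) (w :: 'i \<Rightarrow> real) x. finite S \<longrightarrow>
    (\<forall>i\<in>S. 0 \<le> w i \<and> x i \<in> carrier X \<and> (AE \<omega> in M. rnorm (x i) \<omega> \<le> \<eta> \<omega>)) \<longrightarrow>
    fnorm (\<Oplus>\<^bsub>X\<^esub>i\<in>S. rscale (w i) (x i)) \<le> e / 2 + c * (\<Sum>i\<in>S. w i * fnorm (x i))"
    using fnorm_combination_le[OF \<eta> half_gt_zero[OF assms(2)]] by blast
  \<comment> \<open>Chosen so that \<open>c * (W + 1) * d = e / 2\<close>; \<open>W + 1\<close>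
    instead of \<open>W\<close> allows total weight 0.\<close>
  define d where "d = e / (2 * c * (W + 1))"
  have d: "d > 0" using assms c by (simp add: d_def)
  show ?thesis
  proof (intro exI[of _ d] conjI allI impI d)
    fix S :: "'i set" and w :: "'i \<Rightarrow> real" and x
    assume S: "finite S" "sum w S = W"
      and x: "\<forall>i\<in>S. 0 \<le> w i \<and> x i \<in> carrier X \<and> (AE \<omega> in M. rnorm (x i) \<omega> \<le> \<eta> \<omega>)"
      and small: "\<forall>i\<in>S. 0 < w i \<longrightarrow> fnorm (x i) \<le> d"
    have "(\<Sum>i\<in>S. w i * fnorm (x i)) \<le> (\<Sum>i\<in>S. w i * d)"
    proof (rule sum_mono)
      fix i assume "i \<in> S"
      then show "w i * fnorm (x i) \<le> w i * d"
        using x small by (cases "w i = 0") (auto intro!: mult_left_mono)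
    qed
    also have "\<dots> = W * d" by (simp add: S(2) flip: sum_distrib_right)
    also have "\<dots> \<le> (W + 1) * d" using d by (intro mult_right_mono) auto
    finally have "c * (\<Sum>i\<in>S. w i * fnorm (x i)) \<le> c * ((W + 1) * d)"
      using c by (intro mult_left_mono) auto
    also have "\<dots> = e / 2"
    proof -
      have "c \<noteq> 0" "W + 1 \<noteq> 0" using c assms(3) by auto
      then show ?thesis by (simp add: d_def)
    qed
    finally have "c * (\<Sum>i\<in>S. w i * fnorm (x i)) \<le> e / 2" .
    moreover have "fnorm (\<Oplus>\<^bsub>X\<^esub>i\<in>S. rscale (w i) (x i)) \<le> e / 2 + c * (\<Sum>i\<in>S. w i * fnorm (x i))"
      using le S(1) x by blast
    ultimately show "fnorm (\<Oplus>\<^bsub>X\<^esub>i\<in>S. rscale (w i) (x i)) \<le> e" by linarith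
  qed
qed

section \<open>Integrability of bounded continuous functions\<close>

definition rcont :: "real set \<Rightarrow> (real \<Rightarrow> 'x) \<Rightarrow> bool" where
  "rcont S f \<longleftrightarrow> continuous_map (top_of_set S) RD.mtopology f"

lemma rcont_closed: "rcont S f \<Longrightarrow> f \<in> S \<rightarrow> carrier X"
  by (auto simp: rcont_def continuous_map_def)

lemma rcont_subset: "rcont S f \<Longrightarrow> T \<subseteq> S \<Longrightarrow> rcont T f"
  unfolding rcont_def by (metis continuous_map_from_subtopology_mono)

lemma rcont_dist:
  assumes f: "rcont S f" and s: "s \<in> S" and e: "e > 0"
  shows "\<exists>d>0. \<forall>t\<in>S. \<bar>t - s\<bar> < d \<longrightarrow> fnorm (f t \<ominus>\<^bsub>X\<^esub> f s) < e"
proof -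
  obtain U where U: "openin (top_of_set S) U" "s \<in> U" "\<forall>y\<in>U. f y \<in> RD.mball (f s) e"
    using f[unfolded rcont_def RD.continuous_map_to_metric, THEN bspec, of s] s e by auto
  then obtain d where d: "d > 0" "ball s d \<inter> S \<subseteq> U" by (auto simp: openin_contains_ball)
  show ?thesis
  proof (intro exI[of _ d] conjI ballI impI d)
    fix t assume "t \<in> S" "\<bar>t - s\<bar> < d"
    then have "f t \<in> RD.mball (f s) e" using U d by (auto simp: dist_real_def abs_minus_commute)
    then show "fnorm (f t \<ominus>\<^bsub>X\<^esub> f s) < e" by (auto simp: RD.commute[of "f s"] rdist_eq)
  qed
qed

text \<open>Heine-Cantor on the compact interval, applied to the metric objects \<open>?m1\<close>
  and \<open>?m\<close>.\<close>

lemma rcont_uniform: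
  assumes f: "rcont {a..b} f" and e: "e > 0"
  shows "\<exists>d>0. \<forall>s\<in>{a..b}. \<forall>t\<in>{a..b}. \<bar>t - s\<bar> < d \<longrightarrow> fnorm (f t \<ominus>\<^bsub>X\<^esub> f s) < e"
proof -
  let ?m = "metric (carrier X, rdist)" and ?m1 = "submetric euclidean_metric {a..b}"
  have m: "mspace ?m = carrier X" "mdist ?m = rdist" "mtopology_of ?m = RD.mtopology"
    by (simp_all add: RD.mspace_metric RD.mdist_metric mtopology_of_def)
  have m1: "mtopology_of ?m1 = top_of_set {a..b}" by (simp add: mtopology_of_submetric)
  have "uniformly_continuous_map ?m1 ?m f"
    using f by (intro continuous_imp_uniformly_continuous_map)
      (simp add: m m1 rcont_def compact_space_subtopology)
  then obtain d where "d > 0" "\<forall>s\<in>{a..b}. \<forall>t\<in>{a..b}. dist t s < d \<longrightarrow> rdist (f t) (f s) < e"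
    using e unfolding uniformly_continuous_map_def m by auto
  then show ?thesis using rcont_closed[OF f]
    by (intro exI[of _ d]) (auto simp: dist_real_def rdist_eq Pi_iff)
qed

text \<open>Over all pairs of cells the difference is a combination of increments of
  \<open>f\<close> with total weight \<open>b - a\<close>. The increments are bounded by
  \<open>2 * \<eta>\<close>, and uniform continuity makes those of positive weight small.\<close>

lemma rsum_Cauchy:
  fixes \<eta> :: "'a \<Rightarrow> real"
  assumes f: "rcont {a..b} f" and \<eta>: "\<eta> \<in> borel_measurable M"
    and bd: "\<And>t. t \<in> {a..b} \<Longrightarrow> AE \<omega> in M. rnorm (f t) \<omega> \<le> \<eta> \<omega>"
    and "a \<le> b" "e > 0"
  shows "\<exists>\<delta>>0. \<forall>p q. p tagged_division_of {a..b} \<and> (\<lambda>t. ball t \<delta>) fine p \<longrightarrow>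
    q tagged_division_of {a..b} \<and> (\<lambda>t. ball t \<delta>) fine q \<longrightarrow> fnorm (rsum f p \<ominus>\<^bsub>X\<^esub> rsum f q) \<le> e"
proof -
  have fc: "f t \<in> carrier X" if "t \<in> {a..b}" for t using rcont_closed[OF f] that by auto
  have "(\<lambda>\<omega>. 2 * \<eta> \<omega>) \<in> borel_measurable M" using \<eta> by simp
  moreover have "0 \<le> b - a" using assms(4) by simp
  ultimately have "\<exists>d>0. \<forall>(S :: ((real \<times> real set) \<times> (real \<times> real set)) set) w x.
    finite S \<longrightarrow> sum w S = b - a \<longrightarrow>
    (\<forall>i\<in>S. 0 \<le> w i \<and> x i \<in> carrier X \<and> (AE \<omega> in M. rnorm (x i) \<omega> \<le> 2 * \<eta> \<omega>)) \<longrightarrow>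
    (\<forall>i\<in>S. 0 < w i \<longrightarrow> fnorm (x i) \<le> d) \<longrightarrow> fnorm (\<Oplus>\<^bsub>X\<^esub>i\<in>S. rscale (w i) (x i)) \<le> e"
    by (rule fnorm_finsum_weights_le[OF _ assms(5)])
  then obtain d where d: "d > 0" and le: "\<forall>(S :: ((real \<times> real set) \<times> (real \<times> real set)) set) w x.
    finite S \<longrightarrow> sum w S = b - a \<longrightarrow>
    (\<forall>i\<in>S. 0 \<le> w i \<and> x i \<in> carrier X \<and> (AE \<omega> in M. rnorm (x i) \<omega> \<le> 2 * \<eta> \<omega>)) \<longrightarrow>
    (\<forall>i\<in>S. 0 < w i \<longrightarrow> fnorm (x i) \<le> d) \<longrightarrow> fnorm (\<Oplus>\<^bsub>X\<^esub>i\<in>S. rscale (w i) (x i)) \<le> e"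
    by (elim exE conjE)
  obtain r where r: "r > 0" "\<And>s t. s \<in> {a..b} \<Longrightarrow> t \<in> {a..b} \<Longrightarrow> \<bar>t - s\<bar> < r \<Longrightarrow> fnorm (f t \<ominus>\<^bsub>X\<^esub> f s) < d"
    using rcont_uniform[OF f d] by blast
  show ?thesis
  proof (intro exI[of _ "r / 2"] conjI allI impI)
    show "r / 2 > 0" using r by simp
    fix p q
    assume p: "p tagged_division_of {a..b} \<and> (\<lambda>t. ball t (r / 2)) fine p"
      and q: "q tagged_division_of {a..b} \<and> (\<lambda>t. ball t (r / 2)) fine q"
    have fin: "finite p" "finite q" using p q by auto
    have tp: "fst i \<in> {a..b}" if "i \<in> p" for i using tagged_division_tag[of p a b i] p that by simp
    have tq: "fst i \<in> {a..b}" if "i \<in> q" for i using tagged_division_tag[of q a b i] q that by simp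
    define w where "w k = measure lborel (snd (fst k) \<inter> snd (snd k))"
      for k :: "(real \<times> real set) \<times> (real \<times> real set)"
    define x where "x k = f (fst (fst k)) \<ominus>\<^bsub>X\<^esub> f (fst (snd k))"
      for k :: "(real \<times> real set) \<times> (real \<times> real set)"
    have diff: "rsum f p \<ominus>\<^bsub>X\<^esub> rsum f q = (\<Oplus>\<^bsub>X\<^esub>k\<in>p \<times> q. rscale (w k) (x k))"
      unfolding w_def x_def by (rule rsum_diff[OF conjunct1[OF p] conjunct1[OF q] rcont_closed[OF f]])
    have 1: "finite (p \<times> q)" using fin by simp
    have "sum w (p \<times> q) = (\<Sum>i\<in>p. \<Sum>j\<in>q. measure lborel (snd i \<inter> snd j))"
      by (simp add: w_def sum.cartesian_product case_prod_beta)
    also have "\<dots> = (\<Sum>i\<in>p. measure lborel (snd i))"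
    proof (intro sum.cong refl)
      fix i assume i: "i \<in> p"
      obtain c d where "snd i = {c..d}" "{c..d} \<subseteq> {a..b}"
        by (rule tagged_division_interval[OF conjunct1[OF p] i])
      then show "(\<Sum>j\<in>q. measure lborel (snd i \<inter> snd j)) = measure lborel (snd i)"
        using sum_measure_Int_tagged_division[OF conjunct1[OF q], of c d] by (simp only:)
    qed
    also have "\<dots> = b - a"
      using additive_content_tagged_division[of p a b] p assms(4) by (simp add: case_prod_beta)
    finally have 2: "sum w (p \<times> q) = b - a" .
    have t: "fst (fst k) \<in> {a..b}" "fst (snd k) \<in> {a..b}" if "k \<in> p \<times> q" for k
      using tp[of "fst k"] tq[of "snd k"] that mem_Times_iff by blast+
    have 3: "\<forall>k\<in>p \<times> q. 0 \<le> w k \<and> x k \<in> carrier X \<and> (AE \<omega> in M. rnorm (x k) \<omega> \<le> 2 * \<eta> \<omega>)"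
    proof (intro ballI conjI)
      fix k assume k: "k \<in> p \<times> q"
      show "0 \<le> w k" by (simp add: w_def)
      show "x k \<in> carrier X" unfolding x_def using fc[OF t(1)[OF k]] fc[OF t(2)[OF k]] by simp
      show "AE \<omega> in M. rnorm (x k) \<omega> \<le> 2 * \<eta> \<omega>"
        unfolding x_def
        using rnorm_minus_le[OF fc[OF t(1)[OF k]] fc[OF t(2)[OF k]]] bd[OF t(1)[OF k]] bd[OF t(2)[OF k]]
        by eventually_elim simp
    qed
    have 4: "\<forall>k\<in>p \<times> q. 0 < w k \<longrightarrow> fnorm (x k) \<le> d"
    proof (intro ballI impI)
      fix k assume k: "k \<in> p \<times> q" and pos: "0 < w k"
      \<comment> \<open>Positive overlap makes the two cells meet. Each lies in the ball of radius
        \<open>r / 2\<close> about its tag, so the tags are closer than \<open>r\<close>.\<close>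
      then have "snd (fst k) \<inter> snd (snd k) \<noteq> {}" by (auto simp: w_def)
      then obtain u where u: "u \<in> snd (fst k)" "u \<in> snd (snd k)" by blast
      have kp: "(fst (fst k), snd (fst k)) \<in> p" and kq: "(fst (snd k), snd (snd k)) \<in> q"
        using k by (simp_all add: mem_Times_iff)
      have "snd (fst k) \<subseteq> ball (fst (fst k)) (r / 2)" "snd (snd k) \<subseteq> ball (fst (snd k)) (r / 2)"
        using fineD[OF conjunct2[OF p] kp] fineD[OF conjunct2[OF q] kq] .
      with u have "u \<in> ball (fst (fst k)) (r / 2)" "u \<in> ball (fst (snd k)) (r / 2)" by blast+
      then have "\<bar>fst (fst k) - fst (snd k)\<bar> < r" unfolding mem_ball dist_real_def by linarith
      from r(2)[OF t(2)[OF k] t(1)[OF k] this] show "fnorm (x k) \<le> d" by (simp add: x_def)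
    qed
    show "fnorm (rsum f p \<ominus>\<^bsub>X\<^esub> rsum f q) \<le> e"
      unfolding diff by (rule le[THEN spec, THEN spec, THEN spec, THEN mp, THEN mp, THEN mp, THEN mp, OF 1 2 3 4])
  qed
qed

text \<open>Connects the metric with \<open>RN_has_integral\<close>, which is phrased with the
  neighbourhoods of 0.\<close>

lemma rlim_nhd_iff:
  "rlim f l F \<longleftrightarrow> l \<in> carrier X \<and> (\<forall>\<^sub>F i in F. f i \<in> carrier X) \<and>
    (\<forall>\<epsilon>>0. \<forall>\<kappa>. 0 < \<kappa> \<and> \<kappa> < 1 \<longrightarrow> (\<forall>\<^sub>F i in F. f i \<ominus>\<^bsub>X\<^esub> l \<in> eps_lambda_nhd M X nrm \<epsilon> \<kappa>))"
  (is "_ \<longleftrightarrow> ?R")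
proof
  assume *: "rlim f l F"
  have "\<forall>\<^sub>F i in F. f i \<ominus>\<^bsub>X\<^esub> l \<in> eps_lambda_nhd M X nrm \<epsilon> \<kappa>" if "\<epsilon> > 0" "\<kappa> < 1" for \<epsilon> \<kappa>
  proof -
    note l = rlim_closed[OF *]
    have "\<forall>\<^sub>F i in F. fnorm (f i \<ominus>\<^bsub>X\<^esub> l) < min 1 \<epsilon> * (1 - \<kappa>)"
      using * that by (intro order_tendstoD) (auto simp: rlim_iff)
    moreover have "\<forall>\<^sub>F i in F. f i \<in> carrier X" using * by (simp add: rlim_iff)
    ultimately show ?thesis by eventually_elim (use that l in \<open>auto intro: nhdI_fnorm\<close>)
  qed
  then show ?R using * by (auto simp: rlim_iff)
next
  assume *: ?R
  show "rlim f l F"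
    unfolding rlim_iff
  proof (intro conjI tendstoI)
    fix e :: real assume e: "e > 0"
    define \<epsilon> where "\<epsilon> = min (e / 2) (1 / 2)"
    have \<epsilon>: "\<epsilon> > 0" "\<epsilon> < 1" "\<epsilon> + (1 - (1 - \<epsilon>)) \<le> e" using e by (auto simp: \<epsilon>_def)
    then have "\<forall>\<^sub>F i in F. f i \<ominus>\<^bsub>X\<^esub> l \<in> eps_lambda_nhd M X nrm \<epsilon> (1 - \<epsilon>)" using * by simp
    then show "\<forall>\<^sub>F i in F. dist (fnorm (f i \<ominus>\<^bsub>X\<^esub> l)) 0 < e"
    proof eventually_elim
      case (elim i)
      then have "f i \<ominus>\<^bsub>X\<^esub> l \<in> carrier X" by (simp add: nhd_iff)
      then show ?case using fnorm_le_nhd[OF elim \<epsilon>(1)] \<epsilon> by simp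
    qed
  qed (use * in auto)
qed

lemma has_integral_iff:
  assumes "f \<in> {a..b} \<rightarrow> carrier X"
  shows "RN_has_integral M X nrm a b f I \<longleftrightarrow> rlim (rsum f) I (riemann_filter a b)"
proof -
  have "\<forall>\<^sub>F p in riemann_filter a b. rsum f p \<in> carrier X"
    using eventually_riemann_filter_tagged[of a b] by eventually_elim (rule rsum_closed[OF _ assms])
  then show ?thesis
    unfolding RN_has_integral_def rlim_nhd_iff
      eventually_riemann_filter[of "\<lambda>p. rsum f p \<ominus>\<^bsub>X\<^esub> I \<in> eps_lambda_nhd M X nrm _ _"] by auto
qed

lemma integral_eq:
  assumes "f \<in> {a..b} \<rightarrow> carrier X" "RN_has_integral M X nrm a b f I"
  shows "RN_integral M X nrm a b f = I"
  unfolding RN_integral_def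
  using assms by (intro the_equality)
    (auto simp: has_integral_iff intro: RD.limitin_metric_unique[OF _ _ riemann_filter_neq_bot])

text \<open>Completeness speaks of sequences, Riemann sums converge along a filter. A sequence
  picked from the small sets of the filter is Cauchy, and the whole filter stays close to
  it.\<close>

lemma rlim_exists:
  assumes compl: "RN_complete M X nrm" and F: "F \<noteq> bot" and c: "\<forall>\<^sub>F i in F. f i \<in> carrier X"
    and Cauchy: "\<And>e::real. e > 0 \<Longrightarrow> \<exists>P. eventually P F \<and> (\<forall>i j. P i \<longrightarrow> P j \<longrightarrow> fnorm (f i \<ominus>\<^bsub>X\<^esub> f j) \<le> e)"
  shows "\<exists>l. rlim f l F"
proof -
  have "\<forall>n. \<exists>P. eventually P F \<and> (\<forall>i j. P i \<longrightarrow> P j \<longrightarrow> fnorm (f i \<ominus>\<^bsub>X\<^esub> f j) \<le> 1 / real (Suc n))"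
    using Cauchy by simp
  from choice[OF this] obtain P where P: "\<And>n. eventually (P n) F"
    "\<And>n i j. P n i \<Longrightarrow> P n j \<Longrightarrow> fnorm (f i \<ominus>\<^bsub>X\<^esub> f j) \<le> 1 / real (Suc n)" by blast
  \<comment> \<open>The sets \<open>P n\<close> need not decrease, so the n-th index is taken in all
    of \<open>P 0\<close>, ..., \<open>P n\<close>.\<close>
  have "\<forall>n. \<exists>i. (\<forall>k\<in>{..n}. P k i) \<and> f i \<in> carrier X"
  proof
    fix n
    have "eventually (\<lambda>i. (\<forall>k\<in>{..n}. P k i) \<and> f i \<in> carrier X) F"
      using c P(1) by (intro eventually_conj eventually_ball_finite) auto
    then show "\<exists>i. (\<forall>k\<in>{..n}. P k i) \<and> f i \<in> carrier X" using F eventually_happens' by blast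
  qed
  from choice[OF this] obtain i where i: "\<And>n k. k \<le> n \<Longrightarrow> P k (i n)" "\<And>n. f (i n) \<in> carrier X" by auto
  have "\<exists>N. \<forall>m\<ge>N. \<forall>n\<ge>N. f (i m) \<ominus>\<^bsub>X\<^esub> f (i n) \<in> eps_lambda_nhd M X nrm \<epsilon> \<kappa>"
    if "\<epsilon> > 0" "\<kappa> < 1" for \<epsilon> \<kappa>
  proof -
    have "min 1 \<epsilon> * (1 - \<kappa>) > 0" using that by simp
    then obtain N where N: "1 / real (Suc N) < min 1 \<epsilon> * (1 - \<kappa>)" by (meson nat_approx_posE)
    have "f (i m) \<ominus>\<^bsub>X\<^esub> f (i n) \<in> eps_lambda_nhd M X nrm \<epsilon> \<kappa>" if "m \<ge> N" "n \<ge> N" for m n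
      using P(2)[OF i(1)[OF that(1)] i(1)[OF that(2)]] N \<open>\<epsilon> > 0\<close> \<open>\<kappa> < 1\<close> i(2)
      by (intro nhdI_fnorm) auto
    then show ?thesis by blast
  qed
  then have "\<forall>\<epsilon>>0. \<forall>\<kappa>. 0 < \<kappa> \<and> \<kappa> < 1 \<longrightarrow>
    (\<exists>N. \<forall>m\<ge>N. \<forall>n\<ge>N. f (i m) \<ominus>\<^bsub>X\<^esub> f (i n) \<in> eps_lambda_nhd M X nrm \<epsilon> \<kappa>)" by simp
  moreover have "range (\<lambda>n. f (i n)) \<subseteq> carrier X" using i(2) by auto
  ultimately have "\<exists>l. rlim (\<lambda>n. f (i n)) l sequentially"
    using compl[unfolded RN_complete_def topology_eq, THEN spec[where x = "\<lambda>n. f (i n)"]] by simp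
  then obtain l where l: "rlim (\<lambda>n. f (i n)) l sequentially" ..
  have lc: "l \<in> carrier X" using l by (rule rlim_closed)
  have "((\<lambda>j. fnorm (f j \<ominus>\<^bsub>X\<^esub> l)) \<longlongrightarrow> 0) F"
  proof (rule tendstoI)
    fix e :: real assume "e > 0"
    then obtain N where N: "1 / real (Suc N) < e / 2" by (meson half_gt_zero nat_approx_posE)
    have "\<forall>\<^sub>F n in sequentially. fnorm (f (i n) \<ominus>\<^bsub>X\<^esub> l) < e / 2"
      using l \<open>e > 0\<close> by (intro order_tendstoD) (auto simp: rlim_iff)
    then obtain n where n: "n \<ge> N" "fnorm (f (i n) \<ominus>\<^bsub>X\<^esub> l) < e / 2"
      by (auto simp: eventually_sequentially) (meson nat_le_linear)
    show "\<forall>\<^sub>F j in F. dist (fnorm (f j \<ominus>\<^bsub>X\<^esub> l)) 0 < e"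
      using P(1)[of N] c
    proof eventually_elim
      case (elim j)
      have "fnorm (f j \<ominus>\<^bsub>X\<^esub> l) \<le> fnorm (f j \<ominus>\<^bsub>X\<^esub> f (i n)) + fnorm (f (i n) \<ominus>\<^bsub>X\<^esub> l)"
        using RD.triangle[OF elim(2) i(2)[of n] lc] elim(2) i(2) lc by (simp add: rdist_eq)
      moreover have "fnorm (f j \<ominus>\<^bsub>X\<^esub> f (i n)) \<le> 1 / real (Suc N)"
        using P(2)[OF elim(1) i(1)[OF n(1)]] .
      ultimately show ?case using n(2) N elim(2) lc by simp
    qed
  qed
  then show ?thesis using lc c by (auto simp: rlim_iff)
qed

lemma integrable_rcont:
  fixes \<eta> :: "'a \<Rightarrow> real"
  assumes compl: "RN_complete M X nrm" and f: "rcont {a..b} f" and \<eta>: "\<eta> \<in> borel_measurable M"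
    and bd: "\<And>t. t \<in> {a..b} \<Longrightarrow> AE \<omega> in M. rnorm (f t) \<omega> \<le> \<eta> \<omega>"
    and ab: "a \<le> b"
  shows "rlim (rsum f) (RN_integral M X nrm a b f) (riemann_filter a b)"
proof -
  have fc: "f \<in> {a..b} \<rightarrow> carrier X" by (rule rcont_closed[OF f])
  have "\<exists>I. rlim (rsum f) I (riemann_filter a b)"
  proof (rule rlim_exists[OF compl riemann_filter_neq_bot])
    show "\<forall>\<^sub>F p in riemann_filter a b. rsum f p \<in> carrier X"
      using eventually_riemann_filter_tagged[of a b] by eventually_elim (rule rsum_closed[OF _ fc])
    fix e :: real assume "e > 0"
    from rsum_Cauchy[OF f \<eta> bd ab this] obtain \<delta> where "\<delta> > 0"
      "\<forall>p q. p tagged_division_of {a..b} \<and> (\<lambda>t. ball t \<delta>) fine p \<longrightarrow>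
        q tagged_division_of {a..b} \<and> (\<lambda>t. ball t \<delta>) fine q \<longrightarrow> fnorm (rsum f p \<ominus>\<^bsub>X\<^esub> rsum f q) \<le> e"
      by blast
    then show "\<exists>P. eventually P (riemann_filter a b) \<and>
        (\<forall>p q. P p \<longrightarrow> P q \<longrightarrow> fnorm (rsum f p \<ominus>\<^bsub>X\<^esub> rsum f q) \<le> e)"
      by (intro exI[of _ "\<lambda>p. p tagged_division_of {a..b} \<and> (\<lambda>t. ball t \<delta>) fine p"])
        (auto simp: eventually_riemann_filter)
  qed
  then obtain I where "rlim (rsum f) I (riemann_filter a b)" by blast
  then show ?thesis using integral_eq[OF fc, of I] fc by (simp add: has_integral_iff)
qed

end

section \<open>Translation and concatenation of divisions\<close>

definition shift_division :: "real \<Rightarrow> (real \<times> real set) set \<Rightarrow> (real \<times> real set) set" where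
  "shift_division h p = (\<lambda>i. (h + fst i, (+) h ` snd i)) ` p"

lemma mem_shift_divisionE:
  assumes "(x, K) \<in> shift_division h p"
  obtains y L where "(y, L) \<in> p" "x = h + y" "K = (+) h ` L"
proof -
  obtain i where "i \<in> p" "(x, K) = (h + fst i, (+) h ` snd i)"
    using assms unfolding shift_division_def by blast
  then show ?thesis by (intro that[of "fst i" "snd i"]) simp_all
qed

text \<open>A gauge of constant radius is translation invariant. In this form the substitution
  \<open>t = h + u\<close> in an integral is a composition of limits.\<close>

lemma filterlim_shift_division:
  "filterlim (shift_division h) (riemann_filter (a + h) (b + h)) (riemann_filter a b)"
  unfolding filterlim_iff
proof (intro allI impI)
  fix P assume "eventually P (riemann_filter (a + h) (b + h))"
  then obtain d where d: "d > 0"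
    "\<And>p. p tagged_division_of {a + h..b + h} \<Longrightarrow> (\<lambda>t. ball t d) fine p \<Longrightarrow> P p"
    unfolding eventually_riemann_filter by blast
  have "P (shift_division h p)" if p: "p tagged_division_of {a..b}" and fine: "(\<lambda>t. ball t d) fine p" for p
  proof (rule d(2))
    show "shift_division h p tagged_division_of {a + h..b + h}"
    proof (rule tagged_division_ofI)
      show "finite (shift_division h p)" using p by (auto simp: shift_division_def)
      fix x K assume "(x, K) \<in> shift_division h p"
      then obtain y L where y: "(y, L) \<in> p" "x = h + y" "K = (+) h ` L"
        by (rule mem_shift_divisionE)
      obtain c e where L: "L = cbox c e" using tagged_division_ofD(4)[OF p y(1)] by blast
      show "x \<in> K" using tagged_division_ofD(2)[OF p y(1)] y by auto
      show "K \<subseteq> {a + h..b + h}" using tagged_division_ofD(3)[OF p y(1)] y by auto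
      have "K = cbox (c + h) (e + h)" by (simp add: y L add.commute)
      then show "\<exists>a b. K = cbox a b" by blast
      fix x' K' assume m': "(x', K') \<in> shift_division h p" and ne: "(x, K) \<noteq> (x', K')"
      from m' obtain y' L' where y': "(y', L') \<in> p" "x' = h + y'" "K' = (+) h ` L'"
        by (rule mem_shift_divisionE)
      have "(y, L) \<noteq> (y', L')" using ne y y' by auto
      then have "interior L \<inter> interior L' = {}" by (rule tagged_division_ofD(5)[OF p y(1) y'(1)])
      then show "interior K \<inter> interior K' = {}"
        unfolding y(3) y'(3) interior_translation by (subst image_Int[symmetric]) auto
    next
      have "\<Union>{K. \<exists>x. (x, K) \<in> shift_division h p} = (+) h ` \<Union>{L. \<exists>y. (y, L) \<in> p}"
      proof (intro equalityI subsetI)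
        fix z assume "z \<in> \<Union>{K. \<exists>x. (x, K) \<in> shift_division h p}"
        then obtain x K where "(x, K) \<in> shift_division h p" "z \<in> K" by blast
        then show "z \<in> (+) h ` \<Union>{L. \<exists>y. (y, L) \<in> p}" by (auto elim!: mem_shift_divisionE)
      next
        fix z assume "z \<in> (+) h ` \<Union>{L. \<exists>y. (y, L) \<in> p}"
        then obtain y L where L: "(y, L) \<in> p" "z \<in> (+) h ` L" by blast
        then have "(h + y, (+) h ` L) \<in> shift_division h p"
          unfolding shift_division_def by (intro image_eqI[of _ _ "(y, L)"]) simp_all
        then show "z \<in> \<Union>{K. \<exists>x. (x, K) \<in> shift_division h p}" using L(2) by blast
      qed
      then show "\<Union>{K. \<exists>x. (x, K) \<in> shift_division h p} = {a + h..b + h}"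
        using tagged_division_ofD(6)[OF p] by (simp add: add.commute)
    qed
    show "(\<lambda>t. ball t d) fine shift_division h p"
    proof (rule fineI)
      fix x K assume "(x, K) \<in> shift_division h p"
      then obtain y L where y: "(y, L) \<in> p" "x = h + y" "K = (+) h ` L"
        by (rule mem_shift_divisionE)
      then show "K \<subseteq> ball x d" using fineD[OF fine y(1)] by (auto simp: dist_real_def)
    qed
  qed
  then show "\<forall>\<^sub>F p in riemann_filter a b. P (shift_division h p)"
    unfolding eventually_riemann_filter using d(1) by blast
qed

text \<open>Glued divisions are only those of \<open>{a..c}\<close> that split at \<open>b\<close>.
  This suffices when the limit over \<open>{a..c}\<close> is already known to exist, for it can then
  be evaluated along them.\<close>

lemma filterlim_Un_division:
  assumes "a \<le> b" "b \<le> c"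
  shows "filterlim (\<lambda>(p, q). p \<union> q) (riemann_filter a c) (riemann_filter a b \<times>\<^sub>F riemann_filter b c)"
  unfolding filterlim_iff
proof (intro allI impI)
  fix P assume "eventually P (riemann_filter a c)"
  then obtain d where d: "d > 0"
    "\<And>p. p tagged_division_of {a..c} \<Longrightarrow> (\<lambda>t. ball t d) fine p \<Longrightarrow> P p"
    unfolding eventually_riemann_filter by blast
  define Q where "Q u v p \<longleftrightarrow> p tagged_division_of {u..v} \<and> (\<lambda>t. ball t d) fine p" for u v :: real and p
  have ev: "eventually (Q u v) (riemann_filter u v)" for u v
    unfolding eventually_riemann_filter Q_def using d(1) by blast
  have "P (p \<union> q)" if "Q a b p" "Q b c q" for p q
  proof (rule d(2))
    have "(p \<union> q) tagged_division_of ({a..b} \<union> {b..c})"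
      using that by (intro tagged_division_Un) (auto simp: Q_def)
    then show "(p \<union> q) tagged_division_of {a..c}" using assms by (simp add: ivl_disj_un)
    show "(\<lambda>t. ball t d) fine (p \<union> q)" using that by (auto simp: Q_def intro: fine_Un)
  qed
  then show "\<forall>\<^sub>F x in riemann_filter a b \<times>\<^sub>F riemann_filter b c. P (case x of (p, q) \<Rightarrow> p \<union> q)"
    unfolding eventually_prod_filter using ev[of a b] ev[of b c]
    by (intro exI[of _ "Q a b"] exI[of _ "Q b c"]) simp
qed

section \<open>Rules for limits of Riemann sums\<close>

context RN_module
begin

lemma minus_minus_cancel:
  assumes "x \<in> carrier X" "y \<in> carrier X"
  shows "x \<ominus>\<^bsub>X\<^esub> (x \<ominus>\<^bsub>X\<^esub> y) = y"
proof -
  have "x \<ominus>\<^bsub>X\<^esub> (x \<ominus>\<^bsub>X\<^esub> y) = x \<oplus>\<^bsub>X\<^esub> (y \<ominus>\<^bsub>X\<^esub> x)"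
    using assms by (simp only: RN.M.minus_eq[of x "x \<ominus>\<^bsub>X\<^esub> y"] uminus_minus)
  also have "\<dots> = (y \<ominus>\<^bsub>X\<^esub> x) \<oplus>\<^bsub>X\<^esub> x" using assms by (intro RN.M.a_comm) auto
  finally show ?thesis using assms by (simp add: minus_add_id)
qed

lemma rlim_compose: "rlim f l F \<Longrightarrow> filterlim g F G \<Longrightarrow> rlim (\<lambda>i. f (g i)) l G"
  unfolding limitin_def filterlim_iff by blast

lemma rlim_unique: "rlim f l F \<Longrightarrow> rlim f l' F \<Longrightarrow> F \<noteq> bot \<Longrightarrow> l = l'"
  by (rule RD.limitin_metric_unique)

lemma fnorm_limit_le:
  assumes f: "rlim f l F" and F: "F \<noteq> bot" and le: "\<forall>\<^sub>F i in F. fnorm (f i) \<le> e"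
  shows "fnorm l \<le> e"
proof -
  have l: "l \<in> carrier X" and c: "\<forall>\<^sub>F i in F. f i \<in> carrier X" using f by (auto simp: rlim_iff)
  have "((\<lambda>i. e + fnorm (f i \<ominus>\<^bsub>X\<^esub> l)) \<longlongrightarrow> e + 0) F"
    using f by (intro tendsto_intros) (simp add: rlim_iff)
  moreover have "\<forall>\<^sub>F i in F. fnorm l \<le> e + fnorm (f i \<ominus>\<^bsub>X\<^esub> l)"
    using c le
  proof eventually_elim
    case (elim i)
    have "l = f i \<ominus>\<^bsub>X\<^esub> (f i \<ominus>\<^bsub>X\<^esub> l)"
      using elim l by (simp add: minus_minus_cancel)
    then have "fnorm l \<le> fnorm (f i) + fnorm (\<ominus>\<^bsub>X\<^esub> (f i \<ominus>\<^bsub>X\<^esub> l))"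
      using fnorm_add[of "f i" "\<ominus>\<^bsub>X\<^esub> (f i \<ominus>\<^bsub>X\<^esub> l)"] elim l by (simp add: RN.M.minus_eq)
    then show ?case using elim l by (simp add: fnorm_uminus)
  qed
  ultimately have "fnorm l \<le> e + 0" by (rule tendsto_lowerbound[OF _ _ F])
  then show ?thesis by simp
qed

text \<open>The a.s. order is closed under convergence in probability. Instead of an a.s. convergent
  subsequence, the positive part \<open>h\<close> of \<open>rnorm l - \<zeta>\<close> is used: it is
  dominated by \<open>rnorm (f i - l)\<close>, so its truncated expectation is 0.\<close>

lemma rnorm_limit_le:
  fixes \<zeta> :: "'a \<Rightarrow> real"
  assumes f: "rlim f l F" and F: "F \<noteq> bot" and [measurable]: "\<zeta> \<in> borel_measurable M"
    and le: "\<forall>\<^sub>F i in F. AE \<omega> in M. rnorm (f i) \<omega> \<le> \<zeta> \<omega>"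
  shows "AE \<omega> in M. rnorm l \<omega> \<le> \<zeta> \<omega>"
proof -
  have l: "l \<in> carrier X" and c: "\<forall>\<^sub>F i in F. f i \<in> carrier X" using f by (auto simp: rlim_iff)
  note [measurable] = rnorm_measurable[OF l]
  define h where "h \<omega> = max 0 (rnorm l \<omega> - \<zeta> \<omega>)" for \<omega>
  have [measurable]: "h \<in> borel_measurable M" unfolding h_def by measurable
  have int: "integrable M (\<lambda>\<omega>. min 1 (h \<omega>))" by (rule integrable_min_1) (simp_all add: h_def)
  have "\<forall>\<^sub>F i in F. expectation (\<lambda>\<omega>. min 1 (h \<omega>)) \<le> fnorm (f i \<ominus>\<^bsub>X\<^esub> l)"
    using c le
  proof eventually_elim
    case (elim i)
    have d: "f i \<ominus>\<^bsub>X\<^esub> l \<in> carrier X" using elim l by simp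
    have "AE \<omega> in M. rnorm l \<omega> \<le> rnorm (f i) \<omega> + rnorm (f i \<ominus>\<^bsub>X\<^esub> l) \<omega>"
    proof -
      have "l = f i \<ominus>\<^bsub>X\<^esub> (f i \<ominus>\<^bsub>X\<^esub> l)"
        using elim l by (simp add: minus_minus_cancel)
      then show ?thesis using rnorm_minus_le[OF elim(1) d] by simp
    qed
    with elim(2) rnorm_nonneg[OF d] have "AE \<omega> in M. min 1 (h \<omega>) \<le> min 1 (rnorm (f i \<ominus>\<^bsub>X\<^esub> l) \<omega>)"
      by eventually_elim (auto simp: h_def)
    then show ?case
      unfolding fnorm_def by (intro integral_mono_AE int integrable_min_1_rnorm d)
  qed
  moreover have "((\<lambda>i. fnorm (f i \<ominus>\<^bsub>X\<^esub> l)) \<longlongrightarrow> 0) F" using f by (simp add: rlim_iff)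
  ultimately have "expectation (\<lambda>\<omega>. min 1 (h \<omega>)) \<le> 0" using tendsto_lowerbound[OF _ _ F] by blast
  moreover have "0 \<le> expectation (\<lambda>\<omega>. min 1 (h \<omega>))" by (intro integral_nonneg_AE) (simp add: h_def)
  ultimately have "expectation (\<lambda>\<omega>. min 1 (h \<omega>)) = 0" by simp
  then have "AE \<omega> in M. min 1 (h \<omega>) = 0"
    using int by (subst (asm) integral_nonneg_eq_0_iff_AE) (auto simp: h_def)
  then show ?thesis by eventually_elim (auto simp: h_def min_def max_def split: if_splits)
qed

lemma rsum_term_closed:
  fixes a b :: real
  assumes "p tagged_division_of {a..b}" "f \<in> {a..b} \<rightarrow> carrier X" "i \<in> p"
  shows "f (fst i) \<in> carrier X"
  using assms(2) tagged_division_tag[OF assms(1,3)] by (rule funcset_mem)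

lemma rsum_cong:
  assumes "p tagged_division_of {a..b}" "g \<in> {a..b} \<rightarrow> carrier X" "\<And>t. t \<in> {a..b} \<Longrightarrow> f t = g t"
  shows "rsum f p = rsum g p"
  unfolding RN_riemann_sum_def
proof (intro RN.M.finsum_cong' refl Pi_I scaleK_closed)
  fix i assume i: "i \<in> p"
  show "g (fst i) \<in> carrier X" by (rule rsum_term_closed[OF assms(1,2) i])
  show "rscale (measure lborel (snd i)) (f (fst i)) = rscale (measure lborel (snd i)) (g (fst i))"
    using assms(3)[OF tagged_division_tag[OF assms(1) i]] by simp
qed

lemma rsum_add:
  assumes "p tagged_division_of {a..b}" "f \<in> {a..b} \<rightarrow> carrier X" "g \<in> {a..b} \<rightarrow> carrier X"
  shows "rsum (\<lambda>t. f t \<oplus>\<^bsub>X\<^esub> g t) p = rsum f p \<oplus>\<^bsub>X\<^esub> rsum g p"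
proof -
  note c = rsum_term_closed[OF assms(1,2)] rsum_term_closed[OF assms(1,3)]
  have "rsum (\<lambda>t. f t \<oplus>\<^bsub>X\<^esub> g t) p = (\<Oplus>\<^bsub>X\<^esub>i\<in>p. rscale (measure lborel (snd i)) (f (fst i))
      \<oplus>\<^bsub>X\<^esub> rscale (measure lborel (snd i)) (g (fst i)))"
    unfolding RN_riemann_sum_def
    by (intro RN.M.finsum_cong' refl Pi_I scaleK_add_right RN.M.a_closed scaleK_closed c)
  also have "\<dots> = rsum f p \<oplus>\<^bsub>X\<^esub> rsum g p"
    unfolding RN_riemann_sum_def by (intro RN.M.finsum_addf Pi_I scaleK_closed c)
  finally show ?thesis .
qed

lemma op_rsum:
  assumes "T \<in> BX" "p tagged_division_of {a..b}" "f \<in> {a..b} \<rightarrow> carrier X"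
  shows "T (rsum f p) = rsum (\<lambda>t. T (f t)) p"
proof -
  note c = rsum_term_closed[OF assms(2,3)]
  have "T (rsum f p) = (\<Oplus>\<^bsub>X\<^esub>i\<in>p. T (rscale (measure lborel (snd i)) (f (fst i))))"
    unfolding RN_riemann_sum_def using assms(2)
    by (intro op_finsum assms(1) Pi_I scaleK_closed c) auto
  also have "\<dots> = rsum (\<lambda>t. T (f t)) p"
    unfolding RN_riemann_sum_def
  proof (intro RN.M.finsum_cong' refl Pi_I)
    fix i assume i: "i \<in> p"
    show "T (rscale (measure lborel (snd i)) (f (fst i))) = rscale (measure lborel (snd i)) (T (f (fst i)))"
      by (rule op_scaleK[OF assms(1) c[OF i]])
    show "rscale (measure lborel (snd i)) (T (f (fst i))) \<in> carrier X"
      by (rule scaleK_closed[OF op_closed[OF assms(1) c[OF i]]])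
  qed
  finally show ?thesis .
qed

lemma rsum_shift_division:
  assumes p: "p tagged_division_of {a..b}" and f: "f \<in> {a + h..b + h} \<rightarrow> carrier X"
  shows "rsum f (shift_division h p) = rsum (\<lambda>t. f (h + t)) p"
proof -
  have c: "f (h + fst i) \<in> carrier X" if "i \<in> p" for i
    using tagged_division_tag[OF p that] f by (auto simp: Pi_iff)
  have inj: "inj_on (\<lambda>i. (h + fst i, (+) h ` snd i)) p"
    by (intro inj_onI prod_eqI) (auto simp: inj_image_eq_iff)
  have m: "measure lborel ((+) h ` snd i) = measure lborel (snd i)" if i: "i \<in> p" for i
  proof -
    obtain u v where "snd i = {u..v}" by (rule tagged_division_interval[OF p i])
    then show ?thesis by simp
  qed
  have "rsum f (shift_division h p) = (\<Oplus>\<^bsub>X\<^esub>i\<in>p. rscale (measure lborel ((+) h ` snd i)) (f (h + fst i)))"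
    unfolding RN_riemann_sum_def shift_division_def
  proof (subst RN.M.finsum_reindex[OF _ inj])
    show "(\<lambda>i. rscale (measure lborel (snd i)) (f (fst i))) \<in> (\<lambda>i. (h + fst i, (+) h ` snd i)) ` p \<rightarrow> carrier X"
    proof (rule Pi_I)
      fix j assume "j \<in> (\<lambda>i. (h + fst i, (+) h ` snd i)) ` p"
      then obtain i where i: "i \<in> p" "j = (h + fst i, (+) h ` snd i)" by (rule imageE)
      show "rscale (measure lborel (snd j)) (f (fst j)) \<in> carrier X"
        unfolding i(2) fst_conv by (intro scaleK_closed c i(1))
    qed
  qed simp
  also have "\<dots> = rsum (\<lambda>t. f (h + t)) p"
    unfolding RN_riemann_sum_def
    by (intro RN.M.finsum_cong' refl Pi_I scaleK_closed c) (simp_all add: m)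
  finally show ?thesis .
qed

lemma rsum_Un:
  assumes p: "p tagged_division_of {a..b}" and q: "q tagged_division_of {b..c}"
    and f: "f \<in> {a..c} \<rightarrow> carrier X" and abc: "a \<le> b" "b \<le> c"
  shows "rsum f (p \<union> q) = rsum f p \<oplus>\<^bsub>X\<^esub> rsum f q"
proof -
  have f': "f \<in> {a..b} \<rightarrow> carrier X" "f \<in> {b..c} \<rightarrow> carrier X" using f abc by (auto simp: Pi_iff)
  note cl = rsum_term_closed[OF p f'(1)] rsum_term_closed[OF q f'(2)]
  \<comment> \<open>A tagged cell may belong to both divisions, but it then lies in
    \<open>{b}\<close> and has length 0, so counting it once or twice makes no difference.\<close>
  have "rscale (measure lborel (snd i)) (f (fst i)) = \<zero>\<^bsub>X\<^esub>" if i: "i \<in> p \<inter> q" for i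
  proof -
    obtain u v where uv: "snd i = {u..v}" "{u..v} \<subseteq> {a..b}"
      using tagged_division_interval[OF p] i by blast
    obtain u' v' where uv': "snd i = {u'..v'}" "{u'..v'} \<subseteq> {b..c}"
      using tagged_division_interval[OF q] i by blast
    have "measure lborel {u..v} = 0" using uv uv' by (cases "u \<le> v") auto
    then show ?thesis using cl(1)[of i] i uv by simp
  qed
  then have "(\<Oplus>\<^bsub>X\<^esub>i\<in>p \<inter> q. rscale (measure lborel (snd i)) (f (fst i))) = \<zero>\<^bsub>X\<^esub>"
    by (rule RN.M.add.finprod_one_eqI)
  moreover have "rsum f (p \<union> q) \<oplus>\<^bsub>X\<^esub> (\<Oplus>\<^bsub>X\<^esub>i\<in>p \<inter> q. rscale (measure lborel (snd i)) (f (fst i)))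
      = rsum f p \<oplus>\<^bsub>X\<^esub> rsum f q"
    unfolding RN_riemann_sum_def using p q
    by (intro RN.M.finsum_Un_Int Pi_I scaleK_closed cl) auto
  moreover have "rsum f (p \<union> q) \<in> carrier X"
    unfolding RN_riemann_sum_def using cl by (intro RN.M.finsum_closed Pi_I scaleK_closed) auto
  ultimately show ?thesis by simp
qed

lemma integral_combine:
  assumes 1: "rlim (rsum f) I (riemann_filter a b)" and 2: "rlim (rsum f) J (riemann_filter b c)"
    and 3: "rlim (rsum f) L (riemann_filter a c)"
    and f: "f \<in> {a..c} \<rightarrow> carrier X" and abc: "a \<le> b" "b \<le> c"
  shows "L = I \<oplus>\<^bsub>X\<^esub> J"
proof -
  let ?F = "riemann_filter a b \<times>\<^sub>F riemann_filter b c"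
  have ne: "?F \<noteq> bot" by (simp add: prod_filter_eq_bot riemann_filter_neq_bot)
  have L: "rlim (\<lambda>x. rsum f (case x of (p, q) \<Rightarrow> p \<union> q)) L ?F"
    by (rule rlim_compose[OF 3 filterlim_Un_division[OF abc]])
  have IJ: "rlim (\<lambda>x. rsum f (fst x) \<oplus>\<^bsub>X\<^esub> rsum f (snd x)) (I \<oplus>\<^bsub>X\<^esub> J) ?F"
    by (intro rlim_add rlim_compose[OF 1 filterlim_fst] rlim_compose[OF 2 filterlim_snd])
  have "\<forall>\<^sub>F x in ?F. rsum f (fst x) \<oplus>\<^bsub>X\<^esub> rsum f (snd x) = rsum f (case x of (p, q) \<Rightarrow> p \<union> q)"
    unfolding eventually_prod_filter
    using eventually_riemann_filter_tagged[of a b] eventually_riemann_filter_tagged[of b c]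
    by (intro exI[of _ "\<lambda>p. p tagged_division_of {a..b}"] exI[of _ "\<lambda>p. p tagged_division_of {b..c}"])
      (auto simp: rsum_Un[OF _ _ f abc])
  from rlim_unique[OF L rlim_cong[OF this IJ] ne] show ?thesis .
qed

text \<open>The average minus \<open>f s\<close> is a limit of combinations of
  \<open>f t - f s\<close> with total weight 1. The point \<open>s\<close> may lie anywhere in
  \<open>{u..v}\<close>, so derivatives from the left and from the right are both covered.\<close>

lemma integral_mean_value:
  fixes \<eta> :: "'a \<Rightarrow> real"
  assumes compl: "RN_complete M X nrm" and f: "rcont {a..b} f" and \<eta>: "\<eta> \<in> borel_measurable M"
    and bd: "\<And>t. t \<in> {a..b} \<Longrightarrow> AE \<omega> in M. rnorm (f t) \<omega> \<le> \<eta> \<omega>"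
    and s: "s \<in> {a..b}" and e: "e > 0"
  shows "\<exists>d>0. \<forall>u v. a \<le> u \<and> u \<le> s \<and> s \<le> v \<and> v \<le> b \<and> u < v \<and> v - u < d \<longrightarrow>
    fnorm (rscale (1 / (v - u)) (RN_integral M X nrm u v f) \<ominus>\<^bsub>X\<^esub> f s) \<le> e"
proof -
  have fc: "f t \<in> carrier X" if "t \<in> {a..b}" for t using rcont_closed[OF f] that by blast
  have "(\<lambda>\<omega>. 2 * \<eta> \<omega>) \<in> borel_measurable M" using \<eta> by simp
  then have "\<exists>d>0. \<forall>(S :: (real \<times> real set) set) w x. finite S \<longrightarrow> sum w S = 1 \<longrightarrow>
    (\<forall>i\<in>S. 0 \<le> w i \<and> x i \<in> carrier X \<and> (AE \<omega> in M. rnorm (x i) \<omega> \<le> 2 * \<eta> \<omega>)) \<longrightarrow>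
    (\<forall>i\<in>S. 0 < w i \<longrightarrow> fnorm (x i) \<le> d) \<longrightarrow> fnorm (\<Oplus>\<^bsub>X\<^esub>i\<in>S. rscale (w i) (x i)) \<le> e"
    by (rule fnorm_finsum_weights_le[OF _ e zero_le_one])
  then obtain d where d: "d > 0" and le: "\<forall>(S :: (real \<times> real set) set) w x. finite S \<longrightarrow> sum w S = 1 \<longrightarrow>
    (\<forall>i\<in>S. 0 \<le> w i \<and> x i \<in> carrier X \<and> (AE \<omega> in M. rnorm (x i) \<omega> \<le> 2 * \<eta> \<omega>)) \<longrightarrow>
    (\<forall>i\<in>S. 0 < w i \<longrightarrow> fnorm (x i) \<le> d) \<longrightarrow> fnorm (\<Oplus>\<^bsub>X\<^esub>i\<in>S. rscale (w i) (x i)) \<le> e"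
    by (elim exE conjE)
  obtain r where r: "r > 0" "\<forall>t\<in>{a..b}. \<bar>t - s\<bar> < r \<longrightarrow> fnorm (f t \<ominus>\<^bsub>X\<^esub> f s) < d"
    using rcont_dist[OF f s d] by blast
  show ?thesis
  proof (intro exI[of _ r] conjI allI impI r(1))
    fix u v assume uv: "a \<le> u \<and> u \<le> s \<and> s \<le> v \<and> v \<le> b \<and> u < v \<and> v - u < r"
    then have sub: "{u..v} \<subseteq> {a..b}" and L: "v - u > 0" by auto
    have fuv: "f \<in> {u..v} \<rightarrow> carrier X" using fc sub by blast
    \<comment> \<open>No fineness of \<open>p\<close> enters: all tags lie in \<open>{u..v}\<close>,
      hence within \<open>r\<close> of \<open>s\<close>.\<close>
    have bound: "fnorm (rscale (1 / (v - u)) (rsum f p) \<ominus>\<^bsub>X\<^esub> f s) \<le> e" if p: "p tagged_division_of {u..v}" for p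
    proof -
      define w where "w i = measure lborel (snd i) / (v - u)" for i :: "real \<times> real set"
      define x where "x i = f (fst i) \<ominus>\<^bsub>X\<^esub> f s" for i :: "real \<times> real set"
      have t: "fst i \<in> {a..b}" "\<bar>fst i - s\<bar> < r" if "i \<in> p" for i
        using tagged_division_tag[OF p that] uv by auto
      have c: "f (fst i) \<in> carrier X" if "i \<in> p" for i using fc[OF t(1)[OF that]] .
      have 1: "finite p" using p by auto
      have "(\<Sum>i\<in>p. measure lborel (snd i)) = v - u"
        using additive_content_tagged_division[of p u v] p L by (simp add: case_prod_beta)
      then have 2: "sum w p = 1" using L by (simp add: w_def flip: sum_divide_distrib)
      have 3: "\<forall>i\<in>p. 0 \<le> w i \<and> x i \<in> carrier X \<and> (AE \<omega> in M. rnorm (x i) \<omega> \<le> 2 * \<eta> \<omega>)"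
      proof (intro ballI conjI)
        fix i assume i: "i \<in> p"
        show "0 \<le> w i" using L by (simp add: w_def)
        show "x i \<in> carrier X" unfolding x_def using c[OF i] fc[OF s] by simp
        show "AE \<omega> in M. rnorm (x i) \<omega> \<le> 2 * \<eta> \<omega>"
          unfolding x_def using rnorm_minus_le[OF c[OF i] fc[OF s]] bd[OF t(1)[OF i]] bd[OF s]
          by eventually_elim simp
      qed
      have 4: "\<forall>i\<in>p. 0 < w i \<longrightarrow> fnorm (x i) \<le> d"
        unfolding x_def using r(2) t by (meson less_imp_le)
      have "rscale (1 / (v - u)) (rsum f p) = (\<Oplus>\<^bsub>X\<^esub>i\<in>p. rscale (1 / (v - u)) (rscale (measure lborel (snd i)) (f (fst i))))"
        unfolding RN_riemann_sum_def by (intro op_finsum scaleK_op 1 Pi_I scaleK_closed c)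
      also have "\<dots> = (\<Oplus>\<^bsub>X\<^esub>i\<in>p. rscale (w i) (f (fst i)))"
      proof (intro RN.M.finsum_cong' refl Pi_I scaleK_closed c)
        fix i assume "i \<in> p"
        then show "rscale (1 / (v - u)) (rscale (measure lborel (snd i)) (f (fst i))) = rscale (w i) (f (fst i))"
          using c[of i] by (simp add: scaleK_scaleK w_def flip: of_real_mult)
      qed
      finally have A: "rscale (1 / (v - u)) (rsum f p) = (\<Oplus>\<^bsub>X\<^esub>i\<in>p. rscale (w i) (f (fst i)))" .
      \<comment> \<open>The weights sum to 1, so the constant \<open>f s\<close> is a combination
        with the same weights and can be subtracted term by term.\<close>
      have B: "f s = (\<Oplus>\<^bsub>X\<^esub>i\<in>p. rscale (w i) (f s))"
        using rscale_sum[OF 1 fc[OF s], of w] fc[OF s] by (simp add: 2 del: of_real_sum)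
      have "rscale (1 / (v - u)) (rsum f p) \<ominus>\<^bsub>X\<^esub> f s =
          (\<Oplus>\<^bsub>X\<^esub>i\<in>p. rscale (w i) (f (fst i)) \<ominus>\<^bsub>X\<^esub> rscale (w i) (f s))"
        unfolding A by (subst B, intro finsum_minus 1 Pi_I scaleK_closed c fc s)
      also have "\<dots> = (\<Oplus>\<^bsub>X\<^esub>i\<in>p. rscale (w i) (x i))"
        unfolding x_def
        by (intro RN.M.finsum_cong' refl Pi_I scaleK_closed RN.M.minus_closed c fc s scaleK_minus_right[symmetric])
      finally show ?thesis
        by (simp only:) (rule le[THEN spec, THEN spec, THEN spec, THEN mp, THEN mp, THEN mp, THEN mp, OF 1 2 3 4])
    qed
    have "rlim (rsum f) (RN_integral M X nrm u v f) (riemann_filter u v)"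
      using sub uv bd by (intro integrable_rcont[OF compl rcont_subset[OF f sub] \<eta>]) auto
    then have "rlim (\<lambda>p. rscale (1 / (v - u)) (rsum f p) \<ominus>\<^bsub>X\<^esub> f s)
        (rscale (1 / (v - u)) (RN_integral M X nrm u v f) \<ominus>\<^bsub>X\<^esub> f s) (riemann_filter u v)"
      by (intro rlim_minus rlim_scaleK rlim_const fc s)
    then show "fnorm (rscale (1 / (v - u)) (RN_integral M X nrm u v f) \<ominus>\<^bsub>X\<^esub> f s) \<le> e"
    proof (rule fnorm_limit_le[OF _ riemann_filter_neq_bot])
      show "\<forall>\<^sub>F p in riemann_filter u v. fnorm (rscale (1 / (v - u)) (rsum f p) \<ominus>\<^bsub>X\<^esub> f s) \<le> e"
        using eventually_riemann_filter_tagged[of u v] by eventually_elim (rule bound)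
    qed
  qed
qed

end

section \<open>C-semigroups\<close>

locale RN_C_semigroup = RN_module M X nrm
  for M :: "'a measure"
    and X :: "(('a \<Rightarrow> 'k::{real_normed_field, euclidean_space}) set, 'x) Module.module"
    and nrm :: "'x \<Rightarrow> ('a \<Rightarrow> real) set" +
  fixes C :: "'x \<Rightarrow> 'x" and V :: "real \<Rightarrow> 'x \<Rightarrow> 'x"
  assumes complete: "RN_complete M X nrm"
    and semigroup: "C_semigroup M X nrm C V"
    and locally_bounded: "locally_as_bounded M X nrm V"
begin

lemma C_op: "C \<in> BX" and inj_C: "inj_on C (carrier X)"
  and V_op: "0 \<le> s \<Longrightarrow> V s \<in> BX" and V_0: "z \<in> carrier X \<Longrightarrow> V 0 z = C z"
  and C_V_add: "0 \<le> s \<Longrightarrow> 0 \<le> t \<Longrightarrow> z \<in> carrier X \<Longrightarrow> C (V (s + t) z) = V s (V t z)"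
  and V_rcont: "z \<in> carrier X \<Longrightarrow> rcont {0..} (\<lambda>s. V s z)"
  using semigroup unfolding C_semigroup_def rcont_def topology_eq by blast+

lemma V_closed [simp]: "0 \<le> s \<Longrightarrow> z \<in> carrier X \<Longrightarrow> V s z \<in> carrier X"
  by (rule op_closed[OF V_op])

lemma C_closed [simp]: "z \<in> carrier X \<Longrightarrow> C z \<in> carrier X"
  by (rule op_closed[OF C_op])

lemma C_cancel: "C x = C y \<Longrightarrow> x \<in> carrier X \<Longrightarrow> y \<in> carrier X \<Longrightarrow> x = y"
  using inj_C by (rule inj_onD)

text \<open>Both sides are \<open>C (V (s + t) z)\<close>. Since \<open>V 0\<close> is
  \<open>C\<close>, commutation with \<open>C\<close> is a special case.\<close>

lemma V_commute: "0 \<le> s \<Longrightarrow> 0 \<le> t \<Longrightarrow> z \<in> carrier X \<Longrightarrow> V s (V t z) = V t (V s z)"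
  using C_V_add[of s t z] C_V_add[of t s z] by (simp add: add.commute)

lemma V_C_commute: "0 \<le> s \<Longrightarrow> z \<in> carrier X \<Longrightarrow> V s (C z) = C (V s z)"
  using V_commute[of s 0 z] by (simp add: V_0)

lemma V_bound:
  assumes "0 \<le> b"
  obtains \<eta> :: "'a \<Rightarrow> real" where "\<eta> \<in> borel_measurable M" "AE \<omega> in M. 0 \<le> \<eta> \<omega>"
    "\<forall>s\<in>{0..b}. \<forall>z\<in>carrier X. AE \<omega> in M. rnorm (V s z) \<omega> \<le> \<eta> \<omega> * rnorm z \<omega>"
proof (rule locally_boundedE[OF V_op locally_bounded])
  \<comment> \<open>Local boundedness is stated for positive lengths; enlarging \<open>b\<close> by
    1 admits \<open>b = 0\<close>.\<close>
  show "0 < b + 1" using assms by simp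
  fix \<eta> :: "'a \<Rightarrow> real"
  assume "\<eta> \<in> borel_measurable M" "AE \<omega> in M. 0 \<le> \<eta> \<omega>"
    and "\<And>s z. 0 \<le> s \<Longrightarrow> s \<le> b + 1 \<Longrightarrow> z \<in> carrier X \<Longrightarrow> AE \<omega> in M. rnorm (V s z) \<omega> \<le> \<eta> \<omega> * rnorm z \<omega>"
  then show thesis by (intro that[of \<eta>]) auto
qed

section \<open>Integrals of orbits\<close>

definition int_V :: "real \<Rightarrow> real \<Rightarrow> 'x \<Rightarrow> 'x" where
  "int_V a b z = RN_integral M X nrm a b (\<lambda>u. V u z)"

lemma V_orbit: "0 \<le> a \<Longrightarrow> z \<in> carrier X \<Longrightarrow> (\<lambda>u. V u z) \<in> {a..b} \<rightarrow> carrier X"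
  by auto

lemma int_V_lim:
  assumes "0 \<le> a" "a \<le> b" and z: "z \<in> carrier X"
  shows "rlim (rsum (\<lambda>u. V u z)) (int_V a b z) (riemann_filter a b)"
proof -
  have "0 \<le> b" using assms by simp
  then obtain \<eta> :: "'a \<Rightarrow> real" where \<eta>: "\<eta> \<in> borel_measurable M" "AE \<omega> in M. 0 \<le> \<eta> \<omega>"
    "\<forall>s\<in>{0..b}. \<forall>z\<in>carrier X. AE \<omega> in M. rnorm (V s z) \<omega> \<le> \<eta> \<omega> * rnorm z \<omega>"
    by (rule V_bound)
  note [measurable] = \<eta>(1) rnorm_measurable[OF z]
  show ?thesis
    unfolding int_V_def
  proof (rule integrable_rcont[OF complete, where \<eta> = "\<lambda>\<omega>. \<eta> \<omega> * rnorm z \<omega>"])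
    show "rcont {a..b} (\<lambda>u. V u z)" using assms by (intro rcont_subset[OF V_rcont[OF z]]) auto
    show "AE \<omega> in M. rnorm (V t z) \<omega> \<le> \<eta> \<omega> * rnorm z \<omega>" if "t \<in> {a..b}" for t
      using assms that by (intro bspec[OF bspec[OF \<eta>(3)]] z) simp
  qed (simp_all add: assms)
qed

lemma int_V_closed [simp]: "0 \<le> a \<Longrightarrow> a \<le> b \<Longrightarrow> z \<in> carrier X \<Longrightarrow> int_V a b z \<in> carrier X"
  by (rule rlim_closed[OF int_V_lim])

text \<open>The device for algebraic identities of integrals: it is enough to verify them for the
  Riemann sum of each single division.\<close>

lemma int_V_unique:
  assumes "0 \<le> a" "a \<le> b" "z \<in> carrier X" "rlim f l (riemann_filter a b)"
    and eq: "\<And>p. p tagged_division_of {a..b} \<Longrightarrow> f p = rsum (\<lambda>u. V u z) p"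
  shows "l = int_V a b z"
proof (rule rlim_unique[OF assms(4) _ riemann_filter_neq_bot])
  have "\<forall>\<^sub>F p in riemann_filter a b. rsum (\<lambda>u. V u z) p = f p"
    using eventually_riemann_filter_tagged[of a b] by eventually_elim (simp add: eq)
  then show "rlim f (int_V a b z) (riemann_filter a b)"
    by (rule rlim_cong[OF _ int_V_lim[OF assms(1-3)]])
qed

lemma int_V_mean_value:
  assumes z: "z \<in> carrier X" and s: "0 \<le> s" and e: "e > 0"
  shows "\<exists>d>0. \<forall>u v. 0 \<le> u \<and> u \<le> s \<and> s \<le> v \<and> u < v \<and> v - u < d \<longrightarrow>
    fnorm (rscale (1 / (v - u)) (int_V u v z) \<ominus>\<^bsub>X\<^esub> V s z) \<le> e"
proof -
  have "0 \<le> s + 1" using s by simp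
  then obtain \<eta> :: "'a \<Rightarrow> real" where \<eta>: "\<eta> \<in> borel_measurable M" "AE \<omega> in M. 0 \<le> \<eta> \<omega>"
    "\<forall>t\<in>{0..s + 1}. \<forall>z\<in>carrier X. AE \<omega> in M. rnorm (V t z) \<omega> \<le> \<eta> \<omega> * rnorm z \<omega>"
    by (rule V_bound)
  note [measurable] = \<eta>(1) rnorm_measurable[OF z]
  have "\<exists>d>0. \<forall>u v. 0 \<le> u \<and> u \<le> s \<and> s \<le> v \<and> v \<le> s + 1 \<and> u < v \<and> v - u < d \<longrightarrow>
      fnorm (rscale (1 / (v - u)) (int_V u v z) \<ominus>\<^bsub>X\<^esub> V s z) \<le> e"
    unfolding int_V_def
  proof (rule integral_mean_value[OF complete, where \<eta> = "\<lambda>\<omega>. \<eta> \<omega> * rnorm z \<omega>"])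
    show "rcont {0..s + 1} (\<lambda>u. V u z)" by (intro rcont_subset[OF V_rcont[OF z]]) auto
    show "AE \<omega> in M. rnorm (V t z) \<omega> \<le> \<eta> \<omega> * rnorm z \<omega>" if "t \<in> {0..s + 1}" for t
      by (rule bspec[OF bspec[OF \<eta>(3) that] z])
  qed (use s e in auto)
  then obtain d where "d > 0" and d: "\<forall>u v. 0 \<le> u \<and> u \<le> s \<and> s \<le> v \<and> v \<le> s + 1 \<and> u < v \<and> v - u < d \<longrightarrow>
      fnorm (rscale (1 / (v - u)) (int_V u v z) \<ominus>\<^bsub>X\<^esub> V s z) \<le> e" by blast
  show ?thesis
  \<comment> \<open>The estimate is available for \<open>v \<le> s + 1\<close>, which
    \<open>v - u < 1\<close> and \<open>u \<le> s\<close> guarantee.\<close>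
  proof (intro exI[of _ "min d 1"] conjI allI impI)
    fix u v assume "0 \<le> u \<and> u \<le> s \<and> s \<le> v \<and> u < v \<and> v - u < min d 1"
    then show "fnorm (rscale (1 / (v - u)) (int_V u v z) \<ominus>\<^bsub>X\<^esub> V s z) \<le> e"
      using d[rule_format, of u v] by simp
  qed (use \<open>d > 0\<close> in simp)
qed

lemma int_V_derivative:
  assumes z: "z \<in> carrier X" and s: "0 \<le> s"
  shows "rlim (\<lambda>h. rscale (1 / h) (int_V s (s + h) z)) (V s z) (at_right 0)"
  unfolding rlim_iff
proof (intro conjI tendstoI)
  have pos: "\<forall>\<^sub>F h in at_right (0::real). 0 < h" by (rule eventually_at_right_less)
  show "\<forall>\<^sub>F h in at_right 0. rscale (1 / h) (int_V s (s + h) z) \<in> carrier X"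
    using pos by eventually_elim (use s z in simp)
  fix e :: real assume "e > 0"
  then obtain d where "d > 0" and d: "\<forall>u v. 0 \<le> u \<and> u \<le> s \<and> s \<le> v \<and> u < v \<and> v - u < d \<longrightarrow>
    fnorm (rscale (1 / (v - u)) (int_V u v z) \<ominus>\<^bsub>X\<^esub> V s z) \<le> e / 2"
    using int_V_mean_value[OF z s half_gt_zero] by blast
  have "\<forall>\<^sub>F h in at_right (0::real). h < d"
    using \<open>d > 0\<close> eventually_at_right_field by blast
  with pos show "\<forall>\<^sub>F h in at_right 0. dist (fnorm (rscale (1 / h) (int_V s (s + h) z) \<ominus>\<^bsub>X\<^esub> V s z)) 0 < e"
  proof eventually_elim
    case (elim h)
    have "fnorm (rscale (1 / h) (int_V s (s + h) z) \<ominus>\<^bsub>X\<^esub> V s z) \<le> e / 2"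
      using d[rule_format, of s "s + h"] elim s by simp
    then show ?case using \<open>e > 0\<close> elim s z by simp
  qed
qed (use s z in simp)

text \<open>Boundedness makes \<open>z \<mapsto> int_V 0 s z\<close> continuous, so the integral can
  be taken inside the limit that defines the generator.\<close>

lemma int_V_op:
  assumes s: "0 \<le> s"
  shows "int_V 0 s \<in> BX"
proof -
  obtain \<eta> :: "'a \<Rightarrow> real" where \<eta>: "\<eta> \<in> borel_measurable M" "AE \<omega> in M. 0 \<le> \<eta> \<omega>"
    "\<forall>t\<in>{0..s}. \<forall>z\<in>carrier X. AE \<omega> in M. rnorm (V t z) \<omega> \<le> \<eta> \<omega> * rnorm z \<omega>"
    using s by (rule V_bound)
  note [measurable] = \<eta>(1)
  show ?thesis
  proof (rule opI[where \<eta> = "\<lambda>\<omega>. s * \<eta> \<omega>"])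
    show "int_V 0 s x \<in> carrier X" if "x \<in> carrier X" for x using s that by simp
    show "int_V 0 s (x \<oplus>\<^bsub>X\<^esub> y) = int_V 0 s x \<oplus>\<^bsub>X\<^esub> int_V 0 s y" if x: "x \<in> carrier X" and y: "y \<in> carrier X" for x y
    proof (rule int_V_unique[symmetric])
      show "rlim (\<lambda>p. rsum (\<lambda>u. V u x) p \<oplus>\<^bsub>X\<^esub> rsum (\<lambda>u. V u y) p) (int_V 0 s x \<oplus>\<^bsub>X\<^esub> int_V 0 s y) (riemann_filter 0 s)"
        using s x y by (intro rlim_add int_V_lim) auto
      fix p assume p: "p tagged_division_of {0..s}"
      have "rsum (\<lambda>u. V u (x \<oplus>\<^bsub>X\<^esub> y)) p = rsum (\<lambda>u. V u x \<oplus>\<^bsub>X\<^esub> V u y) p"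
        using x y by (intro rsum_cong[OF p]) (auto simp: op_add[OF V_op])
      then show "rsum (\<lambda>u. V u x) p \<oplus>\<^bsub>X\<^esub> rsum (\<lambda>u. V u y) p = rsum (\<lambda>u. V u (x \<oplus>\<^bsub>X\<^esub> y)) p"
        using rsum_add[OF p V_orbit V_orbit] x y by simp
    qed (use s x y in auto)
    show "int_V 0 s (scaleK M X c x) = scaleK M X c (int_V 0 s x)" if x: "x \<in> carrier X" for c x
    proof (rule int_V_unique[symmetric])
      show "rlim (\<lambda>p. scaleK M X c (rsum (\<lambda>u. V u x) p)) (scaleK M X c (int_V 0 s x)) (riemann_filter 0 s)"
        using s x by (intro rlim_scaleK int_V_lim) auto
      fix p assume p: "p tagged_division_of {0..s}"
      have "rsum (\<lambda>u. V u (scaleK M X c x)) p = rsum (\<lambda>u. scaleK M X c (V u x)) p"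
        using x by (intro rsum_cong[OF p]) (auto simp: op_scaleK[OF V_op])
      then show "scaleK M X c (rsum (\<lambda>u. V u x) p) = rsum (\<lambda>u. V u (scaleK M X c x)) p"
        using op_rsum[OF scaleK_op p V_orbit] x by simp
    qed (use s x in auto)
    show "(\<lambda>\<omega>. s * \<eta> \<omega>) \<in> borel_measurable M" by simp
    show "AE \<omega> in M. 0 \<le> s * \<eta> \<omega>" using \<eta>(2) by eventually_elim (use s in simp)
    show "AE \<omega> in M. rnorm (int_V 0 s z) \<omega> \<le> s * \<eta> \<omega> * rnorm z \<omega>" if z: "z \<in> carrier X" for z
    \<comment> \<open>Each Riemann sum obeys the bound, as the lengths of the cells add up to
      \<open>s\<close>, and the bound survives the limit.\<close>
    proof (rule rnorm_limit_le[OF int_V_lim riemann_filter_neq_bot])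
      note [measurable] = rnorm_measurable[OF z]
      show "(\<lambda>\<omega>. s * \<eta> \<omega> * rnorm z \<omega>) \<in> borel_measurable M" by simp
      show "\<forall>\<^sub>F p in riemann_filter 0 s. AE \<omega> in M. rnorm (rsum (\<lambda>u. V u z) p) \<omega> \<le> s * \<eta> \<omega> * rnorm z \<omega>"
        using eventually_riemann_filter_tagged[of 0 s]
      proof eventually_elim
        case p: (elim p)
        have fin: "finite p" using p by auto
        have c: "V (fst i) z \<in> carrier X" if "i \<in> p" for i
          using tagged_division_tag[OF p that] z by simp
        have "AE \<omega> in M. rnorm (rsum (\<lambda>u. V u z) p) \<omega> \<le>
            (\<Sum>i\<in>p. rnorm (rscale (measure lborel (snd i)) (V (fst i) z)) \<omega>)"
          unfolding RN_riemann_sum_def by (intro rnorm_finsum fin Pi_I scaleK_closed c)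
        moreover have "AE \<omega> in M. \<forall>i\<in>p. rnorm (rscale (measure lborel (snd i)) (V (fst i) z)) \<omega> \<le>
            measure lborel (snd i) * (\<eta> \<omega> * rnorm z \<omega>)"
        proof (rule AE_finite_allI[OF fin])
          fix i assume i: "i \<in> p"
          show "AE \<omega> in M. rnorm (rscale (measure lborel (snd i)) (V (fst i) z)) \<omega> \<le>
            measure lborel (snd i) * (\<eta> \<omega> * rnorm z \<omega>)"
            using rnorm_scaleK[OF c[OF i], of "of_real (measure lborel (snd i))"]
              bspec[OF bspec[OF \<eta>(3) tagged_division_tag[OF p i]] z]
            by eventually_elim (simp add: mult_left_mono)
        qed
        ultimately show ?case
        proof eventually_elim
          case (elim \<omega>)
          have "rnorm (rsum (\<lambda>u. V u z) p) \<omega> \<le> (\<Sum>i\<in>p. measure lborel (snd i) * (\<eta> \<omega> * rnorm z \<omega>))"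
            using elim by (intro order_trans[OF elim(1)] sum_mono) auto
          also have "\<dots> = s * (\<eta> \<omega> * rnorm z \<omega>)"
            using additive_content_tagged_division[of p 0 s] p s
            by (simp add: case_prod_beta flip: sum_distrib_right)
          finally show ?case by (simp add: mult.assoc)
        qed
      qed
    qed (use s z in auto)
  qed
qed

lemma int_V_combine:
  assumes "0 \<le> a" "a \<le> b" "z \<in> carrier X"
  shows "int_V 0 b z = int_V 0 a z \<oplus>\<^bsub>X\<^esub> int_V a b z"
  using assms by (intro integral_combine[OF int_V_lim int_V_lim int_V_lim V_orbit]) auto

lemma int_V_diff:
  assumes "0 \<le> a" "a \<le> b" "z \<in> carrier X"
  shows "int_V 0 b z \<ominus>\<^bsub>X\<^esub> int_V 0 a z = int_V a b z"
  using assms by (simp add: int_V_combine[OF assms] add_minus_cancel)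

lemma int_V_V:
  assumes "0 \<le> h" "0 \<le> s" "z \<in> carrier X"
  shows "int_V 0 s (V h z) = V h (int_V 0 s z)"
proof (rule int_V_unique[symmetric])
  show "rlim (\<lambda>p. V h (rsum (\<lambda>u. V u z) p)) (V h (int_V 0 s z)) (riemann_filter 0 s)"
    by (rule op_rlim[OF V_op[OF assms(1)] int_V_lim[OF order_refl assms(2,3)]])
  fix p assume p: "p tagged_division_of {0..s}"
  have "rsum (\<lambda>u. V u (V h z)) p = rsum (\<lambda>u. V h (V u z)) p"
  proof (rule rsum_cong[OF p])
    show "V u (V h z) = V h (V u z)" if "u \<in> {0..s}" for u
      using that assms by (intro V_commute) auto
  qed (use assms in auto)
  also have "\<dots> = V h (rsum (\<lambda>u. V u z) p)"
    by (rule op_rsum[OF V_op[OF assms(1)] p V_orbit[OF order_refl assms(3)], symmetric])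
  finally show "V h (rsum (\<lambda>u. V u z) p) = rsum (\<lambda>u. V u (V h z)) p" ..
qed (use assms in auto)

lemma int_V_C: "0 \<le> s \<Longrightarrow> z \<in> carrier X \<Longrightarrow> int_V 0 s (C z) = C (int_V 0 s z)"
  using int_V_V[of 0 s z] by (simp add: V_0)

text \<open>Term by term, \<open>V h (V u z) = C (V (h + u) z)\<close>; the shift moves the division
  to \<open>{h..s + h}\<close>, and \<open>C\<close> leaves the integral by continuity. Here the
  semigroup law enters the integrals.\<close>

lemma V_int_V:
  assumes h: "0 \<le> h" and s: "0 \<le> s" and z: "z \<in> carrier X"
  shows "V h (int_V 0 s z) = C (int_V h (s + h) z)"
proof (rule rlim_unique[OF _ _ riemann_filter_neq_bot])
  show 1: "rlim (\<lambda>p. V h (rsum (\<lambda>u. V u z) p)) (V h (int_V 0 s z)) (riemann_filter 0 s)"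
    by (rule op_rlim[OF V_op[OF h] int_V_lim[OF order_refl s z]])
  have "rlim (rsum (\<lambda>u. V u z)) (int_V h (s + h) z) (riemann_filter (0 + h) (s + h))"
    using int_V_lim[of h "s + h" z] assms by simp
  then have lim: "rlim (\<lambda>p. C (rsum (\<lambda>u. V u z) (shift_division h p))) (C (int_V h (s + h) z)) (riemann_filter 0 s)"
    by (intro op_rlim[OF C_op] rlim_compose[OF _ filterlim_shift_division])
  have "\<forall>\<^sub>F p in riemann_filter 0 s. C (rsum (\<lambda>u. V u z) (shift_division h p)) = V h (rsum (\<lambda>u. V u z) p)"
    using eventually_riemann_filter_tagged[of 0 s]
  proof eventually_elim
    case p: (elim p)
    have "rsum (\<lambda>u. V u z) (shift_division h p) = rsum (\<lambda>u. V (h + u) z) p"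
      using h z by (intro rsum_shift_division[OF p]) auto
    moreover have "C (rsum (\<lambda>u. V (h + u) z) p) = rsum (\<lambda>u. C (V (h + u) z)) p"
      using h z by (intro op_rsum[OF C_op p]) auto
    moreover have "rsum (\<lambda>u. C (V (h + u) z)) p = rsum (\<lambda>u. V h (V u z)) p"
    proof (rule rsum_cong[OF p])
      show "C (V (h + u) z) = V h (V u z)" if "u \<in> {0..s}" for u
        using that h z by (intro C_V_add) auto
    qed (use h z in auto)
    moreover have "V h (rsum (\<lambda>u. V u z) p) = rsum (\<lambda>u. V h (V u z)) p"
      by (rule op_rsum[OF V_op[OF h] p V_orbit[OF order_refl z]])
    ultimately show ?case by simp
  qed
  then show "rlim (\<lambda>p. V h (rsum (\<lambda>u. V u z) p)) (C (int_V h (s + h) z)) (riemann_filter 0 s)"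
    using lim by (rule rlim_cong)
qed

subsection \<open>The generator\<close>

abbreviation D where "D \<equiv> gen_dom M X nrm C V"
abbreviation A where "A \<equiv> gen_op M X nrm C V"

abbreviation quot :: "real \<Rightarrow> 'x \<Rightarrow> 'x" where
  "quot h z \<equiv> rscale (1 / h) (V h z \<ominus>\<^bsub>X\<^esub> C z)"

lemma gen_limit_iff: "gen_limit M X nrm C V z l \<longleftrightarrow> rlim (\<lambda>h. quot h z) l (at_right 0)"
  by (simp add: gen_limit_def topology_eq)

lemma gen_limit_unique: "rlim f l (at_right (0::real)) \<Longrightarrow> rlim f l' (at_right 0) \<Longrightarrow> l = l'"
  by (rule rlim_unique) (auto simp: trivial_limit_at_right_real)

lemma generatorI:
  assumes "z \<in> carrier X" "y \<in> carrier X" "rlim (\<lambda>h. quot h z) (C y) (at_right 0)"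
  shows "z \<in> D \<and> A z = y"
proof
  show "z \<in> D" using assms unfolding gen_dom_def gen_limit_iff by blast
  have "(THE l. gen_limit M X nrm C V z l) = C y"
    unfolding gen_limit_iff using assms(3) by (rule the_equality) (rule gen_limit_unique[OF _ assms(3)])
  then show "A z = y" unfolding gen_op_def using assms(2) by (simp add: the_inv_into_f_f inj_C)
qed

lemma generatorD:
  assumes "z \<in> D"
  shows "z \<in> carrier X" "A z \<in> carrier X" "rlim (\<lambda>h. quot h z) (C (A z)) (at_right 0)"
proof -
  obtain y where y: "z \<in> carrier X" "y \<in> carrier X" "rlim (\<lambda>h. quot h z) (C y) (at_right 0)"
    using assms unfolding gen_dom_def gen_limit_iff by blast
  then have "A z = y" using generatorI by blast
  then show "z \<in> carrier X" "A z \<in> carrier X" "rlim (\<lambda>h. quot h z) (C (A z)) (at_right 0)" using y by auto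
qed

lemma at_right_0_cong:
  assumes "rlim f l (at_right (0::real))" "\<And>h. 0 < h \<Longrightarrow> f h = g h"
  shows "rlim g l (at_right 0)"
proof (rule rlim_cong[OF _ assms(1)])
  show "\<forall>\<^sub>F h in at_right 0. f h = g h"
    using eventually_at_right_less[of "0::real"] by eventually_elim (rule assms(2))
qed

text \<open>Commuting with every \<open>V h\<close>, in particular with \<open>C = V 0\<close>, lets
  \<open>T\<close> pass through the difference quotients, and continuity through their limit. One
  argument thus serves \<open>V s\<close>, \<open>C\<close> and multiplication by random
  scalars.\<close>

lemma generator_op:
  assumes T: "T \<in> BX" and z: "z \<in> D"
    and V: "\<And>h z. 0 \<le> h \<Longrightarrow> z \<in> carrier X \<Longrightarrow> T (V h z) = V h (T z)"
  shows "T z \<in> D \<and> A (T z) = T (A z)"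
proof (rule generatorI)
  note gz = generatorD[OF z]
  have C: "T (C x) = C (T x)" if "x \<in> carrier X" for x
    using V[of 0 x] that T by (simp add: V_0)
  show "rlim (\<lambda>h. quot h (T z)) (C (T (A z))) (at_right 0)"
  proof (rule at_right_0_cong)
    show "rlim (\<lambda>h. T (quot h z)) (C (T (A z))) (at_right 0)"
      using op_rlim[OF T gz(3)] gz(2) by (simp add: C)
    show "T (quot h z) = quot h (T z)" if "0 < h" for h
      using that gz(1) by (simp add: op_scaleK[OF T] op_minus[OF T] V C)
  qed
qed (use generatorD[OF z] T in auto)

lemma int_V_mean:
  "z \<in> carrier X \<Longrightarrow> rlim (\<lambda>h. rscale (1 / h) (int_V 0 h z)) (C z) (at_right 0)"
  using int_V_derivative[of z 0] by (simp add: V_0)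

lemma generator_int_V:
  assumes s: "0 \<le> s" and z: "z \<in> carrier X"
  shows "int_V 0 s z \<in> D \<and> A (int_V 0 s z) = V s z \<ominus>\<^bsub>X\<^esub> C z"
proof (rule generatorI)
  have "rlim (\<lambda>h. C (rscale (1 / h) (int_V s (s + h) z) \<ominus>\<^bsub>X\<^esub> rscale (1 / h) (int_V 0 h z)))
      (C (V s z \<ominus>\<^bsub>X\<^esub> C z)) (at_right 0)"
    by (intro op_rlim[OF C_op] rlim_minus int_V_derivative int_V_mean z s)
  then show "rlim (\<lambda>h. quot h (int_V 0 s z)) (C (V s z \<ominus>\<^bsub>X\<^esub> C z)) (at_right 0)"
  proof (rule at_right_0_cong)
    fix h :: real assume h: "0 < h"
    have c: "int_V s (s + h) z \<in> carrier X" "int_V 0 h z \<in> carrier X" "int_V 0 s z \<in> carrier X"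
      "int_V h (s + h) z \<in> carrier X" "int_V 0 (s + h) z \<in> carrier X" using h s z by auto
    \<comment> \<open>Written with integrals starting at 0, both sides are the integral to
      \<open>s + h\<close> minus those to \<open>s\<close> and to \<open>h\<close>. No comparison of
      \<open>h\<close> with \<open>s\<close> is required.\<close>
    have "int_V s (s + h) z \<ominus>\<^bsub>X\<^esub> int_V 0 h z = int_V h (s + h) z \<ominus>\<^bsub>X\<^esub> int_V 0 s z"
    proof -
      have "int_V s (s + h) z = int_V 0 (s + h) z \<ominus>\<^bsub>X\<^esub> int_V 0 s z"
        "int_V h (s + h) z = int_V 0 (s + h) z \<ominus>\<^bsub>X\<^esub> int_V 0 h z"
        using h s z by (simp_all add: int_V_diff)
      then show ?thesis using c by (simp add: RN.M.minus_eq RN.M.a_ac)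
    qed
    then show "C (rscale (1 / h) (int_V s (s + h) z) \<ominus>\<^bsub>X\<^esub> rscale (1 / h) (int_V 0 h z)) = quot h (int_V 0 s z)"
      using c h s z by (simp add: V_int_V op_minus[OF C_op] op_scaleK[OF C_op] flip: scaleK_minus_right)
  qed
qed (use s z in auto)

lemma int_V_generator:
  assumes s: "0 \<le> s" and z: "z \<in> D"
  shows "int_V 0 s (A z) = V s z \<ominus>\<^bsub>X\<^esub> C z"
proof (rule C_cancel)
  note gz = generatorD[OF z]
  note J = int_V_op[OF s]
  have "rlim (\<lambda>h. quot h (int_V 0 s z)) (C (V s z \<ominus>\<^bsub>X\<^esub> C z)) (at_right 0)"
    using generatorD(3)[of "int_V 0 s z"] generator_int_V[OF s gz(1)] by simp
  \<comment> \<open>A second evaluation of the same limit: the quotients commute with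
    \<open>int_V 0 s\<close>, and the limit of the quotients of \<open>z\<close> is
    \<open>C (A z)\<close>. Uniqueness then gives an equation, where \<open>C\<close> may be
    cancelled.\<close>
  moreover have "rlim (\<lambda>h. quot h (int_V 0 s z)) (C (int_V 0 s (A z))) (at_right 0)"
  proof (rule at_right_0_cong)
    show "rlim (\<lambda>h. int_V 0 s (quot h z)) (C (int_V 0 s (A z))) (at_right 0)"
      using op_rlim[OF J gz(3)] gz(2) s by (simp add: int_V_C)
    show "int_V 0 s (quot h z) = quot h (int_V 0 s z)" if "0 < h" for h
      using that gz(1) s by (simp add: op_scaleK[OF J] op_minus[OF J] int_V_V int_V_C)
  qed
  ultimately show "C (int_V 0 s (A z)) = C (V s z \<ominus>\<^bsub>X\<^esub> C z)" using gen_limit_unique by blast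
qed (use generatorD[OF z] s in auto)

text \<open>The equations on the right-hand side are closed conditions on \<open>(x, y)\<close> and are
  preserved by cancelling \<open>C\<close>.\<close>

lemma generator_graph_iff:
  "x \<in> D \<and> A x = y \<longleftrightarrow> x \<in> carrier X \<and> y \<in> carrier X \<and> (\<forall>s>0. V s x \<ominus>\<^bsub>X\<^esub> C x = int_V 0 s y)"
proof
  assume "x \<in> D \<and> A x = y"
  then show "x \<in> carrier X \<and> y \<in> carrier X \<and> (\<forall>s>0. V s x \<ominus>\<^bsub>X\<^esub> C x = int_V 0 s y)"
    using generatorD[of x] int_V_generator[of _ x] by auto
next
  assume *: "x \<in> carrier X \<and> y \<in> carrier X \<and> (\<forall>s>0. V s x \<ominus>\<^bsub>X\<^esub> C x = int_V 0 s y)"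
  have "rlim (\<lambda>h. rscale (1 / h) (int_V 0 h y)) (C y) (at_right 0)" using * by (intro int_V_mean) blast
  then have "rlim (\<lambda>h. quot h x) (C y) (at_right 0)" by (rule at_right_0_cong) (use * in simp)
  then show "x \<in> D \<and> A x = y" using * by (intro generatorI) auto
qed

lemma generator_V: "0 \<le> s \<Longrightarrow> z \<in> D \<Longrightarrow> V s z \<in> D \<and> A (V s z) = V s (A z)"
  by (rule generator_op[OF V_op]) (auto simp: V_commute)

text \<open>By the integrated equation, increments of the orbit are integrals of
  \<open>V u (A z)\<close>, and their averages tend to \<open>V s (A z)\<close>.\<close>

lemma V_derivative:
  assumes s: "0 \<le> s" and z: "z \<in> D"
  shows "RN_has_derivative M X nrm (\<lambda>t. V t z) (V s (A z)) s {0..}"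
  unfolding RN_has_derivative_def topology_eq rlim_iff
proof (intro conjI tendstoI)
  note gz = generatorD[OF z]
  show "V s (A z) \<in> carrier X" using s gz by simp
  have t0: "\<forall>\<^sub>F t in at s within {0..}. t \<in> {0..} \<and> t \<noteq> s"
    unfolding eventually_at_filter by simp
  then show "\<forall>\<^sub>F t in at s within {0..}. rscale (1 / (t - s)) (V t z \<ominus>\<^bsub>X\<^esub> V s z) \<in> carrier X"
    by eventually_elim (use s gz in simp)
  have diff: "V v z \<ominus>\<^bsub>X\<^esub> V u z = int_V u v (A z)" if "0 \<le> u" "u \<le> v" for u v
  proof -
    have "V v z \<ominus>\<^bsub>X\<^esub> V u z = (V v z \<ominus>\<^bsub>X\<^esub> C z) \<ominus>\<^bsub>X\<^esub> (V u z \<ominus>\<^bsub>X\<^esub> C z)"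
    proof -
      have "(V v z \<ominus>\<^bsub>X\<^esub> C z) \<ominus>\<^bsub>X\<^esub> (V u z \<ominus>\<^bsub>X\<^esub> C z) = (V v z \<ominus>\<^bsub>X\<^esub> V u z) \<ominus>\<^bsub>X\<^esub> \<zero>\<^bsub>X\<^esub>"
        using that gz(1) minus_minus_swap[of "V v z" "C z" "V u z" "C z"] by simp
      then show ?thesis using that gz(1) by (simp add: RN.M.minus_eq)
    qed
    also have "\<dots> = int_V 0 v (A z) \<ominus>\<^bsub>X\<^esub> int_V 0 u (A z)" using that z by (simp add: int_V_generator)
    also have "\<dots> = int_V u v (A z)" using that gz by (simp add: int_V_diff)
    finally show ?thesis .
  qed
  fix e :: real assume "e > 0"
  then obtain d where "d > 0" and d: "\<forall>u v. 0 \<le> u \<and> u \<le> s \<and> s \<le> v \<and> u < v \<and> v - u < d \<longrightarrow>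
    fnorm (rscale (1 / (v - u)) (int_V u v (A z)) \<ominus>\<^bsub>X\<^esub> V s (A z)) \<le> e / 2"
    using int_V_mean_value[OF gz(2) s half_gt_zero] by blast
  have "\<forall>\<^sub>F t in at s within {0..}. dist t s < d" using \<open>d > 0\<close> by (auto simp: eventually_at)
  with t0 show "\<forall>\<^sub>F t in at s within {0..}.
      dist (fnorm (rscale (1 / (t - s)) (V t z \<ominus>\<^bsub>X\<^esub> V s z) \<ominus>\<^bsub>X\<^esub> V s (A z))) 0 < e"
  proof eventually_elim
    case (elim t)
    \<comment> \<open>Quotients from the right and from the left become averages over an interval
      that begins or ends at \<open>s\<close>; for \<open>t < s\<close> the sign of
      \<open>t - s\<close> is absorbed by exchanging the endpoints.\<close>
    have "\<exists>u v. 0 \<le> u \<and> u \<le> s \<and> s \<le> v \<and> u < v \<and> v - u < d \<and>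
        rscale (1 / (t - s)) (V t z \<ominus>\<^bsub>X\<^esub> V s z) = rscale (1 / (v - u)) (int_V u v (A z))"
    proof (cases "s < t")
      case True
      then show ?thesis
        using elim s diff[of s t] by (intro exI[of _ s] exI[of _ t]) (auto simp: dist_real_def)
    next
      case False
      then have t: "0 \<le> t" "t < s" using elim by auto
      have i: "int_V t s (A z) \<in> carrier X" using t gz by simp
      have "V t z \<ominus>\<^bsub>X\<^esub> V s z = \<ominus>\<^bsub>X\<^esub> (V s z \<ominus>\<^bsub>X\<^esub> V t z)" using t s gz by (simp add: uminus_minus)
      also have "\<dots> = rscale (- 1) (int_V t s (A z))" using t i by (simp add: diff scaleK_uminus)
      finally have "rscale (1 / (t - s)) (V t z \<ominus>\<^bsub>X\<^esub> V s z) = rscale (1 / (t - s) * (- 1)) (int_V t s (A z))"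
        using i by (simp only: scaleK_scaleK of_real_mult)
      also have "1 / (t - s) * (- 1) = 1 / (s - t)" using t by (simp add: field_simps)
      finally show ?thesis
        using elim t by (intro exI[of _ t] exI[of _ s]) (auto simp: dist_real_def)
    qed
    then obtain u v where "0 \<le> u \<and> u \<le> s \<and> s \<le> v \<and> u < v \<and> v - u < d"
      and eq: "rscale (1 / (t - s)) (V t z \<ominus>\<^bsub>X\<^esub> V s z) = rscale (1 / (v - u)) (int_V u v (A z))" by blast
    then have "fnorm (rscale (1 / (t - s)) (V t z \<ominus>\<^bsub>X\<^esub> V s z) \<ominus>\<^bsub>X\<^esub> V s (A z)) \<le> e / 2"
      unfolding eq using d by blast
    moreover have "rscale (1 / (t - s)) (V t z \<ominus>\<^bsub>X\<^esub> V s z) \<ominus>\<^bsub>X\<^esub> V s (A z) \<in> carrier X"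
      using elim s gz by simp
    ultimately show ?case using \<open>e > 0\<close> by simp
  qed
qed

section \<open>Module structure, closedness and the relation to \<open>C\<close>\<close>

lemma generator_smult: "\<xi> \<in> L0 M \<Longrightarrow> x \<in> D \<Longrightarrow> \<xi> \<odot>\<^bsub>X\<^esub> x \<in> D \<and> A (\<xi> \<odot>\<^bsub>X\<^esub> x) = \<xi> \<odot>\<^bsub>X\<^esub> A x"
  by (rule generator_op[OF smult_op]) (auto simp: op_smult[OF V_op])

lemma generator_add:
  assumes x: "x \<in> D" and y: "y \<in> D"
  shows "x \<oplus>\<^bsub>X\<^esub> y \<in> D \<and> A (x \<oplus>\<^bsub>X\<^esub> y) = A x \<oplus>\<^bsub>X\<^esub> A y"
proof (rule generatorI)
  note gx = generatorD[OF x] and gy = generatorD[OF y]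
  show "rlim (\<lambda>h. quot h (x \<oplus>\<^bsub>X\<^esub> y)) (C (A x \<oplus>\<^bsub>X\<^esub> A y)) (at_right 0)"
  proof (rule at_right_0_cong)
    show "rlim (\<lambda>h. quot h x \<oplus>\<^bsub>X\<^esub> quot h y) (C (A x \<oplus>\<^bsub>X\<^esub> A y)) (at_right 0)"
      using rlim_add[OF gx(3) gy(3)] gx(2) gy(2) by (simp add: op_add[OF C_op])
    show "quot h x \<oplus>\<^bsub>X\<^esub> quot h y = quot h (x \<oplus>\<^bsub>X\<^esub> y)" if "0 < h" for h
      using that gx(1) gy(1)
      by (simp add: op_add[OF C_op] op_add[OF V_op] minus_add_swap scaleK_add_right)
  qed
qed (use generatorD[OF x] generatorD[OF y] in auto)

lemma generator_module_hom: "module_hom_on M X D A"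
  unfolding module_hom_on_def
proof (intro conjI ballI)
  have sc: "scaleK M X c x \<in> D" if "x \<in> D" for c x
    using generator_smult[OF L0_const_in that] by (simp add: scaleK_def)
  have "int_V 0 0 \<zero>\<^bsub>X\<^esub> \<in> D" using generator_int_V[of 0 "\<zero>\<^bsub>X\<^esub>"] by simp
  then have zero: "\<zero>\<^bsub>X\<^esub> \<in> D" using int_V_op[of 0] by simp
  show "submodule D (L0_ring M) X"
  proof (rule RN.submoduleI)
    show "D \<subseteq> carrier X" using generatorD(1) by blast
    show "\<ominus>\<^bsub>X\<^esub> x \<in> D" if "x \<in> D" for x
      using sc[OF that, of "- 1"] generatorD(1)[OF that] by (simp add: scaleK_uminus)
  qed (auto simp: zero generator_add generator_smult L0_carrier)
  show "A \<in> D \<rightarrow> carrier X" using generatorD(2) by blast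
qed (auto simp: generator_add generator_smult)

text \<open>By \<open>generator_graph_iff\<close> the graph is an intersection over
  \<open>s > 0\<close> of sets on which two continuous maps into a Hausdorff space agree.\<close>

lemma generator_closed_op: "closed_op_on M X nrm D A"
proof -
  let ?P = "prod_topology RD.mtopology RD.mtopology"
  define G where "G s = {p \<in> topspace ?P. V s (fst p) \<ominus>\<^bsub>X\<^esub> C (fst p) = int_V 0 s (snd p)}" for s
  have "closedin ?P (G s)" if s: "s > 0" for s
    unfolding G_def
  proof (rule closedin_continuous_maps_eq[OF RD.Hausdorff_space_mtopology])
    have "rlim (\<lambda>x. V s x \<ominus>\<^bsub>X\<^esub> C x) (V s x \<ominus>\<^bsub>X\<^esub> C x) (atin RD.mtopology x)"
      if "x \<in> carrier X" for x
      using op_continuous[OF V_op, of s] op_continuous[OF C_op] s that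
      by (intro rlim_minus) (auto simp: continuous_map_atin)
    then have "continuous_map RD.mtopology RD.mtopology (\<lambda>x. V s x \<ominus>\<^bsub>X\<^esub> C x)"
      by (simp add: continuous_map_atin)
    from continuous_map_compose[OF continuous_map_fst this]
    show "continuous_map ?P RD.mtopology (\<lambda>p. V s (fst p) \<ominus>\<^bsub>X\<^esub> C (fst p))" by (simp add: o_def)
    show "continuous_map ?P RD.mtopology (\<lambda>p. int_V 0 s (snd p))"
      using continuous_map_compose[OF continuous_map_snd op_continuous[OF int_V_op[of s]]] s
      by (simp add: o_def)
  qed
  then have "closedin ?P (\<Inter>s\<in>{0<..}. G s)" by (intro closedin_INT) auto
  also have "(\<Inter>s\<in>{0<..}. G s) = {(x, A x) | x. x \<in> D}"
  proof (rule Set.set_eqI)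
    fix p :: "'x \<times> 'x"
    obtain x y where p: "p = (x, y)" by (cases p)
    have "p \<in> (\<Inter>s\<in>{0<..}. G s) \<longleftrightarrow> x \<in> carrier X \<and> y \<in> carrier X \<and> (\<forall>s>0. V s x \<ominus>\<^bsub>X\<^esub> C x = int_V 0 s y)"
      \<comment> \<open>Some positive number must exist for membership in the intersection to imply
        that \<open>x\<close> and \<open>y\<close> lie in the carrier.\<close>
      unfolding p G_def using gt_ex[of "0::real"] by auto
    also have "\<dots> \<longleftrightarrow> x \<in> D \<and> A x = y" by (rule generator_graph_iff[symmetric])
    also have "\<dots> \<longleftrightarrow> p \<in> {(x, A x) | x. x \<in> D}" by (auto simp: p)
    finally show "p \<in> (\<Inter>s\<in>{0<..}. G s) \<longleftrightarrow> p \<in> {(x, A x) | x. x \<in> D}" .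
  qed
  finally show ?thesis by (simp add: closed_op_on_def topology_eq)
qed

lemma generator_C: "x \<in> D \<Longrightarrow> C x \<in> D \<and> A (C x) = C (A x)"
  by (rule generator_op[OF C_op]) (auto simp: V_C_commute)

text \<open>The substantial inclusion behind \<open>C^-1 A C = A\<close>: since \<open>C\<close>
  commutes with \<open>V s\<close> and with the integral, the graph equations of
  \<open>(C x, C y)\<close> are \<open>C\<close> applied to those of \<open>(x, y)\<close>.\<close>

lemma generator_C_inverse:
  assumes x: "x \<in> carrier X" and y: "y \<in> carrier X" and "C x \<in> D" "A (C x) = C y"
  shows "x \<in> D \<and> A x = y"
  unfolding generator_graph_iff
proof (intro conjI allI impI x y)
  fix s :: real assume s: "s > 0"
  have "V s (C x) \<ominus>\<^bsub>X\<^esub> C (C x) = int_V 0 s (C y)"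
    using generator_graph_iff[of "C x" "C y"] assms s by blast
  then have "C (V s x \<ominus>\<^bsub>X\<^esub> C x) = C (int_V 0 s y)"
    using s x y by (simp add: V_C_commute int_V_C op_minus[OF C_op])
  then show "V s x \<ominus>\<^bsub>X\<^esub> C x = int_V 0 s y" by (rule C_cancel) (use s x y in auto)
qed

text \<open>\<open>C z\<close> is the limit of the means \<open>(1 / h) * int_V 0 h z\<close>, which
  are scalar multiples of elements of \<open>D\<close> and hence in \<open>D\<close>.\<close>

lemma range_C_closure: "C ` carrier X \<subseteq> RD.mtopology closure_of D"
proof safe
  fix z assume z: "z \<in> carrier X"
  have "D \<subseteq> RD.mtopology closure_of D" using generatorD(1) by (intro closure_of_subset) auto
  have "\<forall>\<^sub>F h in at_right 0. rscale (1 / h) (int_V 0 h z) \<in> RD.mtopology closure_of D"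
    using eventually_at_right_less[of "0::real"]
  proof eventually_elim
    case (elim h)
    then have "int_V 0 h z \<in> D" using generator_int_V[of h z] z by simp
    then have "rscale (1 / h) (int_V 0 h z) \<in> D"
      using generator_smult[OF L0_const_in] by (simp add: scaleK_def)
    then show ?case using \<open>D \<subseteq> RD.mtopology closure_of D\<close> by blast
  qed
  then show "C z \<in> RD.mtopology closure_of D"
    by (rule limitin_closedin[OF int_V_mean[OF z] closedin_closure_of]) (simp add: trivial_limit_at_right_real)
qed

end

theorem theorem4p4:
  fixes M :: "'a measure"
    and X :: "(('a \<Rightarrow> 'k::{real_normed_field, euclidean_space}) set, 'x) Module.module"
    and nrm :: "'x \<Rightarrow> ('a \<Rightarrow> real) set"
    and C :: "'x \<Rightarrow> 'x"
    and V :: "real \<Rightarrow> 'x \<Rightarrow> 'x"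
    and D :: "'x set"
    and A :: "'x \<Rightarrow> 'x"
    and \<tau> :: "'x topology"
  assumes "RN_module M X nrm"
    and "RN_complete M X nrm"
    and "C \<in> as_bounded_ops M X nrm"
    and "inj_on C (carrier X)"
    and "C_semigroup M X nrm C V"
    and "locally_as_bounded M X nrm V"
    and "\<tau> = eps_lambda_topology M X nrm"
    and "D = gen_dom M X nrm C V"
    and "A = gen_op M X nrm C V"
  shows
    "\<comment> \<open>the integrals below exist\<close>
     (\<forall>z\<in>carrier X. \<forall>s\<ge>0. RN_integrable M X nrm 0 s (\<lambda>u. V u z)) \<and>
     \<comment> \<open>(1)\<close>
     (\<forall>z\<in>carrier X.
        limitin \<tau> (\<lambda>s. scaleK M X (of_real (1 / s)) (RN_integral M X nrm 0 s (\<lambda>u. V u z)))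
          (C z) (at_right 0)) \<and>
     \<comment> \<open>(2)\<close>
     (\<forall>z\<in>carrier X. \<forall>s\<ge>0.
        RN_integral M X nrm 0 s (\<lambda>u. V u z) \<in> D \<and>
        A (RN_integral M X nrm 0 s (\<lambda>u. V u z)) = V s z \<ominus>\<^bsub>X\<^esub> C z) \<and>
     \<comment> \<open>(3)\<close>
     C ` carrier X \<subseteq> \<tau> closure_of D \<and>
     \<comment> \<open>(4)\<close>
     (\<forall>z\<in>D. \<forall>s\<ge>0.
        V s z \<in> D \<and>
        RN_has_derivative M X nrm (\<lambda>t. V t z) (V s (A z)) s {0..} \<and>
        V s (A z) = A (V s z)) \<and>
     \<comment> \<open>(5)\<close>
     (\<forall>z\<in>D. \<forall>s\<ge>0. RN_integral M X nrm 0 s (\<lambda>u. V u (A z)) = V s z \<ominus>\<^bsub>X\<^esub> C z) \<and>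
     \<comment> \<open>(6)\<close>
     module_hom_on M X D A \<and>
     closed_op_on M X nrm D A \<and>
     {x \<in> carrier X. C x \<in> D \<and> A (C x) \<in> C ` carrier X} = D \<and>
     (\<forall>x\<in>D. the_inv_into (carrier X) C (A (C x)) = A x)"
proof -
  note \<tau> = assms(7) and D = assms(8) and A = assms(9)
  interpret RN_C_semigroup M X nrm C V
    using assms(1,2,5,6) by (intro RN_C_semigroup.intro RN_C_semigroup_axioms.intro)
  have int: "RN_integral M X nrm 0 s (\<lambda>u. V u z) = int_V 0 s z" for s z
    by (simp add: int_V_def)
  have integrable: "RN_integrable M X nrm 0 s (\<lambda>u. V u z)" if "z \<in> carrier X" "0 \<le> s" for z s
    unfolding RN_integrable_def
    using int_V_lim[OF order_refl that(2,1)] has_integral_iff[OF V_orbit[OF order_refl that(1)]] by blast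
  \<comment> \<open>Facts \<open>1\<close> and \<open>2\<close> together are
    \<open>C^-1 A C = A\<close>, first the equality of domains and then that of values.\<close>
  have 1: "{x \<in> carrier X. C x \<in> D \<and> A (C x) \<in> C ` carrier X} = D"
    unfolding D A
  proof (intro equalityI subsetI)
    fix x assume "x \<in> {x \<in> carrier X. C x \<in> gen_dom M X nrm C V \<and> gen_op M X nrm C V (C x) \<in> C ` carrier X}"
    then show "x \<in> gen_dom M X nrm C V" using generator_C_inverse by blast
  next
    fix x assume x: "x \<in> gen_dom M X nrm C V"
    then show "x \<in> {x \<in> carrier X. C x \<in> gen_dom M X nrm C V \<and> gen_op M X nrm C V (C x) \<in> C ` carrier X}"
      using generator_C[OF x] generatorD(1,2)[OF x] by simp
  qed
  have 2: "the_inv_into (carrier X) C (A (C x)) = A x" if "x \<in> D" for x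
  proof -
    have x: "x \<in> gen_dom M X nrm C V" using that by (simp add: D)
    show ?thesis
      unfolding A conjunct2[OF generator_C[OF x]] by (rule the_inv_into_f_f[OF inj_C generatorD(2)[OF x]])
  qed
  show ?thesis
    unfolding int
  proof (intro conjI ballI allI impI)
    show "RN_integrable M X nrm 0 s (\<lambda>u. V u z)" if "z \<in> carrier X" "0 \<le> s" for z s
      using that by (rule integrable)
    show "limitin \<tau> (\<lambda>s. rscale (1 / s) (int_V 0 s z)) (C z) (at_right 0)" if "z \<in> carrier X" for z
      unfolding \<tau> topology_eq using that by (rule int_V_mean)
    show "int_V 0 s z \<in> D" "A (int_V 0 s z) = V s z \<ominus>\<^bsub>X\<^esub> C z" if "z \<in> carrier X" "0 \<le> s" for z s
      unfolding D A using generator_int_V[OF that(2,1)] by simp_all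
    show "C ` carrier X \<subseteq> \<tau> closure_of D"
      unfolding \<tau> D topology_eq by (rule range_C_closure)
    show "V s z \<in> D" "V s (A z) = A (V s z)" if "z \<in> D" "0 \<le> s" for z s
      using generator_V[OF that(2) that(1)[unfolded D]] unfolding D A by simp_all
    show "RN_has_derivative M X nrm (\<lambda>t. V t z) (V s (A z)) s {0..}" if "z \<in> D" "0 \<le> s" for z s
      unfolding A by (rule V_derivative[OF that(2) that(1)[unfolded D]])
    show "int_V 0 s (A z) = V s z \<ominus>\<^bsub>X\<^esub> C z" if "z \<in> D" "0 \<le> s" for z s
      unfolding A by (rule int_V_generator[OF that(2) that(1)[unfolded D]])
    show "module_hom_on M X D A" unfolding D A by (rule generator_module_hom)
    show "closed_op_on M X nrm D A" unfolding D A by (rule generator_closed_op)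
    show "{x \<in> carrier X. C x \<in> D \<and> A (C x) \<in> C ` carrier X} = D" by (rule 1)
    show "the_inv_into (carrier X) C (A (C x)) = A x" if "x \<in> D" for x using that by (rule 2)
  qed
qed

end
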